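(* Let $G_1\subset G_2$ be finite subgroups of $\mathrm{SL}(2,\mathbb{C})$ and let $i\colon\mathbb{C}[u,v]^{G_2}\to\mathbb{C}[u,v]^{G_1}$ be the inclusion. Let $R$ be a commutative graded algebra with $R_0=\mathbb{C}$ and all $R_j$ finite-dimensional, let $\mathcal{B}$ be a commutative deformation of $\mathbb{C}[u,v]^{G_2}$ over $R$, and let $F_1\colon\mathcal{B}\to\mathcal{A}_1$ and $F_2\colon\mathcal{B}\to\mathcal{A}_2$ be two (commutative) deformations of $i$ over $R$. Then there exists an isomorphism of deformations $g\colon\mathcal{A}_1\to\mathcal{A}_2$ of $\mathbb{C}[u,v]^{G_1}$ such that $F_2=gF_1$.
   Context: All algebras are associative unital $\mathbb{C}$-algebras, graded by nonnegative integers when graded; $\deg u=\deg v=1$. Put $\mathfrak{m}=R_{>0}$. A commutative deformation of a commutative graded algebra $A$ over $R$ is a pair $(\mathcal{A},\chi)$, where $\mathcal{A}$ is a commutative graded $R$-algebra, flat as an $R$-module, and $\chi\colon\mathcal{A}/\mathfrak{m}\mathcal{A}\to A$ is an isomorphism of graded algebras. A morphism from a deformation $(\mathcal{A},\chi)$ over $R$ to a deformation $(\mathcal{B},\psi)$ over $S$ is a graded algebra homomorphism $f\colon\mathcal{A}\to\mathcal{B}$ with $f(R)\subset S$ and $\psi\circ\bar f=\chi$, where $\bar f\colon\mathcal{A}/R_{>0}\mathcal{A}\to\mathcal{B}/S_{>0}\mathcal{B}$ is induced by $f$; an isomorphism of deformations is an invertible morphism. A deformation over $R$ of a homomorphism of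 graded algebras $f\colon A\to B$ is an $R$-linear homomorphism of graded algebras $F\colon\mathcal{A}\to\mathcal{B}$, where $\mathcal{A},\mathcal{B}$ are deformations of $A,B$ over $R$, such that the induced map $\mathcal{A}/\mathfrak{m}\mathcal{A}\to\mathcal{B}/\mathfrak{m}\mathcal{B}$ coincides with $f$ after the identifications with $A$ and $B$. *)

theory Defs
  imports
    "HOL-Analysis.Determinants"
    "HOL-Computational_Algebra.Polynomial"
    "HOL-Algebra.QuotRing"
    "HOL-Algebra.Embedded_Algebras"
    "HOL-Algebra.Free_Abelian_Groups"
begin

section \<open>Graded algebras\<close>

text \<open>All algebras are commutative and unital; gradings are indexed by the natural numbers.\<close>

record ('a, 'b) gr_alg = "('a, 'b) module" +
  grade :: "nat \<Rightarrow> 'b set"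

text \<open>
  A graded algebra over a graded base ring.  Taking as base the complex numbers, concentrated
  in degree zero, gives graded \<open>\<complex>\<close>-algebras with \<open>\<complex>\<close>-linear homogeneous components.
\<close>

locale graded_algebra = Module.algebra R A
  for R :: "('k, 'r) gr_alg" (structure) and A :: "('r, 'a) gr_alg" (structure) +
  assumes grade_subgroup: "additive_subgroup (grade A i) A"
    and grade_decomp: "x \<in> carrier A \<Longrightarrow>
      \<exists>!f. (\<forall>i. f i \<in> grade A i) \<and> finite {i. f i \<noteq> \<zero>\<^bsub>A\<^esub>} \<and> x = finsum A f {i. f i \<noteq> \<zero>\<^bsub>A\<^esub>}"
    and grade_one: "\<one>\<^bsub>A\<^esub> \<in> grade A 0"
    and grade_mult: "\<lbrakk>x \<in> grade A i; y \<in> grade A j\<rbrakk> \<Longrightarrow> x \<otimes>\<^bsub>A\<^esub> y \<in> grade A (i + j)"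
    and grade_smult: "\<lbrakk>r \<in> grade R i; x \<in> grade A j\<rbrakk> \<Longrightarrow> r \<odot>\<^bsub>A\<^esub> x \<in> grade A (i + j)"

definition complex_base :: "(complex, complex) gr_alg" where
  "complex_base =
    \<lparr>carrier = UNIV, monoid.mult = (*), one = 1, ring.zero = 0, add = (+), module.smult = (*),
     grade = (\<lambda>d. if d = 0 then UNIV else {0})\<rparr>"

definition graded_hom ::
  "('k, 'r) gr_alg \<Rightarrow> ('r, 'a) gr_alg \<Rightarrow> ('r, 'b) gr_alg \<Rightarrow> ('a \<Rightarrow> 'b) \<Rightarrow> bool" where
  "graded_hom R A B f \<longleftrightarrow>
     f \<in> ring_hom A B \<and>
     (\<forall>r\<in>carrier R. \<forall>a\<in>carrier A. f (r \<odot>\<^bsub>A\<^esub> a) = r \<odot>\<^bsub>B\<^esub> f a) \<and>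
     (\<forall>d. f ` grade A d \<subseteq> grade B d)"

definition graded_iso ::
  "('k, 'r) gr_alg \<Rightarrow> ('r, 'a) gr_alg \<Rightarrow> ('r, 'b) gr_alg \<Rightarrow> ('a \<Rightarrow> 'b) \<Rightarrow> bool" where
  "graded_iso R A B f \<longleftrightarrow> graded_hom R A B f \<and> bij_betw f (carrier A) (carrier B) \<and>
     (\<forall>d. f ` grade A d = grade B d)"

text \<open>For the base ring \<open>R\<close> this is the ideal \<open>\<mm> = R\<^sub>>\<^sub>0\<close>.\<close>

definition positive_part :: "('k, 'r) gr_alg \<Rightarrow> 'r set" where
  "positive_part R = {finsum R f {1..n} | f n. \<forall>i. f i \<in> grade R i}"

text \<open>The \<open>\<complex>\<close>-algebra underlying an algebra over a \<open>\<complex>\<close>-algebra \<open>R\<close>.\<close>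

definition restrict_scalars :: "(complex, 'r) gr_alg \<Rightarrow> ('r, 'a) gr_alg \<Rightarrow> (complex, 'a) gr_alg" where
  "restrict_scalars R A =
    \<lparr>carrier = carrier A, monoid.mult = monoid.mult A, one = one A, ring.zero = ring.zero A, add = add A,
     module.smult = (\<lambda>c a. (c \<odot>\<^bsub>R\<^esub> \<one>\<^bsub>R\<^esub>) \<odot>\<^bsub>A\<^esub> a), grade = grade A\<rparr>"

text \<open>The grading is meaningful only for a homogeneous ideal \<open>I\<close>.\<close>

definition quotient_algebra :: "('r, 'a) gr_alg \<Rightarrow> 'a set \<Rightarrow> ('r, 'a set) gr_alg" where
  "quotient_algebra A I =
    \<lparr>carrier = carrier (A Quot I), monoid.mult = monoid.mult (A Quot I), one = one (A Quot I),
     ring.zero = ring.zero (A Quot I), add = add (A Quot I),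
     module.smult = (\<lambda>r X. I <+>\<^bsub>A\<^esub> ((\<lambda>x. r \<odot>\<^bsub>A\<^esub> x) ` X)),
     grade = (\<lambda>d. (\<lambda>a. I +>\<^bsub>A\<^esub> a) ` grade A d)\<rparr>"

section \<open>Flat modules\<close>

definition tensor_relations ::
  "('r, 'm) ring_scheme \<Rightarrow> ('r, 'a, 'n) module_scheme \<Rightarrow> ('r, 'b, 'o) module_scheme \<Rightarrow>
   ('a \<times> 'b \<Rightarrow>\<^sub>0 int) set" where
  "tensor_relations R N M =
     {frag_of (x \<oplus>\<^bsub>N\<^esub> x', y) - frag_of (x, y) - frag_of (x', y) | x x' y.
        x \<in> carrier N \<and> x' \<in> carrier N \<and> y \<in> carrier M} \<union>
     {frag_of (x, y \<oplus>\<^bsub>M\<^esub> y') - frag_of (x, y) - frag_of (x, y') | x y y'.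
        x \<in> carrier N \<and> y \<in> carrier M \<and> y' \<in> carrier M} \<union>
     {frag_of (r \<odot>\<^bsub>N\<^esub> x, y) - frag_of (x, r \<odot>\<^bsub>M\<^esub> y) | r x y.
        r \<in> carrier R \<and> x \<in> carrier N \<and> y \<in> carrier M}"

definition tensor_kernel ::
  "('r, 'm) ring_scheme \<Rightarrow> ('r, 'a, 'n) module_scheme \<Rightarrow> ('r, 'b, 'o) module_scheme \<Rightarrow>
   ('a \<times> 'b \<Rightarrow>\<^sub>0 int) set" where
  "tensor_kernel R N M =
     generate (free_Abelian_group (carrier N \<times> carrier M)) (tensor_relations R N M)"

definition tensor ::
  "('r, 'm) ring_scheme \<Rightarrow> ('r, 'a, 'n) module_scheme \<Rightarrow> ('r, 'b, 'o) module_scheme \<Rightarrow>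
   ('a \<times> 'b \<Rightarrow>\<^sub>0 int) set monoid" where
  "tensor R N M = free_Abelian_group (carrier N \<times> carrier M) Mod tensor_kernel R N M"

text \<open>The map \<open>h \<otimes> id : N \<otimes> M \<rightarrow> N' \<otimes> M\<close>; \<open>X\<close> is a coset in the source, and adding the kernel
  saturates its image to a coset in the target.\<close>

definition tensor_map ::
  "('r, 'm) ring_scheme \<Rightarrow> ('r, 'b, 'n) module_scheme \<Rightarrow> ('r, 'c, 'o) module_scheme \<Rightarrow>
   ('a \<Rightarrow> 'b) \<Rightarrow> ('a \<times> 'c \<Rightarrow>\<^sub>0 int) set \<Rightarrow> ('b \<times> 'c \<Rightarrow>\<^sub>0 int) set" where
  "tensor_map R N' M h X =
     tensor_kernel R N' M <#>\<^bsub>free_Abelian_group (carrier N' \<times> carrier M)\<^esub>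
       frag_extend (\<lambda>(x, y). frag_of (h x, y)) ` X"

definition linear_map ::
  "('r, 'm) ring_scheme \<Rightarrow> ('r, 'a, 'n) module_scheme \<Rightarrow> ('r, 'b, 'o) module_scheme \<Rightarrow>
   ('a \<Rightarrow> 'b) \<Rightarrow> bool" where
  "linear_map R N N' h \<longleftrightarrow>
     h \<in> carrier N \<rightarrow> carrier N' \<and>
     (\<forall>x\<in>carrier N. \<forall>y\<in>carrier N. h (x \<oplus>\<^bsub>N\<^esub> y) = h x \<oplus>\<^bsub>N'\<^esub> h y) \<and>
     (\<forall>r\<in>carrier R. \<forall>x\<in>carrier N. h (r \<odot>\<^bsub>N\<^esub> x) = r \<odot>\<^bsub>N'\<^esub> h x)"

text \<open>
  \<open>M\<close> is flat if tensoring with \<open>M\<close> preserves injections of \<open>R\<close>-modules.  A definition cannot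
  quantify over all types, so the test modules are those whose carrier is a subset of the type
  \<open>'r\<close> of \<open>R\<close>.  They include \<open>R\<close> and all its ideals with their inclusions into \<open>R\<close>, and
  these already detect flatness, so nothing is lost by the restriction.
\<close>

definition flat :: "('r, 'm) ring_scheme \<Rightarrow> ('r, 'a, 'n) module_scheme \<Rightarrow> bool" where
  "flat R M \<longleftrightarrow>
     (\<forall>(N :: ('r, 'r) module) (N' :: ('r, 'r) module) h.
        Module.module R N \<and> Module.module R N' \<and> linear_map R N N' h \<and> inj_on h (carrier N) \<longrightarrow>
        inj_on (tensor_map R N' M h) (carrier (tensor R N M)))"

section \<open>Deformations\<close>

text \<open>The ideal \<open>\<mm>A\<close>, for \<open>\<mm> = R\<^sub>>\<^sub>0\<close>, and the graded \<open>\<complex>\<close>-algebra \<open>A/\<mm>A\<close>.\<close>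

definition ext_ideal :: "(complex, 'r) gr_alg \<Rightarrow> ('r, 'a) gr_alg \<Rightarrow> 'a set" where
  "ext_ideal R A = Idl\<^bsub>A\<^esub> {r \<odot>\<^bsub>A\<^esub> a | r a. r \<in> positive_part R \<and> a \<in> carrier A}"

definition special_fibre :: "(complex, 'r) gr_alg \<Rightarrow> ('r, 'a) gr_alg \<Rightarrow> (complex, 'a set) gr_alg" where
  "special_fibre R A = quotient_algebra (restrict_scalars R A) (ext_ideal R A)"

text \<open>
  The map \<open>A/\<mm>A \<rightarrow> B/\<nn>B\<close> induced by \<open>f\<close>, where \<open>\<nn> = S\<^sub>>\<^sub>0\<close>: a coset \<open>X\<close> goes to \<open>\<nn>B + f(X)\<close>.
\<close>

definition fibre_map ::
  "(complex, 's) gr_alg \<Rightarrow> ('s, 'b) gr_alg \<Rightarrow> ('a \<Rightarrow> 'b) \<Rightarrow> 'a set \<Rightarrow> 'b set" where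
  "fibre_map S B f X = ext_ideal S B <+>\<^bsub>B\<^esub> f ` X"

definition is_deformation ::
  "(complex, 'r) gr_alg \<Rightarrow> (complex, 'p) gr_alg \<Rightarrow> ('r, 'a) gr_alg \<Rightarrow> ('a set \<Rightarrow> 'p) \<Rightarrow> bool" where
  "is_deformation R A \<A> \<phi> \<longleftrightarrow>
     graded_algebra R \<A> \<and> flat R \<A> \<and> graded_iso complex_base (special_fibre R \<A>) A \<phi>"

text \<open>
  Morphisms are only required to map \<open>R\<close> into \<open>S\<close>, more precisely \<open>R\<cdot>1\<close> into \<open>S\<cdot>1\<close>; they are not
  assumed to be \<open>R\<close>-linear, even when the two bases coincide.
\<close>

definition deformation_morphism ::
  "(complex, 'r) gr_alg \<Rightarrow> ('r, 'a) gr_alg \<Rightarrow> ('a set \<Rightarrow> 'p) \<Rightarrow>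
   (complex, 's) gr_alg \<Rightarrow> ('s, 'b) gr_alg \<Rightarrow> ('b set \<Rightarrow> 'p) \<Rightarrow> ('a \<Rightarrow> 'b) \<Rightarrow> bool" where
  "deformation_morphism R \<A> \<phi> S \<B> \<psi> f \<longleftrightarrow>
     graded_hom complex_base (restrict_scalars R \<A>) (restrict_scalars S \<B>) f \<and>
     (\<forall>r\<in>carrier R. \<exists>s\<in>carrier S. f (r \<odot>\<^bsub>\<A>\<^esub> \<one>\<^bsub>\<A>\<^esub>) = s \<odot>\<^bsub>\<B>\<^esub> \<one>\<^bsub>\<B>\<^esub>) \<and>
     (\<forall>X\<in>carrier (special_fibre R \<A>). \<psi> (fibre_map S \<B> f X) = \<phi> X)"

definition deformation_isomorphism ::
  "(complex, 'r) gr_alg \<Rightarrow> ('r, 'a) gr_alg \<Rightarrow> ('a set \<Rightarrow> 'p) \<Rightarrow>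
   (complex, 's) gr_alg \<Rightarrow> ('s, 'b) gr_alg \<Rightarrow> ('b set \<Rightarrow> 'p) \<Rightarrow> ('a \<Rightarrow> 'b) \<Rightarrow> bool" where
  "deformation_isomorphism R \<A> \<phi> S \<B> \<psi> f \<longleftrightarrow>
     deformation_morphism R \<A> \<phi> S \<B> \<psi> f \<and>
     (\<exists>h. deformation_morphism S \<B> \<psi> R \<A> \<phi> h \<and>
          (\<forall>a\<in>carrier \<A>. h (f a) = a) \<and> (\<forall>b\<in>carrier \<B>. f (h b) = b))"

text \<open>\<open>F : \<A> \<rightarrow> \<B>\<close> is a deformation over \<open>R\<close> of the homomorphism \<open>f : A \<rightarrow> B\<close>.\<close>

definition deformation_of_hom ::
  "(complex, 'r) gr_alg \<Rightarrow> (complex, 'p) gr_alg \<Rightarrow> (complex, 'q) gr_alg \<Rightarrow> ('p \<Rightarrow> 'q) \<Rightarrow>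
   ('r, 'a) gr_alg \<Rightarrow> ('a set \<Rightarrow> 'p) \<Rightarrow> ('r, 'b) gr_alg \<Rightarrow> ('b set \<Rightarrow> 'q) \<Rightarrow> ('a \<Rightarrow> 'b) \<Rightarrow> bool" where
  "deformation_of_hom R A B f \<A> \<phi> \<B> \<psi> F \<longleftrightarrow>
     is_deformation R A \<A> \<phi> \<and> is_deformation R B \<B> \<psi> \<and>
     graded_hom R \<A> \<B> F \<and>
     (\<forall>X\<in>carrier (special_fibre R \<A>). \<psi> (fibre_map R \<B> F X) = f (\<phi> X))"

section \<open>Invariants of subgroups of \<open>SL(2,\<complex>)\<close>\<close>

definition SL2 :: "(complex^2^2) monoid" where
  "SL2 = \<lparr>carrier = {g. det g = 1}, monoid.mult = (**), one = mat 1\<rparr>"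

text \<open>
  \<open>\<complex>[u,v]\<close> is represented as \<open>\<complex>[u][v]\<close>: the coefficient of \<open>u\<^sup>i v\<^sup>j\<close> in \<open>p\<close> is
  \<open>coeff (coeff p j) i\<close>.
\<close>

definition var_u :: "complex poly poly" where "var_u = [:[:0, 1:]:]"

definition var_v :: "complex poly poly" where "var_v = [:0, 1:]"

text \<open>The polynomial \<open>p(a, b)\<close>.\<close>

definition subst2 :: "complex poly poly \<Rightarrow> complex poly poly \<Rightarrow> complex poly poly \<Rightarrow> complex poly poly" where
  "subst2 p a b = poly (map_poly (\<lambda>q. poly (map_poly (\<lambda>c. [:[:c:]:]) q) a) p) b"

text \<open>
  The polynomial function \<open>p \<circ> g\<close> on \<open>\<complex>\<^sup>2\<close>, with \<open>u, v\<close> the coordinates.  This is a right action;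
  the corresponding left action \<open>p \<circ> g\<inverse>\<close> of a group has the same invariants.
\<close>

definition poly_act :: "complex^2^2 \<Rightarrow> complex poly poly \<Rightarrow> complex poly poly" where
  "poly_act g p =
     subst2 p ([:[:g $ 1 $ 1:]:] * var_u + [:[:g $ 1 $ 2:]:] * var_v)
              ([:[:g $ 2 $ 1:]:] * var_u + [:[:g $ 2 $ 2:]:] * var_v)"

definition invariants :: "(complex^2^2) set \<Rightarrow> (complex, complex poly poly) gr_alg" where
  "invariants G =
    \<lparr>carrier = {p. \<forall>g\<in>G. poly_act g p = p},
     monoid.mult = (*), one = 1, ring.zero = 0, add = (+),
     module.smult = (\<lambda>c p. [:[:c:]:] * p),
     grade = (\<lambda>d. {p. (\<forall>g\<in>G. poly_act g p = p) \<and>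
                       (\<forall>i j. Polynomial.coeff (Polynomial.coeff p j) i \<noteq> 0 \<longrightarrow> i + j = d)})\<rparr>"

end

theory Submission
imports Defs "HOL-Computational_Algebra.Polynomial_Factorial" "HOL-Computational_Algebra.Field_as_Ring"
begin

text \<open>
  Write \<open>P\<close> and \<open>Q\<close> for the rings of invariants of \<open>G\<^sub>1\<close> and \<open>G\<^sub>2\<close> in \<open>\<complex>[u,v]\<close>, so that \<open>Q \<subseteq> P\<close>.  The
  isomorphism \<open>g : A\<^sub>1 \<rightarrow> A\<^sub>2\<close> is built order by order in the degree of \<open>R\<close>.  Suppose that \<open>g\<close> is
  \<open>R\<close>-linear and graded, lifts the identity of \<open>P\<close>, and is multiplicative and compatible with the
  maps from \<open>B\<close> modulo \<open>R\<^bsub>\<ge>n\<^esub> A\<^sub>2\<close>.  In the next order the failure consists, for every vector of a basis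
  of \<open>R\<^sub>n\<close>, of a symmetric Hochschild 2-cocycle \<open>c : P \<times> P \<rightarrow> P\<close> and a linear map \<open>\<beta> : Q \<rightarrow> P\<close> whose
  coboundary is the restriction of \<open>c\<close> to \<open>Q\<close>.  It can be removed if \<open>c\<close> is the coboundary of a
  linear map \<open>h : P \<rightarrow> P\<close> that extends \<open>\<beta>\<close>.  So the theorem comes down to the statement that such an
  \<open>h\<close> always exists, and that it is unique.

  The reason for this is that \<open>Q \<subseteq> P\<close> is etale away from the origin, which has codimension two.
  A nontrivial element of a finite subgroup of \<open>SL(2,\<complex>)\<close> does not have the eigenvalue 1
  (\<open>finite_SL2_fixed_point_free\<close>).  Hence for a nonzero linear form \<open>l\<close> the product of all
  \<open>\<sigma> (l - \<tau> l)\<close> with \<open>\<tau>\<close> nontrivial is a nonzero invariant, and a constant multiple \<open>F\<close> of it can be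
  written as \<open>\<Sum> a\<^sub>i b\<^sub>i\<close> with \<open>a\<^sub>i, b\<^sub>i \<in> P\<close> and \<open>\<Sum> a\<^sub>i \<sigma>(b\<^sub>i) = 0\<close> for all \<open>\<sigma> \<in> G\<^sub>2\<close> outside \<open>G\<^sub>1\<close>
  (\<open>relative_tensor\<close>).  This is a separability idempotent up to the denominator
  \<open>F\<close>.  It shows that derivations of \<open>P\<close> over \<open>Q\<close> vanish (\<open>derivation_zero\<close>), and the usual contracting homotopy of a
  separable extension solves the equations for \<open>F\<^sup>2 c\<close> and \<open>F\<^sup>2 \<beta>\<close> in place of \<open>c\<close> and \<open>\<beta>\<close>
  (\<open>cocycle_trivial\<close>).  Two generic linear forms give coprime \<open>F\<close> and \<open>F'\<close>.  By uniqueness the two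
  solutions are proportional, and unique factorization in \<open>\<complex>[u,v]\<close> removes the denominator
  (\<open>coprime_cocycle_trivial\<close>).  Uniqueness also shows that \<open>h\<close> is homogeneous when \<open>c\<close> and \<open>\<beta>\<close> are,
  since it must commute with rescaling the variables (\<open>homogeneous_cocycle_trivial\<close>).

  Flatness is used through a single consequence: for a linear functional on \<open>R\<^sub>n\<close> there is a well
  defined symbol \<open>R\<^bsub>\<ge>n\<^esub> A \<rightarrow> P\<close> (\<open>symbol_exists\<close>), so that \<open>R\<^bsub>\<ge>n\<^esub> A / R\<^bsub>>n\<^esub> A\<close> is \<open>R\<^sub>n \<otimes> P\<close>.  The symbols turn the
  failure of \<open>g\<close> into the cocycles \<open>c\<close>, and they show that lifts of a homogeneous basis of \<open>P\<close> form an
  \<open>R\<close>-basis of \<open>A\<close> (\<open>lift_independent\<close>, \<open>free_extension\<close>), so that corrections of \<open>g\<close> may be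
  prescribed on basis elements (\<open>improve\<close>).  An element of degree \<open>d\<close> in \<open>R\<^bsub>>d\<^esub> A\<close> is zero; therefore the
  successive corrections are eventually constant on every basis element.  Their limit is injective because
  it preserves symbols, and surjective by the graded Nakayama lemma (\<open>isomorphism_exists\<close>).
\<close>

section \<open>Derivations and symmetric cocycles of a separable extension\<close>

text \<open>
  Up to sign this is the Hochschild coboundary of \<open>h\<close>; it vanishes for derivations.
\<close>

definition defect :: "('a::comm_ring_1 \<Rightarrow> 'a) \<Rightarrow> 'a \<Rightarrow> 'a \<Rightarrow> 'a" where
  "defect h x y = h (x * y) - x * h y - y * h x"

locale subring_pair =
  fixes P Q :: "'a::idom set"
  assumes one_Q: "1 \<in> Q" and Q_sub: "Q \<subseteq> P"
    and add_P: "x \<in> P \<Longrightarrow> y \<in> P \<Longrightarrow> x + y \<in> P"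
    and mult_P: "x \<in> P \<Longrightarrow> y \<in> P \<Longrightarrow> x * y \<in> P"
    and minus_P: "x \<in> P \<Longrightarrow> - x \<in> P"
    and mult_Q: "x \<in> Q \<Longrightarrow> y \<in> Q \<Longrightarrow> x * y \<in> Q"
begin

lemma Q_P: "x \<in> Q \<Longrightarrow> x \<in> P" using Q_sub by auto
lemma diff_P: "x \<in> P \<Longrightarrow> y \<in> P \<Longrightarrow> x - y \<in> P"
  using add_P[of x "-y"] minus_P by simp
lemma one_P: "1 \<in> P" using one_Q Q_P by blast
lemma zero_P: "0 \<in> P" using diff_P[OF one_P one_P] by simp
lemma sum_P: "(\<And>i. i \<in> I \<Longrightarrow> f i \<in> P) \<Longrightarrow> sum f I \<in> P"
  by (induction I rule: infinite_finite_induct) (auto intro: zero_P add_P)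

definition additive :: "('a \<Rightarrow> 'a) \<Rightarrow> bool" where
  "additive h \<longleftrightarrow> (\<forall>x\<in>P. \<forall>y\<in>P. h (x + y) = h x + h y)"

lemma additiveD: "additive h \<Longrightarrow> x \<in> P \<Longrightarrow> y \<in> P \<Longrightarrow> h (x + y) = h x + h y"
  by (simp add: additive_def)
lemma additive_0: assumes "additive h" shows "h 0 = 0"
proof -
  have "h 0 + 0 = h 0 + h 0" using additiveD[OF assms zero_P zero_P] by (simp only: add_0_right)
  then show ?thesis by (simp only: add_left_cancel)
qed
lemma additive_sum: 
  assumes "additive h" "\<And>i. i \<in> I \<Longrightarrow> f i \<in> P" shows "h (sum f I) = (\<Sum>i\<in>I. h (f i))"
  using assms(2)
  by (induction I rule: infinite_finite_induct) (auto simp: additive_0[OF assms(1)] additiveD[OF assms(1)] sum_P)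

definition cocycle :: "('a \<Rightarrow> 'a \<Rightarrow> 'a) \<Rightarrow> bool" where
  "cocycle c \<longleftrightarrow> (\<forall>x\<in>P. \<forall>y\<in>P. c x y \<in> P \<and> c x y = c y x) \<and> (\<forall>x\<in>P. additive (c x)) \<and>
     (\<forall>x\<in>P. \<forall>y\<in>P. \<forall>z\<in>P. x * c y z - c (x * y) z + c x (y * z) - c x y * z = 0)"

lemma cocycleD:
  assumes "cocycle c"
  shows "x \<in> P \<Longrightarrow> y \<in> P \<Longrightarrow> c x y \<in> P" "x \<in> P \<Longrightarrow> y \<in> P \<Longrightarrow> c x y = c y x"
    "x \<in> P \<Longrightarrow> additive (c x)"
    "x \<in> P \<Longrightarrow> y \<in> P \<Longrightarrow> z \<in> P \<Longrightarrow> x * c y z - c (x * y) z + c x (y * z) - c x y * z = 0"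
  using assms unfolding cocycle_def by blast+

lemma cocycle_defect:
  assumes "additive h" "\<And>x. x \<in> P \<Longrightarrow> h x \<in> P"
  shows "cocycle (defect h)"
  unfolding cocycle_def
proof (intro conjI ballI)
  fix x y assume xy: "x \<in> P" "y \<in> P"
  show "defect h x y \<in> P"
    unfolding defect_def using xy assms(2) by (auto intro!: diff_P mult_P)
  show "defect h x y = defect h y x"
    unfolding defect_def by (simp add: mult.commute)
next
  fix x assume x: "x \<in> P"
  show "additive (defect h x)"
    unfolding additive_def defect_def
    using x by (simp add: distrib_left distrib_right additiveD[OF assms(1)] mult_P)
next
  fix x y z
  show "x * defect h y z - defect h (x * y) z + defect h x (y * z) - defect h x y * z = 0"
    unfolding defect_def by (simp add: algebra_simps)
qed

lemma cocycle_diff: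
  assumes "cocycle c" "cocycle d" shows "cocycle (\<lambda>x y. c x y - d x y)"
  unfolding cocycle_def additive_def
proof (intro conjI ballI)
  fix x y assume "x \<in> P" "y \<in> P"
  then show "c x y - d x y \<in> P" "c x y - d x y = c y x - d y x"
    using cocycleD(1,2)[OF assms(1)] cocycleD(1,2)[OF assms(2)] diff_P by auto
next
  fix x y z assume *: "x \<in> P" "y \<in> P" "z \<in> P"
  then show "c x (y + z) - d x (y + z) = c x y - d x y + (c x z - d x z)"
    using cocycleD(3)[OF assms(1)] cocycleD(3)[OF assms(2)] by (auto simp: additiveD)
  show "x * (c y z - d y z) - (c (x * y) z - d (x * y) z) + (c x (y * z) - d x (y * z)) - (c x y - d x y) * z = 0"
    (is "?l = 0")
  proof -
    have "?l = (x * c y z - c (x * y) z + c x (y * z) - c x y * z) - (x * d y z - d (x * y) z + d x (y * z) - d x y * z)"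
      by (simp add: algebra_simps)
    then show ?thesis using cocycleD(4)[OF assms(1) *] cocycleD(4)[OF assms(2) *] by simp
  qed
qed

lemma cocycle_scale:
  assumes "cocycle c" "F \<in> P" shows "cocycle (\<lambda>x y. F * c x y)"
  unfolding cocycle_def additive_def
proof (intro conjI ballI)
  fix x y assume "x \<in> P" "y \<in> P"
  then show "F * c x y \<in> P" "F * c x y = F * c y x"
    using cocycleD(1,2)[OF assms(1)] assms(2) mult_P by auto
next
  fix x y z assume *: "x \<in> P" "y \<in> P" "z \<in> P"
  then show "F * c x (y + z) = F * c x y + F * c x z"
    using cocycleD(3)[OF assms(1)] by (auto simp: additiveD algebra_simps)
  have "F * (x * c y z - c (x * y) z + c x (y * z) - c x y * z) = 0"
    using cocycleD(4)[OF assms(1) *] by simp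
  then show "x * (F * c y z) - F * c (x * y) z + F * c x (y * z) - F * c x y * z = 0"
    by (simp add: algebra_simps)
qed

end

text \<open>
  If \<open>F\<close> were invertible, then \<open>\<Sum> a\<^sub>i \<otimes> b\<^sub>i / F\<close> would be the separability idempotent of \<open>P\<close> over \<open>Q\<close>, and
  the last axiom would say that \<open>a\<^sub>i / F\<close> and \<open>b\<^sub>i\<close> are dual bases for the trace \<open>\<tau>\<close>.  Keeping \<open>F\<close> as a
  denominator makes sense for extensions that are etale only where \<open>F\<close> does not vanish.
\<close>

locale separable_pair = subring_pair P Q for P Q :: "'a::idom set" +
  fixes I :: "'i set" and a b :: "'i \<Rightarrow> 'a" and \<tau> :: "'a \<Rightarrow> 'a" and F :: 'a
  assumes a_P: "i \<in> I \<Longrightarrow> a i \<in> P" and b_P: "i \<in> I \<Longrightarrow> b i \<in> P"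
    and tr_Q: "x \<in> P \<Longrightarrow> \<tau> x \<in> Q" and tr_add: "additive \<tau>"
    and tr_lin: "q \<in> Q \<Longrightarrow> x \<in> P \<Longrightarrow> \<tau> (q * x) = q * \<tau> x"
    and F_Q: "F \<in> Q" and F_nz: "F \<noteq> 0"
    and F_eq: "(\<Sum>i\<in>I. a i * b i) = F"
    and dual: "z \<in> P \<Longrightarrow> (\<Sum>i\<in>I. \<tau> (z * b i) * a i) = F * z"
begin

text \<open>
  The element \<open>\<Sum> a\<^sub>i \<otimes> b\<^sub>i\<close> of \<open>P \<otimes>\<^sub>Q P\<close> is annihilated by \<open>z \<otimes> 1 - 1 \<otimes> z\<close> up to torsion.  Multiplying by \<open>F\<close> and
  expanding \<open>F z b\<^sub>i\<close> in the dual bases moves \<open>z\<close> from one factor to the other.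
\<close>

lemma balance:
  assumes add: "additive \<kappa>" and lin: "\<And>q x. q \<in> Q \<Longrightarrow> x \<in> P \<Longrightarrow> \<kappa> (q * x) = q * \<kappa> x" and z: "z \<in> P"
  shows "(\<Sum>i\<in>I. a i * \<kappa> (z * b i)) = z * (\<Sum>i\<in>I. a i * \<kappa> (b i))"
proof -
  have *: "F * (\<Sum>i\<in>I. a i * \<kappa> (z * b i)) = z * (\<Sum>j\<in>I. F * b j * \<kappa> (a j))" if z: "z \<in> P" for z
  proof -
    have "F * (\<Sum>i\<in>I. a i * \<kappa> (z * b i)) = (\<Sum>i\<in>I. a i * \<kappa> (F * (z * b i)))"
      by (auto simp: sum_distrib_left lin F_Q mult_P z b_P algebra_simps intro!: sum.cong)
    also have "\<dots> = (\<Sum>i\<in>I. a i * \<kappa> (\<Sum>j\<in>I. \<tau> (z * b i * b j) * a j))"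
      by (intro sum.cong refl, subst dual) (auto simp: z b_P mult_P)
    also have "\<dots> = (\<Sum>i\<in>I. a i * (\<Sum>j\<in>I. \<kappa> (\<tau> (z * b i * b j) * a j)))"
      by (intro sum.cong refl, subst additive_sum[OF add]) (auto intro!: mult_P Q_P[OF tr_Q] z b_P a_P)
    also have "\<dots> = (\<Sum>i\<in>I. \<Sum>j\<in>I. (\<tau> (z * b j * b i) * a i) * \<kappa> (a j))"
      unfolding sum_distrib_left
      by (intro sum.cong refl, subst lin) (auto simp: algebra_simps intro!: mult_P tr_Q z b_P a_P)
    also have "\<dots> = (\<Sum>j\<in>I. \<Sum>i\<in>I. (\<tau> (z * b j * b i) * a i) * \<kappa> (a j))"
      by (rule sum.swap)
    also have "\<dots> = (\<Sum>j\<in>I. F * (z * b j) * \<kappa> (a j))"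
      unfolding sum_distrib_right[symmetric]
      by (intro sum.cong refl, subst dual) (auto intro!: mult_P z b_P)
    also have "\<dots> = z * (\<Sum>j\<in>I. F * b j * \<kappa> (a j))"
      by (simp add: sum_distrib_left algebra_simps)
    finally show ?thesis .
  qed
  have "F * (\<Sum>i\<in>I. a i * \<kappa> (z * b i)) = F * (z * (\<Sum>i\<in>I. a i * \<kappa> (b i)))"
    using *[OF z] *[OF one_P] by (simp add: mult.left_commute)
  then show ?thesis using F_nz by simp
qed

text \<open>
  By the Leibniz rule \<open>F D(x)\<close> is the difference \<open>\<Sum> a\<^sub>i D(x b\<^sub>i) - x \<Sum> a\<^sub>i D(b\<^sub>i)\<close>, and \<open>D\<close> is \<open>Q\<close>-linear.
\<close>

lemma derivation_zero:
  assumes add: "additive D" and der: "\<And>x y. x \<in> P \<Longrightarrow> y \<in> P \<Longrightarrow> D (x * y) = x * D y + y * D x"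
    and zero: "\<And>q. q \<in> Q \<Longrightarrow> D q = 0" and x: "x \<in> P"
  shows "D x = 0"
proof -
  have lin: "D (q * x) = q * D x" if "q \<in> Q" "x \<in> P" for q x
    using der[of q x] zero[of q] that Q_P by simp
  have "F * D x = (\<Sum>i\<in>I. a i * D (x * b i)) - x * (\<Sum>i\<in>I. a i * D (b i))"
    unfolding F_eq[symmetric] sum_distrib_left sum_distrib_right sum_subtractf[symmetric]
    by (intro sum.cong refl) (auto simp: der x b_P algebra_simps)
  also have "\<dots> = 0" using balance[OF add lin x] by simp
  finally show ?thesis using F_nz by simp
qed

text \<open>
  The solution is explicit.  A first step replaces \<open>F c\<close> by a cohomologous cocycle that is \<open>Q\<close>-linear in
  each argument; a second step applies the contracting homotopy of the separability element to it.
\<close>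

lemma normalised_cocycle_trivial:
  assumes c: "cocycle c" and c0: "\<And>q q'. q \<in> Q \<Longrightarrow> q' \<in> Q \<Longrightarrow> c q q' = 0"
  obtains H where "additive H" "\<And>x. x \<in> P \<Longrightarrow> H x \<in> P" "\<And>q. q \<in> Q \<Longrightarrow> H q = 0"
    "\<And>x y. x \<in> P \<Longrightarrow> y \<in> P \<Longrightarrow> defect H x y = F\<^sup>2 * c x y"
proof -
  note cP = cocycleD(1)[OF c] and csym = cocycleD(2)[OF c] and cadd = cocycleD(3)[OF c] and ceq = cocycleD(4)[OF c]
  have cadd2: "c (x + y) z = c x z + c y z" if "x \<in> P" "y \<in> P" "z \<in> P" for x y z
    using csym[of "x+y" z] csym[of x z] csym[of y z] additiveD[OF cadd, of z x y] that add_P by simp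
  \<comment> \<open>A solution \<open>h\<close> of \<open>defect h = c\<close> that vanishes on \<open>Q\<close> and on all \<open>a\<^sub>i\<close> satisfies \<open>F h(z) = K z\<close>: evaluate
    \<open>h\<close> on both sides of \<open>F z = \<Sum> \<tau>(z b\<^sub>i) a\<^sub>i\<close>.\<close>
  define K where "K z = (\<Sum>i\<in>I. c (\<tau> (z * b i)) (a i)) - c F z" for z
  have t_P: "\<tau> (z * b i) \<in> P" if "z \<in> P" "i \<in> I" for z i
    using that by (intro Q_P[OF tr_Q] mult_P b_P)
  have K_P: "K z \<in> P" if "z \<in> P" for z
    unfolding K_def using that by (intro diff_P sum_P cP t_P a_P Q_P[OF F_Q])
  have K_add: "additive K"
    unfolding additive_def K_def
    by (auto simp: distrib_right additiveD[OF tr_add] additiveD[OF cadd] mult_P b_P cadd2 t_P a_P Q_P F_Q sum.distrib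
        algebra_simps)
  have K_mult: "K (q * z) = q * K z + F * c q z" if q: "q \<in> Q" and z: "z \<in> P" for q z
  proof -
    have 1: "c (\<tau> (q * z * b i)) (a i) = q * c (\<tau> (z * b i)) (a i) + c q (\<tau> (z * b i) * a i)" if i: "i \<in> I" for i
    proof -
      have "\<tau> (q * z * b i) = q * \<tau> (z * b i)"
        using tr_lin[OF q, of "z * b i"] z b_P[OF i] by (simp add: mult_P mult.assoc)
      moreover have "c q (\<tau> (z * b i)) = 0"
        using q z i by (intro c0 tr_Q mult_P b_P)
      ultimately show ?thesis
        using ceq[of q "\<tau> (z * b i)" "a i"] q z i by (simp add: Q_P t_P a_P algebra_simps)
    qed
    have 2: "(\<Sum>i\<in>I. c q (\<tau> (z * b i) * a i)) = c q (F * z)"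
      using z q by (subst dual[symmetric]) (auto intro!: additive_sum[symmetric] cadd mult_P t_P a_P Q_P[OF q])
    have 3: "F * c z q - c (F * z) q + c F (z * q) - c F z * q = 0"
      using q z by (intro ceq Q_P[OF q] Q_P[OF F_Q])
    have "K (q * z) = q * (\<Sum>i\<in>I. c (\<tau> (z * b i)) (a i)) + c q (F * z) - c F (q * z)"
      unfolding K_def by (simp add: 1 sum.distrib sum_distrib_left 2)
    also have "\<dots> = q * K z + F * c q z"
      unfolding K_def using 3 csym[of q "F * z"] csym[of q z] q z
      by (simp add: Q_P F_Q mult_P algebra_simps)
    finally show ?thesis .
  qed
  define c' where "c' x y = F * c x y - defect K x y" for x y
  have c': "cocycle c'"
    unfolding c'_def by (intro cocycle_diff cocycle_scale c Q_P[OF F_Q] cocycle_defect K_add K_P)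
  note c'P = cocycleD(1)[OF c'] and c'sym = cocycleD(2)[OF c'] and c'add = cocycleD(3)[OF c'] and c'eq = cocycleD(4)[OF c']
  have c'q: "c' q z = z * K q" if "q \<in> Q" "z \<in> P" for q z
    unfolding c'_def defect_def using K_mult[OF that] by (simp add: algebra_simps)
  have c'lin: "c' x (q * y) = q * c' x y" if "x \<in> P" "y \<in> P" "q \<in> Q" for x y q
  proof -
    have "c' (x * y) q = x * y * K q" "c' y q = y * K q"
      using c'q[of q "x * y"] c'q[of q y] c'sym[of "x * y" q] c'sym[of y q] that by (auto simp: mult_P Q_P)
    then show ?thesis
      using c'eq[of x y q] that by (simp add: Q_P algebra_simps)
  qed
  \<comment> \<open>The contracting homotopy: \<open>c'\<close> is \<open>Q\<close>-linear in the second argument, so \<open>balance\<close> applies to it.\<close>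
  define E where "E z = (\<Sum>i\<in>I. a i * c' z (b i))" for z
  have E_add: "additive E"
    unfolding additive_def E_def
  proof (intro ballI)
    fix x y assume xy: "x \<in> P" "y \<in> P"
    have "c' (x + y) (b i) = c' x (b i) + c' y (b i)" if "i \<in> I" for i
      using c'sym[of _ "b i"] additiveD[OF c'add, of "b i" x y] that xy add_P b_P by simp
    then show "(\<Sum>i\<in>I. a i * c' (x + y) (b i)) = (\<Sum>i\<in>I. a i * c' x (b i)) + (\<Sum>i\<in>I. a i * c' y (b i))"
      by (simp add: sum.distrib[symmetric] algebra_simps)
  qed
  have E_def': "defect E x z = - (F * c' x z)" if x: "x \<in> P" and z: "z \<in> P" for x z
  proof -
    have eq: "c' (x * z) (b i) = x * c' z (b i) + c' x (z * b i) - c' x z * b i" if "i \<in> I" for i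
      using c'eq[OF x z b_P[OF that]] by (simp add: algebra_simps)
    have "E (x * z) = (\<Sum>i\<in>I. a i * (x * c' z (b i) + c' x (z * b i) - c' x z * b i))"
      unfolding E_def by (intro sum.cong refl) (simp add: eq)
    then have "E (x * z) = x * E z + (\<Sum>i\<in>I. a i * c' x (z * b i)) - c' x z * (\<Sum>i\<in>I. a i * b i)"
      unfolding E_def by (simp add: sum_distrib_left algebra_simps sum.distrib sum_subtractf)
    moreover have "(\<Sum>i\<in>I. a i * c' x (z * b i)) = z * (\<Sum>i\<in>I. a i * c' x (b i))"
      using x z by (intro balance c'add c'lin) auto
    ultimately show ?thesis
      unfolding defect_def F_eq by (simp add: E_def algebra_simps)
  qed
  define H where "H z = F * K z - E z" for z
  show thesis
  proof (rule that[of H])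
    show "additive H"
      using K_add E_add unfolding H_def additive_def by (auto simp: algebra_simps)
    show "H x \<in> P" if "x \<in> P" for x
      unfolding H_def E_def using that by (intro diff_P sum_P mult_P Q_P[OF F_Q] K_P a_P c'P b_P)
    show "H q = 0" if "q \<in> Q" for q
    proof -
      have "E q = (\<Sum>i\<in>I. a i * b i) * K q"
        unfolding E_def sum_distrib_right using that by (intro sum.cong refl) (simp add: c'q b_P)
      then show ?thesis unfolding H_def F_eq by simp
    qed
    show "defect H x y = F\<^sup>2 * c x y" if "x \<in> P" "y \<in> P" for x y
    proof -
      have "defect H x y = F * defect K x y - defect E x y"
        by (simp add: defect_def H_def algebra_simps)
      then show ?thesis using E_def'[OF that] by (simp add: c'_def algebra_simps power2_eq_square)
    qed
  qed
qed

text \<open>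
  The retraction \<open>\<rho>\<close> extends \<open>\<beta>\<close> to \<open>P\<close>; subtracting the coboundary of \<open>\<beta> \<circ> \<rho>\<close> reduces to cocycles that vanish on \<open>Q\<close>.
\<close>

lemma cocycle_trivial:
  assumes c: "cocycle c"
    and \<rho>_add: "additive \<rho>" and \<rho>_Q: "\<And>x. x \<in> P \<Longrightarrow> \<rho> x \<in> Q" and \<rho>_id: "\<And>q. q \<in> Q \<Longrightarrow> \<rho> q = q"
    and \<beta>_P: "\<And>q. q \<in> Q \<Longrightarrow> \<beta> q \<in> P"
    and \<beta>_add: "\<And>q q'. q \<in> Q \<Longrightarrow> q' \<in> Q \<Longrightarrow> \<beta> (q + q') = \<beta> q + \<beta> q'"
    and c\<beta>: "\<And>q q'. q \<in> Q \<Longrightarrow> q' \<in> Q \<Longrightarrow> c q q' = defect \<beta> q q'"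
  obtains H where "additive H" "\<And>x. x \<in> P \<Longrightarrow> H x \<in> P" "\<And>q. q \<in> Q \<Longrightarrow> H q = F\<^sup>2 * \<beta> q"
    "\<And>x y. x \<in> P \<Longrightarrow> y \<in> P \<Longrightarrow> defect H x y = F\<^sup>2 * c x y"
proof -
  define B where "B x = \<beta> (\<rho> x)" for x
  have B_add: "additive B"
    using \<rho>_add \<rho>_Q \<beta>_add unfolding B_def additive_def by auto
  have B_P: "B x \<in> P" if "x \<in> P" for x using that \<beta>_P \<rho>_Q B_def by auto
  have B_Q: "B q = \<beta> q" if "q \<in> Q" for q using that by (simp add: B_def \<rho>_id)
  have co: "cocycle (\<lambda>x y. c x y - defect B x y)"
    by (intro cocycle_diff c cocycle_defect B_add B_P)
  have 0: "c q q' - defect B q q' = 0" if "q \<in> Q" "q' \<in> Q" for q q'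
    using c\<beta>[OF that] that by (simp add: defect_def B_Q mult_Q)
  obtain H where H: "additive H" "\<And>x. x \<in> P \<Longrightarrow> H x \<in> P" "\<And>q. q \<in> Q \<Longrightarrow> H q = 0"
    "\<And>x y. x \<in> P \<Longrightarrow> y \<in> P \<Longrightarrow> defect H x y = F\<^sup>2 * (c x y - defect B x y)"
    using normalised_cocycle_trivial[OF co 0] by metis
  show thesis
  proof (rule that[of "\<lambda>x. H x + F\<^sup>2 * B x"])
    show "additive (\<lambda>x. H x + F\<^sup>2 * B x)"
      using H(1) B_add unfolding additive_def by (auto simp: algebra_simps)
    show "H x + F\<^sup>2 * B x \<in> P" if "x \<in> P" for x
      using that unfolding power2_eq_square by (intro add_P H mult_P B_P Q_P[OF F_Q])
    show "H q + F\<^sup>2 * B q = F\<^sup>2 * \<beta> q" if "q \<in> Q" for q using that H(3) B_Q by simp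
    show "defect (\<lambda>x. H x + F\<^sup>2 * B x) x y = F\<^sup>2 * c x y" if "x \<in> P" "y \<in> P" for x y
      using H(4)[OF that] by (simp add: defect_def algebra_simps)
  qed
qed

end

text \<open>
  Let \<open>H\<^sub>1\<close> and \<open>H\<^sub>2\<close> solve the equations multiplied by \<open>F\<^sub>1\<^sup>2\<close> and \<open>F\<^sub>2\<^sup>2\<close>.  Then \<open>F\<^sub>2\<^sup>2 H\<^sub>1 - F\<^sub>1\<^sup>2 H\<^sub>2\<close> is a derivation
  over \<open>Q\<close>, hence zero, and coprimality makes \<open>H\<^sub>1\<close> divisible by \<open>F\<^sub>1\<^sup>2\<close>.
\<close>

lemma coprime_cocycle_trivial:
  fixes P Q :: "'a::factorial_ring_gcd set"
  assumes s1: "separable_pair P Q I1 a1 b1 \<tau>1 F1" and s2: "separable_pair P Q I2 a2 b2 \<tau>2 F2"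
    and cop: "coprime F1 F2" and sat: "\<And>x. F1\<^sup>2 * x \<in> P \<Longrightarrow> x \<in> P"
    and c: "subring_pair.cocycle P c"
    and \<rho>: "subring_pair.additive P \<rho>" "\<And>x. x \<in> P \<Longrightarrow> \<rho> x \<in> Q" "\<And>q. q \<in> Q \<Longrightarrow> \<rho> q = q"
    and \<beta>_P: "\<And>q. q \<in> Q \<Longrightarrow> \<beta> q \<in> P"
    and \<beta>_add: "\<And>q q'. q \<in> Q \<Longrightarrow> q' \<in> Q \<Longrightarrow> \<beta> (q + q') = \<beta> q + \<beta> q'"
    and c\<beta>: "\<And>q q'. q \<in> Q \<Longrightarrow> q' \<in> Q \<Longrightarrow> c q q' = defect \<beta> q q'"
  obtains h where "subring_pair.additive P h" "\<And>x. x \<in> P \<Longrightarrow> h x \<in> P" "\<And>q. q \<in> Q \<Longrightarrow> h q = \<beta> q"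
    "\<And>x y. x \<in> P \<Longrightarrow> y \<in> P \<Longrightarrow> defect h x y = c x y"
proof -
  interpret s1: separable_pair P Q I1 a1 b1 \<tau>1 F1 by (rule s1)
  interpret s2: separable_pair P Q I2 a2 b2 \<tau>2 F2 by (rule s2)
  obtain H1 where H1: "s1.additive H1" "\<And>x. x \<in> P \<Longrightarrow> H1 x \<in> P" "\<And>q. q \<in> Q \<Longrightarrow> H1 q = F1\<^sup>2 * \<beta> q"
    "\<And>x y. x \<in> P \<Longrightarrow> y \<in> P \<Longrightarrow> defect H1 x y = F1\<^sup>2 * c x y"
    using s1.cocycle_trivial[OF c \<rho> \<beta>_P \<beta>_add c\<beta>] by blast
  obtain H2 where H2: "s1.additive H2" "\<And>x. x \<in> P \<Longrightarrow> H2 x \<in> P" "\<And>q. q \<in> Q \<Longrightarrow> H2 q = F2\<^sup>2 * \<beta> q"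
    "\<And>x y. x \<in> P \<Longrightarrow> y \<in> P \<Longrightarrow> defect H2 x y = F2\<^sup>2 * c x y"
    using s2.cocycle_trivial[OF c \<rho> \<beta>_P \<beta>_add c\<beta>] by blast
  define D where "D x = F2\<^sup>2 * H1 x - F1\<^sup>2 * H2 x" for x
  have "D x = 0" if "x \<in> P" for x
  proof (rule s1.derivation_zero[OF _ _ _ that])
    show "s1.additive D"
      using H1(1) H2(1) by (simp add: s1.additive_def D_def algebra_simps)
    show "D q = 0" if "q \<in> Q" for q using that by (simp add: D_def H1 H2)
    fix x y assume xy: "x \<in> P" "y \<in> P"
    have "D (x * y) - x * D y - y * D x = F2\<^sup>2 * defect H1 x y - F1\<^sup>2 * defect H2 x y"
      by (simp add: D_def defect_def algebra_simps)
    also have "\<dots> = 0" using H1(4)[OF xy] H2(4)[OF xy] by simp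
    finally show "D (x * y) = x * D y + y * D x" by (simp add: algebra_simps)
  qed
  then have eq: "F2\<^sup>2 * H1 x = F1\<^sup>2 * H2 x" if "x \<in> P" for x using that by (simp add: D_def)
  have "F1\<^sup>2 dvd H1 x" if "x \<in> P" for x
  proof -
    have "F1\<^sup>2 dvd F2\<^sup>2 * H1 x" using eq[OF that] by simp
    moreover have "coprime (F1\<^sup>2) (F2\<^sup>2)" using cop by simp
    ultimately show ?thesis by (simp add: coprime_dvd_mult_right_iff)
  qed
  then obtain h where h: "\<And>x. x \<in> P \<Longrightarrow> H1 x = F1\<^sup>2 * h x" unfolding dvd_def by metis
  have nz: "F1\<^sup>2 \<noteq> 0" using s1.F_nz by simp
  show thesis
  proof (rule that[of h])
    show "s1.additive h"
      unfolding s1.additive_def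
    proof (intro ballI)
      fix x y assume xy: "x \<in> P" "y \<in> P"
      have "F1\<^sup>2 * h (x + y) = F1\<^sup>2 * (h x + h y)"
        using s1.additiveD[OF H1(1) xy] xy by (simp add: h s1.add_P algebra_simps)
      then show "h (x + y) = h x + h y" using nz by simp
    qed
    show "h x \<in> P" if "x \<in> P" for x using sat H1(2)[OF that] h[OF that] by simp
    show "h q = \<beta> q" if "q \<in> Q" for q
      using H1(3)[OF that] h[of q] nz s1.Q_P[OF that] by simp
    show "defect h x y = c x y" if "x \<in> P" "y \<in> P" for x y
    proof -
      have "F1\<^sup>2 * defect h x y = F1\<^sup>2 * c x y"
        using H1(4)[OF that] that by (simp add: defect_def h s1.mult_P algebra_simps)
      then show ?thesis using nz by simp
    qed
  qed
qed

section \<open>Invariants of finite groups of automorphisms\<close>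

definition ring_endo :: "('a::comm_ring_1 \<Rightarrow> 'a) \<Rightarrow> bool" where
  "ring_endo \<sigma> \<longleftrightarrow> (\<forall>x y. \<sigma> (x + y) = \<sigma> x + \<sigma> y \<and> \<sigma> (x * y) = \<sigma> x * \<sigma> y) \<and> \<sigma> 1 = 1"

lemma ring_endoD:
  assumes "ring_endo \<sigma>"
  shows "\<sigma> (x + y) = \<sigma> x + \<sigma> y" "\<sigma> (x * y) = \<sigma> x * \<sigma> y" "\<sigma> 1 = 1" "\<sigma> 0 = 0" "\<sigma> (- x) = - \<sigma> x"
    "\<sigma> (x - y) = \<sigma> x - \<sigma> y" "\<sigma> (of_nat n) = of_nat n"
    "\<sigma> (sum f I) = (\<Sum>i\<in>I. \<sigma> (f i))" "\<sigma> (prod f I) = (\<Prod>i\<in>I. \<sigma> (f i))"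
proof -
  show a: "\<sigma> (x + y) = \<sigma> x + \<sigma> y" and m: "\<sigma> (x * y) = \<sigma> x * \<sigma> y" and o: "\<sigma> 1 = 1" for x y
    using assms by (auto simp: ring_endo_def)
  show z: "\<sigma> 0 = 0" using a[of 0 0] by (metis add_cancel_right_right add_0_right)
  show n: "\<sigma> (- x) = - \<sigma> x" for x using a[of x "-x"] z by (simp add: eq_neg_iff_add_eq_0 add.commute)
  show "\<sigma> (x - y) = \<sigma> x - \<sigma> y" using a[of x "-y"] n[of y] by simp
  show "\<sigma> (of_nat n) = of_nat n" by (induction n) (auto simp: z a o)
  show "\<sigma> (sum f I) = (\<Sum>i\<in>I. \<sigma> (f i))" by (induction I rule: infinite_finite_induct) (auto simp: z a)
  show "\<sigma> (prod f I) = (\<Prod>i\<in>I. \<sigma> (f i))" by (induction I rule: infinite_finite_induct) (auto simp: o m)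
qed

definition fixed_ring :: "('a \<Rightarrow> 'a) set \<Rightarrow> 'a set" where
  "fixed_ring H = {x. \<forall>\<sigma>\<in>H. \<sigma> x = x}"

text \<open>
  The group acts on a domain in which its order is invertible, so that averages exist.
\<close>

locale finite_aut_group =
  fixes H :: "('a::idom \<Rightarrow> 'a) set"
  assumes fin: "finite H" and id_H: "id \<in> H" and comp_H: "\<sigma> \<in> H \<Longrightarrow> \<tau> \<in> H \<Longrightarrow> \<sigma> \<circ> \<tau> \<in> H"
    and bij_H: "\<sigma> \<in> H \<Longrightarrow> bij \<sigma>" and inv_H: "\<sigma> \<in> H \<Longrightarrow> inv_into UNIV \<sigma> \<in> H"
    and endo: "\<sigma> \<in> H \<Longrightarrow> ring_endo \<sigma>"
    and card_unit: "\<exists>\<kappa>::'a. of_nat (card H) * \<kappa> = 1"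
begin

definition \<kappa> :: 'a where "\<kappa> = (SOME k. of_nat (card H) * k = 1)"

lemma \<kappa>: "of_nat (card H) * \<kappa> = 1"
  unfolding \<kappa>_def using someI_ex[OF card_unit] .

lemma card_nz: "of_nat (card H) \<noteq> (0::'a)" using \<kappa> by auto

lemma \<kappa>_fixed: assumes "ring_endo \<sigma>" shows "\<sigma> \<kappa> = \<kappa>"
proof -
  have "of_nat (card H) * \<sigma> \<kappa> = of_nat (card H) * \<kappa>"
    using ring_endoD(2)[OF assms, of "of_nat (card H)" \<kappa>] \<kappa> ring_endoD(3,7)[OF assms] by metis
  then show ?thesis using card_nz by simp
qed

lemma reindex_left:
  assumes "\<sigma> \<in> H" shows "bij_betw (\<lambda>\<tau>. \<sigma> \<circ> \<tau>) H H"
proof (rule bij_betwI[where g="\<lambda>\<tau>. inv_into UNIV \<sigma> \<circ> \<tau>"])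
  show "(\<lambda>\<tau>. \<sigma> \<circ> \<tau>) \<in> H \<rightarrow> H" "(\<lambda>\<tau>. inv_into UNIV \<sigma> \<circ> \<tau>) \<in> H \<rightarrow> H"
    using assms comp_H inv_H by auto
  show "inv_into UNIV \<sigma> \<circ> (\<sigma> \<circ> \<tau>) = \<tau>" "\<sigma> \<circ> (inv_into UNIV \<sigma> \<circ> \<tau>) = \<tau>" for \<tau>
    using bij_H[OF assms] by (auto simp: fun_eq_iff bij_is_inj inv_f_f surj_f_inv_f bij_is_surj)
qed

lemma orbit_sum_fixed:
  assumes "\<sigma> \<in> H" shows "\<sigma> (\<Sum>\<tau>\<in>H. \<tau> x) = (\<Sum>\<tau>\<in>H. \<tau> x)"
  using sum.reindex_bij_betw[OF reindex_left[OF assms], of "\<lambda>\<tau>. \<tau> x"]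
  by (simp add: ring_endoD(8)[OF endo[OF assms]])

lemma orbit_prod_fixed:
  assumes "\<sigma> \<in> H" shows "\<sigma> (\<Prod>\<tau>\<in>H. \<tau> x) = (\<Prod>\<tau>\<in>H. \<tau> x)"
  using prod.reindex_bij_betw[OF reindex_left[OF assms], of "\<lambda>\<tau>. \<tau> x"]
  by (simp add: ring_endoD(9)[OF endo[OF assms]])

definition average :: "'a \<Rightarrow> 'a" where "average x = \<kappa> * (\<Sum>\<tau>\<in>H. \<tau> x)"

lemma average_fixed: "average x \<in> fixed_ring H"
  unfolding fixed_ring_def average_def
  by (auto simp: ring_endoD(2)[OF endo] \<kappa>_fixed[OF endo] orbit_sum_fixed)

lemma average_id:
  assumes "x \<in> fixed_ring H" shows "average x = x"
proof -
  have "(\<Sum>\<tau>\<in>H. \<tau> x) = (\<Sum>\<tau>\<in>H. x)"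
    using assms by (intro sum.cong refl) (simp add: fixed_ring_def)
  then have "average x = (of_nat (card H) * \<kappa>) * x" unfolding average_def by simp
  then show ?thesis by (simp add: \<kappa>)
qed

lemma average_add: "average (x + y) = average x + average y"
  unfolding average_def by (simp add: ring_endoD(1)[OF endo] sum.distrib distrib_left)

definition nontrivial_diffs :: "'a \<Rightarrow> 'a" where
  "nontrivial_diffs l = (\<Prod>\<tau>\<in>H - {id}. l - \<tau> l)"

text \<open>
  The norm of \<open>\<Prod>(l - \<tau> l)\<close>; when the conjugates of \<open>l\<close> are distinct it is, up to sign, the discriminant of
  their monic polynomial.
\<close>

definition disc :: "'a \<Rightarrow> 'a" where
  "disc l = (\<Prod>\<sigma>\<in>H. \<sigma> (nontrivial_diffs l))"

text \<open>
  Expanding \<open>\<Prod>(l \<otimes> 1 - 1 \<otimes> \<tau> l)\<close> over the subsets \<open>U\<close> gives a tensor which \<open>x \<otimes> y \<mapsto> x \<sigma>(y)\<close> sends to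
  \<open>\<Prod>(l - \<sigma> (\<tau> l))\<close>.  For \<open>\<sigma> \<noteq> id\<close> the factor with \<open>\<tau> = \<sigma>\<inverse>\<close> vanishes.  The factor \<open>N\<close> makes the value at the
  identity invariant.
\<close>

lemma galois_tensor:
  obtains x y where "\<And>\<sigma>. \<sigma> \<in> H \<Longrightarrow> (\<Sum>U\<in>Pow (H - {id}). x U * \<sigma> (y U)) = (if \<sigma> = id then disc l else 0)"
proof -
  define N where "N = (\<Prod>\<sigma>\<in>H - {id}. \<sigma> (nontrivial_diffs l))"
  have f: "N * nontrivial_diffs l = disc l"
    unfolding N_def disc_def using prod.remove[OF fin id_H, of "\<lambda>\<sigma>. \<sigma> (nontrivial_diffs l)"] by (simp add: mult.commute)
  have "(\<Sum>U\<in>Pow (H - {id}). N * (\<Prod>\<tau>\<in>U. l) * \<sigma> (\<Prod>\<tau>\<in>H - {id} - U. - \<tau> l)) = (if \<sigma> = id then disc l else 0)"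
    if \<sigma>: "\<sigma> \<in> H" for \<sigma>
  proof -
    have "(\<Sum>U\<in>Pow (H - {id}). N * (\<Prod>\<tau>\<in>U. l) * \<sigma> (\<Prod>\<tau>\<in>H - {id} - U. - \<tau> l)) =
      N * (\<Prod>\<tau>\<in>H - {id}. l + (- \<sigma> (\<tau> l)))"
      using fin by (subst prod_add) (auto simp: sum_distrib_left ring_endoD(9,5)[OF endo[OF \<sigma>]] mult.assoc)
    also have "\<dots> = (if \<sigma> = id then disc l else 0)"
    proof (cases "\<sigma> = id")
      case True then show ?thesis using f by (simp add: nontrivial_diffs_def)
    next
      case False
      have "inv_into UNIV \<sigma> \<noteq> id" using False bij_H[OF \<sigma>] by (metis inv_inv_eq inv_id)
      then have "inv_into UNIV \<sigma> \<in> H - {id}" using inv_H[OF \<sigma>] by simp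
      moreover have "l + - \<sigma> (inv_into UNIV \<sigma> l) = 0"
        using bij_H[OF \<sigma>] by (simp add: surj_f_inv_f bij_is_surj)
      ultimately have "(\<Prod>\<tau>\<in>H - {id}. l + (- \<sigma> (\<tau> l))) = 0"
        using fin by (intro prod_zero) auto
      then show ?thesis using False by simp
    qed
    finally show ?thesis .
  qed
  then show thesis by (rule that)
qed

lemma disc_fixed: "disc l \<in> fixed_ring H"
  unfolding fixed_ring_def disc_def using orbit_prod_fixed by auto

end

text \<open>
  Averaging both factors of the tensor over the subgroup \<open>K\<close> leaves only the contributions of those
  \<open>\<sigma>\<close> that lie in \<open>K\<close>.  The division by the order of \<open>K\<close> in \<open>\<tau>\<close> makes it the trace from the \<open>K\<close>-invariants
  to the \<open>H\<close>-invariants.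
\<close>

lemma (in finite_aut_group) relative_tensor:
  fixes K
  assumes "finite_aut_group K" and KH: "K \<subseteq> H" and nz: "disc l \<noteq> 0"
  shows "\<exists>(I::('a \<Rightarrow> 'a) set set) a b \<tau>.
    separable_pair (fixed_ring K) (fixed_ring H) I a b \<tau> (of_nat (card K) * disc l)"
proof -
  interpret K: finite_aut_group K by fact
  obtain x y where xy: "\<And>\<sigma>. \<sigma> \<in> H \<Longrightarrow> (\<Sum>U\<in>Pow (H - {id}). x U * \<sigma> (y U)) = (if \<sigma> = id then disc l else 0)"
    using galois_tensor[of l] by blast
  define I where "I = Pow (H - {id})"
  define a where "a U = (\<Sum>h\<in>K. h (x U))" for U
  define b where "b U = (\<Sum>k\<in>K. k (y U))" for U
  define \<tau> where "\<tau> z = K.\<kappa> * (\<Sum>\<sigma>\<in>H. \<sigma> z)" for z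
  have tensor: "(\<Sum>U\<in>I. a U * \<sigma> (b U)) = (if \<sigma> \<in> K then of_nat (card K) * disc l else 0)" if \<sigma>: "\<sigma> \<in> H" for \<sigma>
  proof -
    have inner: "(\<Sum>U\<in>I. h (x U) * \<sigma> (k (y U))) = (if h = \<sigma> \<circ> k then disc l else 0)" if h: "h \<in> K" and k: "k \<in> K" for h k
    proof -
      have hH: "h \<in> H" and kH: "k \<in> H" using h k KH by auto
      have hinv: "h (inv_into UNIV h z) = z" for z using bij_H[OF hH] by (simp add: surj_f_inv_f bij_is_surj)
      have "(\<Sum>U\<in>I. h (x U) * \<sigma> (k (y U))) = h (\<Sum>U\<in>I. x U * (inv_into UNIV h \<circ> \<sigma> \<circ> k) (y U))"
        by (simp add: ring_endoD(8,2)[OF endo[OF hH]] hinv)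
      also have "\<dots> = h (if inv_into UNIV h \<circ> \<sigma> \<circ> k = id then disc l else 0)"
        unfolding I_def by (subst xy) (auto intro!: comp_H inv_H \<sigma> hH kH)
      also have "(inv_into UNIV h \<circ> \<sigma> \<circ> k = id) = (h = \<sigma> \<circ> k)"
      proof
        assume "inv_into UNIV h \<circ> \<sigma> \<circ> k = id"
        then have "h (inv_into UNIV h (\<sigma> (k z))) = h z" for z by (metis comp_apply id_apply)
        then show "h = \<sigma> \<circ> k" using hinv by auto
      next
        assume e: "h = \<sigma> \<circ> k"
        have "inv_into UNIV h \<circ> \<sigma> \<circ> k = inv_into UNIV h \<circ> h" using e by (simp add: comp_assoc)
        then show "inv_into UNIV h \<circ> \<sigma> \<circ> k = id" using bij_H[OF hH] by (simp add: bij_is_inj)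
      qed
      also have "h (if h = \<sigma> \<circ> k then disc l else 0) = (if h = \<sigma> \<circ> k then disc l else 0)"
      proof -
        have "h (disc l) = disc l" using disc_fixed[of l] hH by (simp add: fixed_ring_def)
        with ring_endoD(4)[OF endo[OF hH]] show ?thesis by (cases "h = \<sigma> \<circ> k") (simp_all only: if_True if_False simp_thms)
      qed
      finally show ?thesis .
    qed
    have "(\<Sum>U\<in>I. a U * \<sigma> (b U)) = (\<Sum>U\<in>I. \<Sum>h\<in>K. \<Sum>k\<in>K. h (x U) * \<sigma> (k (y U)))"
      unfolding a_def b_def by (simp add: ring_endoD(8)[OF endo[OF \<sigma>]] sum_product)
    also have "\<dots> = (\<Sum>U\<in>I. \<Sum>k\<in>K. \<Sum>h\<in>K. h (x U) * \<sigma> (k (y U)))"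
      by (intro sum.cong refl sum.swap)
    also have "\<dots> = (\<Sum>k\<in>K. \<Sum>U\<in>I. \<Sum>h\<in>K. h (x U) * \<sigma> (k (y U)))" by (rule sum.swap)
    also have "\<dots> = (\<Sum>k\<in>K. \<Sum>h\<in>K. \<Sum>U\<in>I. h (x U) * \<sigma> (k (y U)))" by (intro sum.cong refl sum.swap)
    also have "\<dots> = (\<Sum>k\<in>K. \<Sum>h\<in>K. if h = \<sigma> \<circ> k then disc l else 0)"
      by (intro sum.cong refl) (simp add: inner)
    also have "\<dots> = (\<Sum>k\<in>K. if \<sigma> \<circ> k \<in> K then disc l else 0)"
      by (simp add: sum.delta K.fin)
    also have "\<dots> = (\<Sum>k\<in>K. if \<sigma> \<in> K then disc l else 0)"
    proof (intro sum.cong refl)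
      fix k assume k: "k \<in> K"
      have "\<sigma> = (\<sigma> \<circ> k) \<circ> inv_into UNIV k"
        using K.bij_H[OF k] by (auto simp: fun_eq_iff surj_f_inv_f bij_is_surj)
      then have "\<sigma> \<circ> k \<in> K \<longleftrightarrow> \<sigma> \<in> K" using K.comp_H K.inv_H k by metis
      then show "(if \<sigma> \<circ> k \<in> K then disc l else 0) = (if \<sigma> \<in> K then disc l else 0)" by simp
    qed
    also have "\<dots> = (if \<sigma> \<in> K then of_nat (card K) * disc l else 0)" by simp
    finally show ?thesis .
  qed
  have P: "fixed_ring H \<subseteq> fixed_ring K" using KH by (auto simp: fixed_ring_def)
  have sp: "subring_pair (fixed_ring K) (fixed_ring H)"
    by unfold_locales (use P in \<open>auto simp: fixed_ring_def ring_endoD[OF K.endo] ring_endoD[OF endo]\<close>)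
  interpret sp: subring_pair "fixed_ring K" "fixed_ring H" by (rule sp)
  have "separable_pair (fixed_ring K) (fixed_ring H) I a b \<tau> (of_nat (card K) * disc l)"
  proof unfold_locales
    show "a i \<in> fixed_ring K" "b i \<in> fixed_ring K" for i
      using K.orbit_sum_fixed by (auto simp: a_def b_def fixed_ring_def)
    show "\<tau> z \<in> fixed_ring H" for z
      using orbit_sum_fixed by (auto simp: \<tau>_def fixed_ring_def ring_endoD(2)[OF endo] K.\<kappa>_fixed[OF endo])
    show "sp.additive \<tau>"
      unfolding sp.additive_def \<tau>_def by (simp add: ring_endoD(1)[OF endo] sum.distrib distrib_left)
    show "\<tau> (q * z) = q * \<tau> z" if "q \<in> fixed_ring H" for q z
    proof -
      have "(\<Sum>\<sigma>\<in>H. \<sigma> (q * z)) = (\<Sum>\<sigma>\<in>H. q * \<sigma> z)"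
        using that by (intro sum.cong refl) (simp add: ring_endoD(2)[OF endo] fixed_ring_def)
      then show ?thesis unfolding \<tau>_def by (simp add: sum_distrib_left algebra_simps)
    qed
    show "of_nat (card K) * disc l \<in> fixed_ring H"
      using disc_fixed[of l] by (auto simp: fixed_ring_def ring_endoD(2,7)[OF endo])
    show "of_nat (card K) * disc l \<noteq> 0" using nz K.card_nz by simp
    show "(\<Sum>i\<in>I. a i * b i) = of_nat (card K) * disc l"
      using tensor[OF id_H] K.id_H by simp
    show "(\<Sum>i\<in>I. \<tau> (z * b i) * a i) = of_nat (card K) * disc l * z" if z: "z \<in> fixed_ring K" for z
    proof -
      have "(\<Sum>i\<in>I. \<tau> (z * b i) * a i) = (\<Sum>i\<in>I. \<Sum>\<sigma>\<in>H. K.\<kappa> * (\<sigma> z * (a i * \<sigma> (b i))))"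
        unfolding \<tau>_def by (simp add: sum_distrib_left sum_distrib_right ring_endoD(2)[OF endo] mult_ac)
      also have "\<dots> = K.\<kappa> * (\<Sum>\<sigma>\<in>H. \<sigma> z * (\<Sum>i\<in>I. a i * \<sigma> (b i)))"
        by (subst sum.swap) (simp add: sum_distrib_left)
      also have "(\<Sum>\<sigma>\<in>H. \<sigma> z * (\<Sum>i\<in>I. a i * \<sigma> (b i))) = (\<Sum>\<sigma>\<in>H. if \<sigma> \<in> K then z * (of_nat (card K) * disc l) else 0)"
        using z by (intro sum.cong refl) (auto simp: tensor fixed_ring_def)
      also have "\<dots> = of_nat (card K) * (z * (of_nat (card K) * disc l))"
        using KH fin by (simp add: sum.inter_restrict[symmetric] inf.absorb2)
      also have "K.\<kappa> * \<dots> = (of_nat (card K) * K.\<kappa>) * (of_nat (card K) * disc l * z)"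
        by (simp add: algebra_simps)
      finally show ?thesis by (simp add: K.\<kappa>)
    qed
  qed
  then show ?thesis by blast
qed

section \<open>The action of matrices on polynomials\<close>

text \<open>
  Substitution in \<open>\<complex>[u][v]\<close> is a two-fold iteration of this map, with \<open>f\<close> the inclusion of the constants
  at the inner level.
\<close>

definition evalp :: "('a::comm_ring_1 \<Rightarrow> 'b::comm_ring_1) \<Rightarrow> 'b \<Rightarrow> 'a poly \<Rightarrow> 'b" where
  "evalp f b p = poly (map_poly f p) b"

lemma evalp_pCons [simp]: "f 0 = 0 \<Longrightarrow> evalp f b (pCons a p) = f a + b * evalp f b p"
  by (cases "a = 0 \<and> p = 0") (auto simp: evalp_def map_poly_pCons)

lemma evalp_0 [simp]: "evalp f b 0 = 0" by (simp add: evalp_def)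

lemma evalp_add:
  assumes "f 0 = 0" "\<And>x y. f (x + y) = f x + f y"
  shows "evalp f b (p + q) = evalp f b p + evalp f b q"
  by (induction p q rule: poly_induct2) (auto simp: assms algebra_simps)

lemma evalp_smult:
  assumes "f 0 = 0" "\<And>x y. f (x * y) = f x * f y"
  shows "evalp f b (Polynomial.smult a p) = f a * evalp f b p"
  by (induction p) (auto simp: assms algebra_simps)

lemma evalp_mult:
  assumes "f 0 = 0" "\<And>x y. f (x + y) = f x + f y" "\<And>x y. f (x * y) = f x * f y"
  shows "evalp f b (p * q) = evalp f b p * evalp f b q"
  by (induction p) (auto simp: assms evalp_add evalp_smult algebra_simps)

abbreviation const2 :: "complex \<Rightarrow> complex poly poly" where "const2 c \<equiv> [:[:c:]:]"

lemma subst2_evalp: "subst2 p a b = evalp (evalp const2 a) b p"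
  by (simp add: subst2_def evalp_def[abs_def])

lemma endo_eqI:
  assumes "ring_endo \<sigma>" "ring_endo \<tau>" and c: "\<And>c. \<sigma> (const2 c) = \<tau> (const2 c)"
    and u: "\<sigma> var_u = \<tau> var_u" and v: "\<sigma> var_v = \<tau> var_v"
  shows "\<sigma> p = \<tau> p"
proof -
  have *: "\<sigma> [:q:] = \<tau> [:q:]" for q
  proof (induction q)
    case 0 then show ?case using ring_endoD(4)[OF assms(1)] ring_endoD(4)[OF assms(2)] by simp
  next
    case (pCons a q)
    have e: "[:pCons a q:] = const2 a + var_u * [:q:]" by (simp add: var_u_def)
    show ?case
      by (simp only: e pCons.IH u c ring_endoD(1,2)[OF assms(1)] ring_endoD(1,2)[OF assms(2)])
  qed
  show ?thesis
  proof (induction p)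
    case 0 then show ?case using ring_endoD(4)[OF assms(1)] ring_endoD(4)[OF assms(2)] by simp
  next
    case (pCons a q)
    have e: "pCons a q = [:a:] + var_v * q" by (simp add: var_v_def)
    show ?case
      by (simp only: e pCons.IH v * ring_endoD(1,2)[OF assms(1)] ring_endoD(1,2)[OF assms(2)])
  qed
qed

lemma poly_act_endo: "ring_endo (poly_act g)"
proof -
  have e1: "evalp const2 a (p + q) = evalp const2 a p + evalp const2 a q" 
    "evalp const2 a (p * q) = evalp const2 a p * evalp const2 a q" for a p q
    by (intro evalp_add evalp_mult; simp)+
  have e2: "evalp (evalp const2 a) b (p + q) = evalp (evalp const2 a) b p + evalp (evalp const2 a) b q"
    "evalp (evalp const2 a) b (p * q) = evalp (evalp const2 a) b p * evalp (evalp const2 a) b q" for a b p q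
    by (intro evalp_add evalp_mult; simp add: e1)+
  have e3: "evalp (evalp const2 a) b 1 = 1" for a b
    by (simp add: one_pCons)
  show ?thesis
    unfolding ring_endo_def poly_act_def subst2_evalp by (simp add: e2 e3)
qed

lemmas poly_act_hom = ring_endoD[OF poly_act_endo]

lemma poly_act_const: "poly_act g (const2 c) = const2 c"
  by (simp add: poly_act_def subst2_evalp)

text \<open>
  Coefficients are row vectors: a matrix acts on the linear form by multiplication of \<open>w\<close> from the right.
\<close>

definition lin :: "complex^2 \<Rightarrow> complex poly poly" where
  "lin w = [:[:0, w $ 1:], [:w $ 2:]:]"

lemma poly_act_u: "poly_act g var_u = lin (row 1 g)"
  by (simp add: poly_act_def subst2_evalp var_u_def var_v_def lin_def row_def one_pCons)
lemma poly_act_v: "poly_act g var_v = lin (row 2 g)"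
  by (simp add: poly_act_def subst2_evalp var_u_def var_v_def lin_def row_def one_pCons)

lemma lin_eq: "lin w = const2 (w $ 1) * var_u + const2 (w $ 2) * var_v"
  by (simp add: lin_def var_u_def var_v_def)

lemma poly_act_lin: "poly_act g (lin w) = lin (w v* g)"
  unfolding lin_eq[of w] poly_act_hom poly_act_const poly_act_u poly_act_v
  by (simp add: lin_def row_def vector_matrix_mult_def sum_2 algebra_simps)

lemma lin_diff: "lin w - lin w' = lin (w - w')"
  by (simp add: lin_def)

lemma poly_act_comp: "poly_act g (poly_act h p) = poly_act (h ** g) p"
proof (rule endo_eqI[of "\<lambda>p. poly_act g (poly_act h p)"])
  show "ring_endo (\<lambda>p. poly_act g (poly_act h p))"
    unfolding ring_endo_def by (simp add: poly_act_hom)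
  show "ring_endo (poly_act (h ** g))" by (rule poly_act_endo)
  show "poly_act g (poly_act h var_u) = poly_act (h ** g) var_u"
    "poly_act g (poly_act h var_v) = poly_act (h ** g) var_v"
    unfolding poly_act_u poly_act_v poly_act_lin
    by (simp_all add: lin_def row_def vector_matrix_mult_def matrix_matrix_mult_def sum_2)
qed (simp add: poly_act_const)

lemma poly_act_one: "poly_act (mat 1) p = p"
proof (rule endo_eqI[of "poly_act (mat 1)" "\<lambda>p. p"])
  show "poly_act (mat 1) var_u = var_u" "poly_act (mat 1) var_v = var_v"
    unfolding poly_act_u poly_act_v by (simp_all add: lin_def row_def mat_def var_u_def var_v_def)
qed (simp_all add: poly_act_const poly_act_endo ring_endo_def[of "\<lambda>p. p"])

text \<open>
  By Cramer's rule a common divisor of the two forms divides \<open>u\<close> and \<open>v\<close>.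
\<close>

lemma coprime_lin:
  assumes "w $ 1 * w' $ 2 - w $ 2 * w' $ 1 \<noteq> 0"
  shows "coprime (lin w) (lin w')"
proof (rule coprimeI)
  fix d assume d: "d dvd lin w" "d dvd lin w'"
  define e where "e = w $ 1 * w' $ 2 - w $ 2 * w' $ 1"
  have 1: "const2 (w' $ 2) * lin w - const2 (w $ 2) * lin w' = const2 e * var_u"
    "const2 (w $ 1) * lin w' - const2 (w' $ 1) * lin w = const2 e * var_v"
    by (simp_all add: lin_def e_def var_u_def var_v_def algebra_simps)
  have "d dvd const2 e * var_u" "d dvd const2 e * var_v"
    unfolding 1[symmetric] by (intro dvd_diff dvd_mult d)+
  then have "d dvd const2 (inverse e) * (const2 e * var_u)" "d dvd const2 (inverse e) * (const2 e * var_v)"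
    by (simp_all only: dvd_mult)
  moreover have "e \<noteq> 0" using assms by (simp add: e_def)
  then have "const2 (inverse e) * (const2 e * var_u) = [:[:0, 1:]:]" "const2 (inverse e) * (const2 e * var_v) = [:0, 1:]"
    by (simp_all add: var_u_def var_v_def one_pCons)
  ultimately have u: "d dvd [:[:0, 1:]:]" and v: "d dvd [:0, 1:]" by simp_all
  from u have "Polynomial.degree d \<le> 0" by (metis dvd_imp_degree_le degree_pCons_0 pCons_eq_0_iff zero_neq_one)
  then obtain q where q: "d = [:q:]" by (metis degree_eq_zeroE le_zero_eq)
  from v obtain r where "[:0, 1:] = [:q:] * r" unfolding q dvd_def by blast
  then have "Polynomial.coeff [:0, 1:] 1 = q * Polynomial.coeff r 1" by simp
  then have "1 = q * Polynomial.coeff r 1" by simp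
  then have "q dvd 1" by (rule dvdI)
  then show "is_unit d" unfolding q by (simp add: is_unit_const_poly_iff)
qed

lemma lin_nz: "w \<noteq> 0 \<Longrightarrow> lin w \<noteq> 0"
  by (auto simp: lin_def vec_eq_iff forall_2)

text \<open>
  The equations are the entries of \<open>N\<^sup>2 = 0\<close> for \<open>N = g - 1\<close>, an instance of the Cayley-Hamilton theorem: a
  matrix with determinant 1 and trace 2 has the characteristic polynomial \<open>(X - 1)\<^sup>2\<close>.
\<close>

lemma unipotent_2x2:
  fixes a b c d :: "'a::comm_ring_1"
  assumes "a * d - b * c = 1" and tr: "a + d = 2"
  shows "(a - 1) * (a - 1) + b * c = 0" "c * b + (d - 1) * (d - 1) = 0"
    "(a - 1) * b + b * (d - 1) = 0" "c * (a - 1) + (d - 1) * c = 0"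
proof -
  have bc: "b * c = a * d - 1" using assms(1) by (metis diff_diff_eq2 add_diff_cancel_left' diff_add_cancel)
  have "(a - 1) * (a - 1) + b * c = a * (a + d - 2)" unfolding bc by (simp add: algebra_simps)
  then show "(a - 1) * (a - 1) + b * c = 0" using tr by simp
  have "c * b + (d - 1) * (d - 1) = b * c + (d - 1) * (d - 1)" by (simp add: mult.commute)
  also have "\<dots> = d * (a + d - 2)" unfolding bc by (simp add: algebra_simps)
  finally show "c * b + (d - 1) * (d - 1) = 0" using tr by simp
  have "(a - 1) * b + b * (d - 1) = b * (a + d - 2)" by (simp add: algebra_simps)
  then show "(a - 1) * b + b * (d - 1) = 0" using tr by simp
  have "c * (a - 1) + (d - 1) * c = c * (a + d - 2)" by (simp add: algebra_simps)
  then show "c * (a - 1) + (d - 1) * c = 0" using tr by simp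
qed

text \<open>
  If 1 is an eigenvalue of \<open>g\<close>, so is its inverse, and \<open>N = g - 1\<close> has square zero.  The powers
  \<open>g\<^sup>n = 1 + n N\<close> are then pairwise different unless \<open>N = 0\<close>.
\<close>

lemma finite_SL2_fixed_point_free:
  fixes G :: "(complex^2^2) set" and g
  assumes fin: "finite G" and one: "mat 1 \<in> G" and mult: "\<And>g h. g \<in> G \<Longrightarrow> h \<in> G \<Longrightarrow> g ** h \<in> G"
    and g: "g \<in> G" "det g = 1" "g \<noteq> mat 1"
  shows "det (mat 1 - g) \<noteq> 0"
proof
  assume d: "det (mat 1 - g) = 0"
  define N where "N = g - mat 1"
  have ge: "g = mat 1 + N" by (simp add: N_def)
  have g12: "g$1$1 * g$2$2 - g$1$2 * g$2$1 = 1" using g(2) by (simp add: det_2)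
  have "(1 - g$1$1) * (1 - g$2$2) - g$1$2 * g$2$1 = 0" using d by (simp add: det_2 mat_def)
  moreover have "(1 - g$1$1) * (1 - g$2$2) - g$1$2 * g$2$1
      = 1 + (g$1$1 * g$2$2 - g$1$2 * g$2$1) - (g$1$1 + g$2$2)" by (simp add: algebra_simps)
  ultimately have tr: "g$1$1 + g$2$2 = 2" unfolding g12 by simp
  have NN: "N ** N = 0"
    using unipotent_2x2[OF g12 tr] by (simp add: N_def vec_eq_iff forall_2 matrix_matrix_mult_def sum_2 mat_def)
  define p where "p n = (\<chi> i j. mat 1 $ i $ j + of_nat n * N $ i $ j)" for n :: nat
  have pS: "p (Suc n) = p n ** g" for n
  proof -
    have "(N ** N) $ i $ j = 0" for i j by (simp add: NN)
    then have e: "N$i$1 * N$1$j + N$i$2 * N$2$j = 0" for i j by (simp add: matrix_matrix_mult_def sum_2)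
    have f: "of_nat n * (N$i$1 * N$1$j) + of_nat n * (N$i$2 * N$2$j) = 0" for i j
      using arg_cong[OF e[of i j], of "\<lambda>x. of_nat n * x"] by (simp add: distrib_left)
    show ?thesis
      using f[of 1 1] f[of 1 2] f[of 2 1] f[of 2 2]
      by (simp add: ge p_def vec_eq_iff forall_2 matrix_matrix_mult_def sum_2 mat_def algebra_simps)
  qed
  have pG: "p n \<in> G" for n
  proof (induction n)
    case 0
    have "p 0 = mat 1" by (simp add: p_def vec_eq_iff)
    then show ?case using one by simp
  next
    case (Suc n) then show ?case using pS mult g(1) by simp
  qed
  obtain i j where ij: "N $ i $ j \<noteq> 0" using g(3) by (auto simp: N_def vec_eq_iff)
  have "inj p"
  proof (rule injI)
    fix m n assume "p m = p n"
    then have "p m $ i $ j = p n $ i $ j" by simp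
    then show "m = n" using ij by (simp add: p_def)
  qed
  moreover have "finite (range p)" using pG fin by (meson finite_subset image_subsetI)
  ultimately show False using finite_imageD infinite_UNIV_nat by blast
qed

section \<open>Invariants of finite subgroups of \<open>SL(2,\<complex>)\<close>\<close>

lemma act_group:
  fixes G :: "(complex^2^2) set"
  assumes fin: "finite G" and one: "mat 1 \<in> G" and mult: "\<And>g h. g \<in> G \<Longrightarrow> h \<in> G \<Longrightarrow> g ** h \<in> G"
    and det1: "\<And>g. g \<in> G \<Longrightarrow> det g = 1"
  shows "finite_aut_group (poly_act ` G)"
proof -
  have inverse: "\<exists>h\<in>G. g ** h = mat 1 \<and> h ** g = mat 1" if g: "g \<in> G" for g
  proof -
    have "invertible g" using det1[OF g] by (simp add: invertible_det_nz)
    then obtain g' where g': "g' ** g = mat 1" by (auto simp: invertible_def)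
    \<comment> \<open>Multiplication by \<open>g\<close> is injective on the finite set \<open>G\<close>, hence surjective.\<close>
    have "inj_on (\<lambda>h. g ** h) G"
    proof (rule inj_onI)
      fix x y assume "g ** x = g ** y"
      then have "g' ** (g ** x) = g' ** (g ** y)" by simp
      then show "x = y" by (simp add: matrix_mul_assoc g')
    qed
    then have "(\<lambda>h. g ** h) ` G = G" using fin mult g by (intro endo_inj_surj) auto
    then obtain h where "h \<in> G" "g ** h = mat 1" using one by (metis imageE)
    then show ?thesis using matrix_left_right_inverse by blast
  qed
  have inv: "bij (poly_act g) \<and> inv_into UNIV (poly_act g) \<in> poly_act ` G" if g: "g \<in> G" for g
  proof -
    obtain h where h: "h \<in> G" "g ** h = mat 1" "h ** g = mat 1" using inverse[OF g] by blast
    have "poly_act g \<circ> poly_act h = id" "poly_act h \<circ> poly_act g = id"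
      by (auto simp: fun_eq_iff poly_act_comp h poly_act_one)
    then show ?thesis using o_bij inv_unique_comp h(1) by (metis image_eqI)
  qed
  have "card (poly_act ` G) \<noteq> 0" using fin one by auto
  then have "of_nat (card (poly_act ` G)) * const2 (inverse (of_nat (card (poly_act ` G)))) = 1"
    by (simp add: of_nat_poly one_pCons)
  then have card: "\<exists>\<kappa>::complex poly poly. of_nat (card (poly_act ` G)) * \<kappa> = 1" by blast
  show ?thesis
  proof unfold_locales
    show "finite (poly_act ` G)" using fin by simp
    have "id = poly_act (mat 1)" by (auto simp: fun_eq_iff poly_act_one)
    then show "id \<in> poly_act ` G" using one by blast
    fix \<sigma> assume \<sigma>: "\<sigma> \<in> poly_act ` G"
    show "bij \<sigma>" "inv_into UNIV \<sigma> \<in> poly_act ` G" "ring_endo \<sigma>"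
      using \<sigma> inv poly_act_endo by auto
    fix \<tau> assume \<tau>: "\<tau> \<in> poly_act ` G"
    obtain g h where gh: "g \<in> G" "h \<in> G" "\<sigma> = poly_act g" "\<tau> = poly_act h" using \<sigma> \<tau> by blast
    then have "\<sigma> \<circ> \<tau> = poly_act (h ** g)" by (auto simp: fun_eq_iff poly_act_comp)
    then show "\<sigma> \<circ> \<tau> \<in> poly_act ` G" using mult gh by blast
  qed (rule card)
qed

definition cross :: "complex^2 \<Rightarrow> complex^2 \<Rightarrow> complex" where
  "cross w w' = w $ 1 * w' $ 2 - w $ 2 * w' $ 1"

text \<open>
  On the affine line of vectors \<open>(1, t)\<close> the condition \<open>cross w (x v* M) = 0\<close> is an affine equation in \<open>t\<close>.
  It is not identically satisfied because \<open>M\<close> is invertible and \<open>w \<noteq> 0\<close>, so finitely many \<open>t\<close> are excluded.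
\<close>

lemma generic_vector:
  fixes W :: "(complex^2) set" and Ms :: "(complex^2^2) set"
  assumes "finite W" "finite Ms" and nz: "\<And>w. w \<in> W \<Longrightarrow> w \<noteq> 0" and det: "\<And>M. M \<in> Ms \<Longrightarrow> det M \<noteq> 0"
  obtains x :: "complex^2" where "x \<noteq> 0" "\<And>w M. w \<in> W \<Longrightarrow> M \<in> Ms \<Longrightarrow> cross w (x v* M) \<noteq> 0"
proof -
  define x :: "complex \<Rightarrow> complex^2" where "x t = (\<chi> i. if i = 1 then 1 else t)" for t
  define bad where "bad w M = {t. cross w (x t v* M) = 0}" for w M
  have x1: "x t $ 1 = 1" and x2: "x t $ 2 = t" for t by (simp_all add: x_def)
  have "finite (bad w M)" if w: "w \<in> W" and M: "M \<in> Ms" for w M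
  proof -
    define A where "A = w$1 * M$1$2 - w$2 * M$1$1"
    define B where "B = w$1 * M$2$2 - w$2 * M$2$1"
    have eq: "cross w (x t v* M) = A + t * B" for t
      by (simp add: cross_def vector_matrix_mult_def sum_2 x1 x2 A_def B_def algebra_simps)
    show ?thesis
    proof (cases "B = 0")
      case False
      then have "bad w M \<subseteq> {- A / B}" unfolding bad_def eq by (auto simp: field_simps add_eq_0_iff)
      then show ?thesis using finite_subset by blast
    next
      case True
      have "w$1 * det M = M$1$1 * B - M$2$1 * A" "w$2 * det M = M$1$2 * B - M$2$2 * A"
        by (simp_all add: det_2 A_def B_def algebra_simps)
      moreover have "w$1 \<noteq> 0 \<or> w$2 \<noteq> 0" using nz[OF w] by (auto simp: vec_eq_iff forall_2)
      ultimately have "A \<noteq> 0" using det[OF M] True by auto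
      then show ?thesis unfolding bad_def eq using True by simp
    qed
  qed
  then have "finite (\<Union>w\<in>W. \<Union>M\<in>Ms. bad w M)" using assms(1,2) by auto
  then obtain t where t: "t \<notin> (\<Union>w\<in>W. \<Union>M\<in>Ms. bad w M)"
    using ex_new_if_finite infinite_UNIV_char_0 by blast
  have "x t \<noteq> 0" using x1[of t] by (metis zero_index zero_neq_one)
  then show thesis using t by (intro that[of "x t"]) (auto simp: bad_def)
qed

locale finite_SL2_pair =
  fixes G1 G2 :: "(complex^2^2) set"
  assumes fin: "finite G2" and sub: "G1 \<subseteq> G2" and one: "mat 1 \<in> G1"
    and mult1: "g \<in> G1 \<Longrightarrow> h \<in> G1 \<Longrightarrow> g ** h \<in> G1"
    and mult2: "g \<in> G2 \<Longrightarrow> h \<in> G2 \<Longrightarrow> g ** h \<in> G2"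
    and det1: "g \<in> G2 \<Longrightarrow> det g = 1"
begin

definition P :: "complex poly poly set" where "P = fixed_ring (poly_act ` G1)"
definition Q :: "complex poly poly set" where "Q = fixed_ring (poly_act ` G2)"

lemma aut1: "finite_aut_group (poly_act ` G1)"
  using fin sub one mult1 det1 by (intro act_group) (auto intro: finite_subset)

sublocale aut2: finite_aut_group "poly_act ` G2"
  using fin sub one mult2 det1 by (intro act_group) auto

text \<open>
  The matrices that occur when \<open>\<sigma> (l - \<tau> l)\<close>, for \<open>\<sigma>\<close> and \<open>\<tau>\<close> in the group and \<open>\<tau>\<close> nontrivial, is written in terms of the
  coefficients of the linear form \<open>l\<close>.
\<close>

definition Ms :: "(complex^2^2) set" where
  "Ms = (\<lambda>(g, h). (mat 1 - h) ** g) ` (G2 \<times> (G2 - {mat 1}))"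

lemma finite_Ms: "finite Ms" using fin by (simp add: Ms_def)

lemma det_Ms: "M \<in> Ms \<Longrightarrow> det M \<noteq> 0"
  unfolding Ms_def
  using finite_SL2_fixed_point_free[OF fin _ mult2] sub one det1 by (auto simp: det_mul)

text \<open>
  A multiplicative property of the discriminant of a linear form may be checked on its linear factors.
\<close>

lemma disc_lin_factors:
  assumes "\<And>M. M \<in> Ms \<Longrightarrow> R (lin (w v* M))" "R 1" "\<And>a b. R a \<Longrightarrow> R b \<Longrightarrow> R (a * b)"
  shows "R (aut2.disc (lin w))"
proof -
  have prodI: "(\<And>i. i \<in> I \<Longrightarrow> R (f i)) \<Longrightarrow> R (prod f I)" for I and f :: "_ \<Rightarrow> complex poly poly"
    by (induction I rule: infinite_finite_induct) (auto simp: assms)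
  show ?thesis
    unfolding aut2.disc_def aut2.nontrivial_diffs_def
  proof (intro prodI)
    fix \<sigma> assume \<sigma>: "\<sigma> \<in> poly_act ` G2"
    then obtain g where g: "g \<in> G2" "\<sigma> = poly_act g" by blast
    have "R (\<Prod>\<tau>\<in>poly_act ` G2 - {id}. \<sigma> (lin w - \<tau> (lin w)))"
    proof (intro prodI)
      fix \<tau> assume \<tau>: "\<tau> \<in> poly_act ` G2 - {id}"
      then obtain h where h: "h \<in> G2" "\<tau> = poly_act h" by blast
      have "h \<noteq> mat 1" using \<tau> h poly_act_one by auto
      then have "(mat 1 - h) ** g \<in> Ms" using h(1) g(1) by (auto simp: Ms_def)
      moreover have "\<sigma> (lin w - \<tau> (lin w)) = lin (w v* ((mat 1 - h) ** g))"
        unfolding g h poly_act_lin lin_diff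
        by (simp add: lin_def vector_matrix_mult_def matrix_matrix_mult_def sum_2 mat_def algebra_simps)
      ultimately show "R (\<sigma> (lin w - \<tau> (lin w)))" using assms(1) by simp
    qed
    then show "R (\<sigma> (\<Prod>\<tau>\<in>poly_act ` G2 - {id}. lin w - \<tau> (lin w)))"
      by (simp add: g(2) poly_act_hom(9))
  qed
qed

lemma vec_mat_nz: "det M \<noteq> 0 \<Longrightarrow> w \<noteq> 0 \<Longrightarrow> w v* (M :: complex^2^2) \<noteq> 0"
  by (metis det_transpose invertible_det_nz matrix_left_invertible_ker invertible_def transpose_matrix_vector)

text \<open>
  The discriminants of two linear forms in general position have no linear factor in common.
\<close>

lemma coprime_tensors:
  obtains I1 I2 :: "(complex poly poly \<Rightarrow> complex poly poly) set set" and a1 b1 \<tau>1 F1 a2 b2 \<tau>2 F2 where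
    "separable_pair P Q I1 a1 b1 \<tau>1 F1" "separable_pair P Q I2 a2 b2 \<tau>2 F2" "coprime F1 F2"
proof -
  define w :: "complex^2" where "w = (\<chi> i. 1)"
  have w: "w \<noteq> 0" by (simp add: w_def vec_eq_iff)
  obtain x where x: "x \<noteq> 0" "\<And>y M. y \<in> (\<lambda>M. w v* M) ` Ms \<Longrightarrow> M \<in> Ms \<Longrightarrow> cross y (x v* M) \<noteq> 0"
    using generic_vector[of "(\<lambda>M. w v* M) ` Ms" Ms] finite_Ms det_Ms vec_mat_nz w by (metis (no_types, lifting) finite_imageI image_iff)
  have nz: "aut2.disc (lin y) \<noteq> 0" if "y \<noteq> 0" for y
    by (rule disc_lin_factors[of "\<lambda>z. z \<noteq> 0"]) (simp_all add: lin_nz vec_mat_nz det_Ms that)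
  have cop: "coprime (aut2.disc (lin w)) (aut2.disc (lin x))"
  proof (rule disc_lin_factors[of "\<lambda>z. coprime z (aut2.disc (lin x))"])
    fix M assume M: "M \<in> Ms"
    show "coprime (lin (w v* M)) (aut2.disc (lin x))"
    proof (rule disc_lin_factors[of "\<lambda>z. coprime (lin (w v* M)) z"])
      fix M' assume "M' \<in> Ms"
      then show "coprime (lin (w v* M)) (lin (x v* M'))"
        using x(2) M by (intro coprime_lin) (auto simp: cross_def)
    qed auto
  qed auto
  define n where "n = (of_nat (card (poly_act ` G1)) :: complex poly poly)"
  have "is_unit n" unfolding n_def using finite_aut_group.card_unit[OF aut1] by (metis dvdI)
  then have cop': "coprime (n * aut2.disc (lin w)) (n * aut2.disc (lin x))"
    using cop by (simp add: is_unit_left_imp_coprime is_unit_right_imp_coprime)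
  have "poly_act ` G1 \<subseteq> poly_act ` G2" using sub by blast
  note * = aut2.relative_tensor[OF aut1 this, folded P_def Q_def n_def]
  show thesis using *[OF nz[OF w]] *[OF nz[OF x(1)]] cop' that by blast
qed

lemma subring_PQ: "subring_pair P Q"
  using coprime_tensors separable_pair.axioms(1) by metis

sublocale PQ: subring_pair P Q by (rule subring_PQ)

text \<open>
  Invariance under \<open>G\<^sub>1\<close> can be tested after multiplication by a nonzero invariant.
\<close>

lemma P_sat: assumes "F \<in> Q" "F \<noteq> 0" "F\<^sup>2 * x \<in> P" shows "x \<in> P"
  unfolding P_def fixed_ring_def
proof (intro CollectI ballI)
  fix \<sigma> assume \<sigma>: "\<sigma> \<in> poly_act ` G1"
  have "\<sigma> F = F" using assms(1) \<sigma> sub by (auto simp: Q_def fixed_ring_def)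
  moreover have "\<sigma> (F\<^sup>2 * x) = F\<^sup>2 * x" using assms(3) \<sigma> by (auto simp: P_def fixed_ring_def)
  moreover have "\<sigma> (F\<^sup>2 * x) = \<sigma> F * \<sigma> F * \<sigma> x" using \<sigma> by (auto simp: poly_act_hom power2_eq_square)
  ultimately have "F\<^sup>2 * \<sigma> x = F\<^sup>2 * x" by (metis power2_eq_square)
  then show "\<sigma> x = x" using assms(2) by simp
qed

lemma derivation_zero:
  assumes "PQ.additive D" "\<And>x y. x \<in> P \<Longrightarrow> y \<in> P \<Longrightarrow> D (x * y) = x * D y + y * D x"
    "\<And>q. q \<in> Q \<Longrightarrow> D q = 0" "x \<in> P"
  shows "D x = 0"
  using coprime_tensors separable_pair.derivation_zero[OF _ assms] by metis

lemma cocycle_trivial: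
  assumes c: "PQ.cocycle c"
    and \<beta>_P: "\<And>q. q \<in> Q \<Longrightarrow> \<beta> q \<in> P"
    and \<beta>_add: "\<And>q q'. q \<in> Q \<Longrightarrow> q' \<in> Q \<Longrightarrow> \<beta> (q + q') = \<beta> q + \<beta> q'"
    and c\<beta>: "\<And>q q'. q \<in> Q \<Longrightarrow> q' \<in> Q \<Longrightarrow> c q q' = defect \<beta> q q'"
  obtains h where "PQ.additive h" "\<And>x. x \<in> P \<Longrightarrow> h x \<in> P" "\<And>q. q \<in> Q \<Longrightarrow> h q = \<beta> q"
    "\<And>x y. x \<in> P \<Longrightarrow> y \<in> P \<Longrightarrow> defect h x y = c x y"
proof -
  obtain I1 I2 :: "(complex poly poly \<Rightarrow> complex poly poly) set set" and a1 b1 \<tau>1 F1 a2 b2 \<tau>2 F2 where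
    s: "separable_pair P Q I1 a1 b1 \<tau>1 F1" "separable_pair P Q I2 a2 b2 \<tau>2 F2" "coprime F1 F2"
    by (rule coprime_tensors)
  have F: "F1 \<in> Q" "F1 \<noteq> 0" using separable_pair.F_Q[OF s(1)] separable_pair.F_nz[OF s(1)] by auto
  show thesis
  proof (rule coprime_cocycle_trivial[OF s P_sat[OF F] c _ _ _ \<beta>_P \<beta>_add c\<beta>])
    show "PQ.additive aut2.average" by (simp add: PQ.additive_def aut2.average_add)
    show "aut2.average x \<in> Q" for x using aut2.average_fixed by (simp add: Q_def)
    show "aut2.average q = q" if "q \<in> Q" for q using aut2.average_id that by (simp add: Q_def)
  qed (use that in blast)+
qed

end

section \<open>Homogeneity of solutions\<close>

text \<open>
  The polynomial is homogeneous of degree \<open>d - n\<close>, and zero if \<open>d < n\<close>.  Writing the degree with a shift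
  avoids negative degrees: a symbol of order \<open>n\<close> lowers degrees by \<open>n\<close>.
\<close>

definition shifted :: "nat \<Rightarrow> nat \<Rightarrow> complex poly poly \<Rightarrow> bool" where
  "shifted n d p \<longleftrightarrow> (\<forall>i j. Polynomial.coeff (Polynomial.coeff p j) i \<noteq> 0 \<longrightarrow> i + j + n = d)"

abbreviation homog :: "nat \<Rightarrow> complex poly poly \<Rightarrow> bool" where "homog \<equiv> shifted 0"

abbreviation scale_act :: "complex \<Rightarrow> complex poly poly \<Rightarrow> complex poly poly" where
  "scale_act t \<equiv> poly_act (mat t)"

lemma coeff_const2 [simp]: "Polynomial.coeff (Polynomial.coeff (const2 c * p) j) i = c * Polynomial.coeff (Polynomial.coeff p j) i"
  by simp

lemma coeff_scale_act:
  "Polynomial.coeff (Polynomial.coeff (scale_act t p) j) i = t ^ (i + j) * Polynomial.coeff (Polynomial.coeff p j) i"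
proof -
  have e: "scale_act t p = evalp (evalp const2 [:[:0, t:]:]) [:0, [:t:]:] p" for p
    by (simp add: poly_act_def subst2_evalp mat_def var_u_def var_v_def one_pCons)
  have 1: "evalp const2 [:[:0, t:]:] q = [:pcompose q [:0, t:]:]" for q
    by (induction q) (simp_all add: pcompose_pCons)
  have 2: "Polynomial.coeff (pcompose q [:0, t:]) i = t ^ i * Polynomial.coeff q i" for q i
  proof (induction q arbitrary: i)
    case (pCons a q) then show ?case by (cases i) (simp_all add: pcompose_pCons coeff_pCons)
  qed simp
  show ?thesis
  proof (induction p arbitrary: j)
    case 0 then show ?case by (simp add: poly_act_hom)
  next
    case (pCons a p)
    have "scale_act t (pCons a p) = [:pcompose a [:0, t:]:] + [:0, [:t:]:] * scale_act t p"
      by (simp add: e 1)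
    then show ?case using pCons.IH by (cases j) (simp_all add: coeff_pCons 2)
  qed
qed

lemma homog_scale: "homog d p \<Longrightarrow> scale_act t p = const2 (t ^ d) * p"
proof (intro poly_eqI)
  fix i j assume "homog d p"
  then show "Polynomial.coeff (Polynomial.coeff (scale_act t p) j) i = Polynomial.coeff (Polynomial.coeff (const2 (t ^ d) * p) j) i"
    unfolding coeff_scale_act coeff_const2
    by (cases "Polynomial.coeff (Polynomial.coeff p j) i = 0") (auto simp: shifted_def)
qed

text \<open>
  Rescaling both variables by 2 separates degrees, since different powers of 2 are different.
\<close>

lemma shifted_iff: "shifted n d p \<longleftrightarrow> const2 (2 ^ n) * scale_act 2 p = const2 (2 ^ d) * p"
proof -
  have pow: "(2::complex) ^ a = 2 ^ b \<longleftrightarrow> a = b" for a b :: nat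
  proof
    assume "(2::complex) ^ a = 2 ^ b"
    then have "norm ((2::complex) ^ a) = norm ((2::complex) ^ b)" by simp
    then show "a = b" by (simp add: norm_power)
  qed simp
  have "shifted n d p \<longleftrightarrow> (\<forall>j i. 2 ^ n * (2 ^ (i + j) * Polynomial.coeff (Polynomial.coeff p j) i) = 2 ^ d * Polynomial.coeff (Polynomial.coeff p j) i)"
    unfolding shifted_def mult.assoc[symmetric] power_add[symmetric] add.commute[of n]
    by (auto simp: pow)
  also have "\<dots> \<longleftrightarrow> const2 (2 ^ n) * scale_act 2 p = const2 (2 ^ d) * p"
    unfolding poly_eq_iff coeff_const2 coeff_scale_act ..
  finally show ?thesis .
qed

definition graded_set :: "complex poly poly set \<Rightarrow> bool" where
  "graded_set X \<longleftrightarrow> (\<forall>p\<in>X. \<exists>f N. (\<forall>d. f d \<in> X \<and> homog d (f d)) \<and> p = (\<Sum>d<N::nat. f d))"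

context finite_SL2_pair
begin

lemma const_Q: "const2 k \<in> Q"
  by (auto simp: Q_def fixed_ring_def poly_act_const)

lemma const_P: "const2 k \<in> P"
  using const_Q PQ.Q_P by blast

sublocale QQ: subring_pair Q Q
  by unfold_locales (auto simp: Q_def fixed_ring_def poly_act_hom)

lemma scale_act_comm: "scale_act t (poly_act g p) = poly_act g (scale_act t p)"
proof -
  have "g ** mat t = mat t ** g"
    by (simp add: matrix_matrix_mult_def mat_def vec_eq_iff forall_2 sum_2)
  then show ?thesis by (simp add: poly_act_comp)
qed

lemma scale_act_P: "p \<in> P \<Longrightarrow> scale_act t p \<in> P"
  by (auto simp: P_def fixed_ring_def scale_act_comm[symmetric])
lemma scale_act_Q: "p \<in> Q \<Longrightarrow> scale_act t p \<in> Q"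
  by (auto simp: Q_def fixed_ring_def scale_act_comm[symmetric])

lemma scale_act_inverse: "t \<noteq> 0 \<Longrightarrow> scale_act t (scale_act (inverse t) p) = p"
proof -
  assume t: "t \<noteq> 0"
  have "mat (inverse t) ** mat t = (mat 1 :: complex^2^2)"
    using t by (simp add: matrix_matrix_mult_def mat_def vec_eq_iff forall_2 sum_2)
  then show ?thesis by (simp add: poly_act_comp poly_act_one)
qed

text \<open>
  The equations for \<open>h\<close> are invariant under conjugation with rescaling of the variables, combined with
  the factor \<open>2\<^sup>n\<close>.  As the solution is unique, it is itself invariant, which means homogeneous of degree \<open>-n\<close>.
  Linearity over \<open>\<complex>\<close> follows from the equations, because constants lie in \<open>Q\<close>.
\<close>

lemma homogeneous_cocycle_trivial:
  assumes c: "PQ.cocycle c"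
    and c_lin: "\<And>k x y. x \<in> P \<Longrightarrow> y \<in> P \<Longrightarrow> c (const2 k * x) y = const2 k * c x y"
    and \<beta>_P: "\<And>q. q \<in> Q \<Longrightarrow> \<beta> q \<in> P"
    and \<beta>_add: "\<And>q q'. q \<in> Q \<Longrightarrow> q' \<in> Q \<Longrightarrow> \<beta> (q + q') = \<beta> q + \<beta> q'"
    and \<beta>_lin: "\<And>k q. q \<in> Q \<Longrightarrow> \<beta> (const2 k * q) = const2 k * \<beta> q"
    and c\<beta>: "\<And>q q'. q \<in> Q \<Longrightarrow> q' \<in> Q \<Longrightarrow> c q q' = defect \<beta> q q'"
    and gr: "graded_set P" "graded_set Q"
    and c_deg: "\<And>d e x y. x \<in> P \<Longrightarrow> y \<in> P \<Longrightarrow> homog d x \<Longrightarrow> homog e y \<Longrightarrow> shifted n (d + e) (c x y)"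
    and \<beta>_deg: "\<And>d q. q \<in> Q \<Longrightarrow> homog d q \<Longrightarrow> shifted n d (\<beta> q)"
  obtains h where "PQ.additive h" "\<And>x. x \<in> P \<Longrightarrow> h x \<in> P" "\<And>q. q \<in> Q \<Longrightarrow> h q = \<beta> q"
    "\<And>x y. x \<in> P \<Longrightarrow> y \<in> P \<Longrightarrow> defect h x y = c x y"
    "\<And>k x. x \<in> P \<Longrightarrow> h (const2 k * x) = const2 k * h x"
    "\<And>d x. x \<in> P \<Longrightarrow> homog d x \<Longrightarrow> shifted n d (h x)"
proof -
  obtain h where h: "PQ.additive h" "\<And>x. x \<in> P \<Longrightarrow> h x \<in> P" "\<And>q. q \<in> Q \<Longrightarrow> h q = \<beta> q"
    "\<And>x y. x \<in> P \<Longrightarrow> y \<in> P \<Longrightarrow> defect h x y = c x y"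
    using cocycle_trivial[OF c \<beta>_P \<beta>_add c\<beta>] by blast
  have hm: "h (x * y) = x * h y + y * h x + c x y" if "x \<in> P" "y \<in> P" for x y
    using h(4)[OF that] by (simp add: defect_def algebra_simps)
  note csym = PQ.cocycleD(2)[OF c] and cadd = PQ.cocycleD(3)[OF c]
  have h_lin: "h (const2 k * x) = const2 k * h x" if x: "x \<in> P" for k x
  proof -
    have "const2 1 = 1" by (simp add: one_pCons)
    then have \<beta>k: "\<beta> (const2 k) = const2 k * \<beta> 1" and ck: "c (const2 k) x = const2 k * c 1 x"
      using \<beta>_lin[of 1 k] c_lin[of 1 x k] PQ.one_P PQ.one_Q x by simp_all
    have "c 1 x = - (x * \<beta> 1)" using hm[OF PQ.one_P x] h(3)[OF PQ.one_Q]
      by (simp add: eq_neg_iff_add_eq_0 add.commute)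
    then show ?thesis
      using hm[OF const_P x, of k] h(3)[OF const_Q, of k] \<beta>k ck by (simp add: algebra_simps)
  qed
  define S where "S p = const2 (2 ^ n) * scale_act 2 p" for p
  have S_add: "S (p + q) = S p + S q" and S_sum: "S (sum f I) = (\<Sum>i\<in>I. S (f i))" and S_mult: "S (p * q) = scale_act 2 p * S q" for p q f and I :: "nat set"
    by (simp_all add: S_def poly_act_hom sum_distrib_left algebra_simps del: mult_pCons_left)
  have Sc0: "S (c x y) = c (scale_act 2 x) (scale_act 2 y)" if xy: "x \<in> P" "y \<in> P" "homog d x" "homog e y" for x y d e
  proof -
    have "S (c x y) = const2 (2 ^ (d + e)) * c x y"
      using c_deg[OF xy] unfolding shifted_iff S_def .
    also have "\<dots> = const2 (2 ^ d) * (const2 (2 ^ e) * c x y)" by (simp add: power_add)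
    also have "const2 (2 ^ e) * c x y = c x (const2 (2 ^ e) * y)"
      using c_lin[OF xy(2,1)] csym xy PQ.mult_P const_P by metis
    also have "const2 (2 ^ d) * \<dots> = c (const2 (2 ^ d) * x) (const2 (2 ^ e) * y)"
      using xy PQ.mult_P const_P by (metis c_lin)
    finally show ?thesis using homog_scale xy by metis
  qed
  have Sc: "S (c x y) = c (scale_act 2 x) (scale_act 2 y)" if xy: "x \<in> P" "y \<in> P" for x y
  proof -
    obtain f M where f: "\<And>d. f d \<in> P" "\<And>d. homog d (f d)" "x = (\<Sum>d<M::nat. f d)"
      using gr(1) xy(1) unfolding graded_set_def by metis
    obtain g N where g: "\<And>d. g d \<in> P" "\<And>d. homog d (g d)" "y = (\<Sum>d<N::nat. g d)"
      using gr(1) xy(2) unfolding graded_set_def by metis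
    have sum2: "c (\<Sum>d<M. a d) (\<Sum>d<N. b d) = (\<Sum>e<N. \<Sum>d<M. c (a d) (b e))"
      if "\<And>d. a d \<in> P" "\<And>d. b d \<in> P" for a b
    proof -
      have "c (\<Sum>d<M. a d) (\<Sum>d<N. b d) = (\<Sum>e<N. c (\<Sum>d<M. a d) (b e))"
        using that by (intro PQ.additive_sum cadd PQ.sum_P)
      also have "\<dots> = (\<Sum>e<N. c (b e) (\<Sum>d<M. a d))"
        using that by (intro sum.cong refl csym PQ.sum_P)
      also have "\<dots> = (\<Sum>e<N. \<Sum>d<M. c (b e) (a d))"
        using that by (intro sum.cong refl PQ.additive_sum cadd)
      finally show ?thesis using csym that by simp
    qed
    show ?thesis
      unfolding f(3) g(3) poly_act_hom
      by (simp add: sum2 f g scale_act_P S_sum Sc0[OF f(1) g(1) f(2) g(2)])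
  qed
  have S\<beta>: "S (\<beta> q) = \<beta> (scale_act 2 q)" if q: "q \<in> Q" for q
  proof -
    obtain f M where f: "\<And>d. f d \<in> Q" "\<And>d. homog d (f d)" "q = (\<Sum>d<M::nat. f d)"
      using gr(2) q unfolding graded_set_def by metis
    have b: "QQ.additive \<beta>" using \<beta>_add by (simp add: QQ.additive_def)
    have "S (\<beta> (f d)) = \<beta> (scale_act 2 (f d))" for d
      using \<beta>_deg[OF f(1,2)] \<beta>_lin[OF f(1)] homog_scale[OF f(2)] unfolding shifted_iff S_def by metis
    then show ?thesis
      unfolding f(3) poly_act_hom by (simp add: QQ.additive_sum[OF b] f scale_act_Q S_sum)
  qed
  \<comment> \<open>The difference of the conjugate of \<open>h\<close> and \<open>h\<close> itself is a derivation over \<open>Q\<close>.\<close>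
  define D where "D x = S (h (scale_act (inverse 2) x)) - h x" for x
  have inv2: "scale_act 2 (scale_act (inverse 2) x) = x" for x by (rule scale_act_inverse) simp
  have D0: "D x = 0" if "x \<in> P" for x
  proof (rule derivation_zero[OF _ _ _ that])
    show "PQ.additive D"
      using h(1) by (auto simp: PQ.additive_def D_def poly_act_hom scale_act_P S_add)
    show "D q = 0" if "q \<in> Q" for q
      using S\<beta>[of "scale_act (inverse 2) q"] that by (simp add: D_def h(3) scale_act_Q inv2[simplified])
    fix x y assume xy: "x \<in> P" "y \<in> P"
    define x' y' where "x' = scale_act (inverse 2) x" and "y' = scale_act (inverse 2) y"
    have *: "x' \<in> P" "y' \<in> P" "scale_act 2 x' = x" "scale_act 2 y' = y"
      using xy by (auto simp: x'_def y'_def scale_act_P inv2[simplified])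
    have "S (h (x' * y')) = x * S (h y') + y * S (h x') + c x y"
      using hm[OF *(1,2)] Sc[OF *(1,2)] * by (simp add: S_add S_mult)
    then have "D (x * y) = (x * S (h y') + y * S (h x') + c x y) - (x * h y + y * h x + c x y)"
      using hm[OF xy] by (simp add: D_def x'_def y'_def poly_act_hom)
    also have "\<dots> = x * (S (h y') - h y) + y * (S (h x') - h x)" by (simp add: algebra_simps)
    finally show "D (x * y) = x * D y + y * D x" by (simp add: D_def x'_def y'_def)
  qed
  have deg: "shifted n d (h x)" if x: "x \<in> P" "homog d x" for d x
  proof -
    have "h x = S (h (const2 (inverse 2 ^ d) * x))"
      using D0[OF x(1)] homog_scale[OF x(2)] by (simp add: D_def del: mult_pCons_left)
    also have "\<dots> = S (const2 (inverse 2 ^ d) * h x)" using h_lin[OF x(1)] by (simp only:)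
    also have "\<dots> = const2 (inverse 2 ^ d) * S (h x)" using S_mult[of "const2 (inverse 2 ^ d)" "h x"] by (simp only: poly_act_const)
    finally have "const2 (2 ^ d) * h x = (const2 (2 ^ d) * const2 (inverse 2 ^ d)) * S (h x)" by (simp only: mult.assoc)
    also have "const2 (2 ^ d) * const2 (inverse 2 ^ d) = 1" by (simp add: one_pCons power_mult_distrib[symmetric])
    finally show ?thesis unfolding shifted_iff S_def by simp
  qed
  show thesis by (rule that[OF h h_lin deg])
qed

end

section \<open>Functionals on flat modules\<close>

text \<open>
  The additive extension of \<open>f\<close> to the free abelian group.
\<close>

definition frag_lin :: "('k \<Rightarrow> 'g::comm_ring_1) \<Rightarrow> ('k \<Rightarrow>\<^sub>0 int) \<Rightarrow> 'g" where
  "frag_lin f c = (\<Sum>k\<in>Poly_Mapping.keys c. of_int (Poly_Mapping.lookup c k) * f k)"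

lemma frag_lin_superset:
  assumes "finite T" "Poly_Mapping.keys c \<subseteq> T"
  shows "frag_lin f c = (\<Sum>k\<in>T. of_int (Poly_Mapping.lookup c k) * f k)"
  unfolding frag_lin_def using assms by (intro sum.mono_neutral_left) (auto simp: in_keys_iff)

lemma frag_lin_add: "frag_lin f (c + d) = frag_lin f c + frag_lin f d"
proof -
  define T where "T = Poly_Mapping.keys c \<union> Poly_Mapping.keys d"
  have T: "finite T" "Poly_Mapping.keys c \<subseteq> T" "Poly_Mapping.keys d \<subseteq> T" by (auto simp: T_def)
  have "Poly_Mapping.keys (c + d) \<subseteq> T" unfolding T_def by (rule Poly_Mapping.keys_add)
  then show ?thesis
    using T by (simp add: frag_lin_superset[of T] lookup_add distrib_right sum.distrib)
qed

lemma frag_lin_0 [simp]: "frag_lin f 0 = 0" by (simp add: frag_lin_def)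

lemma frag_lin_of [simp]: "frag_lin f (frag_of k) = f k"
  by (simp add: frag_lin_def keys_frag_of)

lemma frag_lin_minus: "frag_lin f (- c) = - frag_lin f c"
  using frag_lin_add[of f c "-c"] by (simp add: eq_neg_iff_add_eq_0 add.commute)

lemma frag_lin_diff: "frag_lin f (c - d) = frag_lin f c - frag_lin f d"
  using frag_lin_add[of f c "-d"] by (simp add: frag_lin_minus)

lemma tensor_relations_carrier:
  fixes N :: "('a, 'b, 'n) module_scheme" and M :: "('a, 'd, 'o) module_scheme"
  assumes "abelian_group N" "abelian_group M"
    and "\<And>r x. r \<in> carrier R \<Longrightarrow> x \<in> carrier N \<Longrightarrow> r \<odot>\<^bsub>N\<^esub> x \<in> carrier N"
    and "\<And>r x. r \<in> carrier R \<Longrightarrow> x \<in> carrier M \<Longrightarrow> r \<odot>\<^bsub>M\<^esub> x \<in> carrier M"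
  shows "tensor_relations R N M \<subseteq> carrier (free_Abelian_group (carrier N \<times> carrier M))"
proof -
  interpret N: abelian_group N by fact
  interpret M: abelian_group M by fact
  have d: "a - b \<in> carrier (free_Abelian_group S)"
    if "a \<in> carrier (free_Abelian_group S)" "b \<in> carrier (free_Abelian_group S)" for a b and S :: "('b \<times> 'd) set"
    using that keys_diff[of a b] by auto
  have f: "frag_of k \<in> carrier (free_Abelian_group S)" if "k \<in> S" for k and S :: "('b \<times> 'd) set"
    using that by simp
  show ?thesis
    unfolding tensor_relations_def
    by (intro Un_least subsetI; elim CollectE exE conjE; hypsubst; intro d f; simp add: assms)
qed

lemma tensor_relations_add:
  "x \<in> carrier N \<Longrightarrow> y \<in> carrier M \<Longrightarrow> y' \<in> carrier M \<Longrightarrow>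
    frag_of (x, y \<oplus>\<^bsub>M\<^esub> y') - frag_of (x, y) - frag_of (x, y') \<in> tensor_relations R N M"
  unfolding tensor_relations_def by blast

lemma tensor_relations_balance:
  "r \<in> carrier R \<Longrightarrow> x \<in> carrier N \<Longrightarrow> y \<in> carrier M \<Longrightarrow>
    frag_of (r \<odot>\<^bsub>N\<^esub> x, y) - frag_of (x, r \<odot>\<^bsub>M\<^esub> y) \<in> tensor_relations R N M"
  unfolding tensor_relations_def by blast

text \<open>
  Relates a formal sum \<open>\<Sum> (r\<^sub>i, a\<^sub>i)\<close> with \<open>r\<^sub>i \<in> I\<close> to its value \<open>\<Sum> r\<^sub>i a\<^sub>i\<close> in \<open>A\<close>.
\<close>

inductive tensor_value :: "('r, 'a, 'n) module_scheme \<Rightarrow> 'r set \<Rightarrow> ('r \<times> 'a \<Rightarrow>\<^sub>0 int) \<Rightarrow> 'a \<Rightarrow> bool"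
  for A :: "('r, 'a, 'n) module_scheme" and I :: "'r set" where
  zero: "tensor_value A I 0 \<zero>\<^bsub>A\<^esub>"
| step: "tensor_value A I c x \<Longrightarrow> r \<in> I \<Longrightarrow> a \<in> carrier A \<Longrightarrow>
    tensor_value A I (c + frag_of (r, a)) (x \<oplus>\<^bsub>A\<^esub> r \<odot>\<^bsub>A\<^esub> a)"

text \<open>
  The map \<open>\<mu>\<close> is biadditive and balanced, so it factors through \<open>I \<otimes>\<^sub>R A\<close>.
\<close>

locale flat_ideal = Module.module R A for R :: "('r, 'm) ring_scheme" (structure) and A :: "('r, 'a, 'n) module_scheme" (structure) +
  fixes I :: "'r set" and \<mu> :: "'r \<Rightarrow> 'a \<Rightarrow> 'g::comm_ring_1"
  assumes flat: "flat R A" and ideal: "ideal I R"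
    and lam_add1: "r \<in> I \<Longrightarrow> s \<in> I \<Longrightarrow> a \<in> carrier A \<Longrightarrow> \<mu> (r \<oplus>\<^bsub>R\<^esub> s) a = \<mu> r a + \<mu> s a"
    and lam_add2: "r \<in> I \<Longrightarrow> a \<in> carrier A \<Longrightarrow> b \<in> carrier A \<Longrightarrow> \<mu> r (a \<oplus>\<^bsub>A\<^esub> b) = \<mu> r a + \<mu> r b"
    and lam_balanced: "s \<in> carrier R \<Longrightarrow> r \<in> I \<Longrightarrow> a \<in> carrier A \<Longrightarrow> \<mu> (s \<otimes>\<^bsub>R\<^esub> r) a = \<mu> r (s \<odot>\<^bsub>A\<^esub> a)"
begin

definition sub_module :: "'r set \<Rightarrow> ('r, 'r) module" where
  "sub_module J = \<lparr>carrier = J, monoid.mult = monoid.mult R, one = one R, ring.zero = ring.zero R, add = add R,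
     smult = monoid.mult R\<rparr>"

lemma sub_module_simps [simp]:
  "carrier (sub_module J) = J" "add (sub_module J) = add R" "ring.zero (sub_module J) = ring.zero R"
  "smult (sub_module J) = monoid.mult R"
  by (simp_all add: sub_module_def)

lemma sub_module:
  assumes "ideal J R" shows "Module.module R (sub_module J)"
proof -
  interpret J: ideal J R by fact
  have neg: "\<exists>y\<in>J. y \<oplus>\<^bsub>R\<^esub> x = \<zero>\<^bsub>R\<^esub>" if "x \<in> J" for x
    using that J.Icarr J.a_inv_closed R.l_neg by metis
  have "abelian_group (sub_module J)"
  proof (rule abelian_groupI)
    fix x y assume "x \<in> carrier (sub_module J)" "y \<in> carrier (sub_module J)"
    then show "x \<oplus>\<^bsub>sub_module J\<^esub> y = y \<oplus>\<^bsub>sub_module J\<^esub> x" by (simp add: R.a_comm J.Icarr)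
  qed (simp_all add: J.Icarr R.a_assoc neg)
  then show ?thesis
    by (intro moduleI R.is_cring) (auto simp: J.I_l_closed J.Icarr R.l_distr R.r_distr R.m_assoc)
qed

abbreviation "K J \<equiv> tensor_kernel R (sub_module J) A"
abbreviation "FG J \<equiv> free_Abelian_group (J \<times> carrier A)"

lemma K_subgroup: assumes "ideal J R" shows "subgroup (K J) (FG J)"
proof -
  have "tensor_relations R (sub_module J) A \<subseteq> carrier (FG J)"
    using tensor_relations_carrier[of "sub_module J" A R] sub_module[OF assms]
    by (simp add: module_def abelian_group_axioms module_axioms_def M.abelian_group_axioms)
  then show ?thesis
    unfolding tensor_kernel_def sub_module_simps
    by (intro group.generate_is_subgroup group_free_Abelian_group)
qed

lemma K_closed:
  assumes "ideal J R"
  shows "0 \<in> K J" "c \<in> K J \<Longrightarrow> d \<in> K J \<Longrightarrow> c + d \<in> K J" "c \<in> K J \<Longrightarrow> - c \<in> K J" 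
    "c \<in> K J \<Longrightarrow> c \<in> carrier (FG J)"
    "c \<in> tensor_relations R (sub_module J) A \<Longrightarrow> c \<in> K J"
proof -
  interpret subgroup "K J" "FG J" by (rule K_subgroup[OF assms])
  show "0 \<in> K J" using one_closed by simp
  show "c + d \<in> K J" if "c \<in> K J" "d \<in> K J" using m_closed that by simp
  show "- c \<in> K J" if "c \<in> K J" using m_inv_closed[OF that] mem_carrier[OF that] by simp
  show "c \<in> carrier (FG J)" if "c \<in> K J" using mem_carrier[OF that] .
  show "c \<in> tensor_relations R (sub_module J) A \<Longrightarrow> c \<in> K J"
    unfolding tensor_kernel_def by (rule generate.incl)
qed

lemma frag_lin_K: "c \<in> K I \<Longrightarrow> frag_lin (\<lambda>(r, a). \<mu> r a) c = 0"
proof -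
  interpret I: ideal I R by (rule ideal)
  have rel: "frag_lin (\<lambda>(r, a). \<mu> r a) c = 0" if "c \<in> tensor_relations R (sub_module I) A" for c
    using that unfolding tensor_relations_def
    by (auto simp: frag_lin_diff lam_add1 lam_add2 lam_balanced)
  have car: "tensor_relations R (sub_module I) A \<subseteq> carrier (FG I)"
    using K_closed(4,5)[OF ideal] by blast
  assume "c \<in> K I"
  then have "c \<in> generate (FG I) (tensor_relations R (sub_module I) A)"
    by (simp add: tensor_kernel_def)
  then show ?thesis
  proof induction
    case (inv h)
    then have "h \<in> carrier (FG I)" using car by blast
    then have "Poly_Mapping.keys h \<subseteq> I \<times> carrier A" by simp
    then show ?case using rel[OF inv] by (simp add: frag_lin_minus)
  qed (auto simp: rel frag_lin_add)
qed

lemma whole_ideal: "ideal (carrier R) R" by (rule R.oneideal)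

lemma tensor_value_carrier: "tensor_value A I c x \<Longrightarrow> x \<in> carrier A \<and> c \<in> carrier (FG I)"
proof (induction rule: tensor_value.induct)
  interpret I: ideal I R by (rule ideal)
  case (step c x r a)
  then show ?case using keys_add[of c "frag_of (r, a)"] I.Icarr by (auto simp: keys_frag_of)
qed auto

text \<open>
  In \<open>R \<otimes>\<^sub>R A\<close> scalars can be moved to the right, so that \<open>\<Sum> r\<^sub>i \<otimes> a\<^sub>i = 1 \<otimes> \<Sum> r\<^sub>i a\<^sub>i\<close>.
\<close>

lemma tensor_value_whole: "tensor_value A I c x \<Longrightarrow> c - frag_of (\<one>\<^bsub>R\<^esub>, x) \<in> K (carrier R)"
proof (induction rule: tensor_value.induct)
  case zero
  have "frag_of (\<one>\<^bsub>R\<^esub>, \<zero>\<^bsub>A\<^esub> \<oplus>\<^bsub>A\<^esub> \<zero>\<^bsub>A\<^esub>) - frag_of (\<one>\<^bsub>R\<^esub>, \<zero>\<^bsub>A\<^esub>) - frag_of (\<one>\<^bsub>R\<^esub>, \<zero>\<^bsub>A\<^esub>)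
      \<in> tensor_relations R (sub_module (carrier R)) A"
    by (rule tensor_relations_add) simp_all
  from K_closed(5)[OF whole_ideal this] show ?case by simp
next
  case (step c x r a)
  interpret I: ideal I R by (rule ideal)
  have x: "x \<in> carrier A" and r: "r \<in> carrier R" using step tensor_value_carrier I.Icarr by auto
  have 1: "frag_of (r \<otimes>\<^bsub>R\<^esub> \<one>\<^bsub>R\<^esub>, a) - frag_of (\<one>\<^bsub>R\<^esub>, r \<odot>\<^bsub>A\<^esub> a) \<in> tensor_relations R (sub_module (carrier R)) A"
    using tensor_relations_balance[of r R "\<one>\<^bsub>R\<^esub>" "sub_module (carrier R)" a A] r step.hyps by simp
  have 2: "frag_of (\<one>\<^bsub>R\<^esub>, x \<oplus>\<^bsub>A\<^esub> r \<odot>\<^bsub>A\<^esub> a) - frag_of (\<one>\<^bsub>R\<^esub>, x) - frag_of (\<one>\<^bsub>R\<^esub>, r \<odot>\<^bsub>A\<^esub> a)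
      \<in> tensor_relations R (sub_module (carrier R)) A"
    using r x step.hyps by (intro tensor_relations_add) simp_all
  note k = K_closed[OF whole_ideal]
  let ?e = "(c - frag_of (\<one>\<^bsub>R\<^esub>, x)) + (frag_of (r \<otimes>\<^bsub>R\<^esub> \<one>\<^bsub>R\<^esub>, a) - frag_of (\<one>\<^bsub>R\<^esub>, r \<odot>\<^bsub>A\<^esub> a))
    + - (frag_of (\<one>\<^bsub>R\<^esub>, x \<oplus>\<^bsub>A\<^esub> r \<odot>\<^bsub>A\<^esub> a) - frag_of (\<one>\<^bsub>R\<^esub>, x) - frag_of (\<one>\<^bsub>R\<^esub>, r \<odot>\<^bsub>A\<^esub> a))"
  have "?e \<in> K (carrier R)"
    by (intro k(2) k(3) step.IH k(5)[OF 1] k(5)[OF 2])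
  moreover have "?e = c + frag_of (r, a) - frag_of (\<one>\<^bsub>R\<^esub>, x \<oplus>\<^bsub>A\<^esub> r \<odot>\<^bsub>A\<^esub> a)"
    using r by (simp add: algebra_simps)
  ultimately show ?case by simp
qed

text \<open>
  The map \<open>I \<otimes>\<^sub>R A \<rightarrow> R \<otimes>\<^sub>R A\<close> is injective by flatness, and it sends the class of \<open>c\<close> to zero.
\<close>

lemma tensor_value_zero_K: assumes "tensor_value A I c \<zero>\<^bsub>A\<^esub>" shows "c \<in> K I"
proof -
  interpret I: ideal I R by (rule ideal)
  have IR: "I \<subseteq> carrier R" using I.Icarr by auto
  note k = K_closed[OF whole_ideal] and kI = K_closed[OF ideal]
  have "c - frag_of (\<one>\<^bsub>R\<^esub>, \<zero>\<^bsub>A\<^esub>) + - (0 - frag_of (\<one>\<^bsub>R\<^esub>, \<zero>\<^bsub>A\<^esub>)) \<in> K (carrier R)"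
    by (intro k(2) k(3) tensor_value_whole assms tensor_value.zero)
  then have cK: "c \<in> K (carrier R)" by simp
  have cI: "c \<in> carrier (FG I)" using tensor_value_carrier[OF assms] by simp
  have KK: "K I \<subseteq> K (carrier R)"
  proof -
    have "tensor_relations R (sub_module I) A \<subseteq> tensor_relations R (sub_module (carrier R)) A"
      unfolding tensor_relations_def using IR by (intro Un_mono) (auto; blast)+
    then have rel: "\<And>h. h \<in> tensor_relations R (sub_module I) A \<Longrightarrow> h \<in> K (carrier R)" using k(5) by blast
    show ?thesis
    proof
      fix h assume "h \<in> K I"
      then have "h \<in> generate (FG I) (tensor_relations R (sub_module I) A)" by (simp add: tensor_kernel_def)
      then show "h \<in> K (carrier R)"
      proof induction
        case (inv h)
        then have "h \<in> carrier (FG I)" using kI(4,5) by blast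
        then have "Poly_Mapping.keys h \<subseteq> I \<times> carrier A" by simp
        then show ?case using rel[OF inv] k(3) by simp
      qed (auto simp: rel intro: k)
    qed
  qed
  have ext: "frag_extend (\<lambda>(x, y). frag_of (x, y)) = (\<lambda>c::('r \<times> 'a \<Rightarrow>\<^sub>0 int). c)"
    by (simp add: fun_eq_iff split_def frag_expansion[symmetric])
  define T where "T = tensor_map R (sub_module (carrier R)) A (\<lambda>x. x)"
  have T: "T X = {k + x | k x. k \<in> K (carrier R) \<and> x \<in> X}" for X
    unfolding T_def tensor_map_def ext by (auto simp: set_mult_def)
  have TK: "T (K I #>\<^bsub>FG I\<^esub> d) = K (carrier R)" if d: "d \<in> K (carrier R)" for d
  proof
    show "T (K I #>\<^bsub>FG I\<^esub> d) \<subseteq> K (carrier R)"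
      unfolding T r_coset_def using KK d k(2) by (auto intro!: k(2))
    show "K (carrier R) \<subseteq> T (K I #>\<^bsub>FG I\<^esub> d)"
    proof
      fix h assume "h \<in> K (carrier R)"
      then have "h + - d \<in> K (carrier R)" using d k(2,3) by blast
      moreover have "0 + d \<in> K I #>\<^bsub>FG I\<^esub> d" unfolding r_coset_def using kI(1) by auto
      ultimately have "(h + - d) + (0 + d) \<in> T (K I #>\<^bsub>FG I\<^esub> d)" unfolding T by blast
      then show "h \<in> T (K I #>\<^bsub>FG I\<^esub> d)" by simp
    qed
  qed
  have "inj_on T (carrier (tensor R (sub_module I) A))"
  proof -
    have "linear_map R (sub_module I) (sub_module (carrier R)) (\<lambda>x. x)"
      using IR by (auto simp: linear_map_def)
    then show ?thesis
      using flat[unfolded flat_def, rule_format, of "sub_module I" "sub_module (carrier R)" "\<lambda>x. x"]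
        sub_module[OF ideal] sub_module[OF whole_ideal] by (simp add: T_def)
  qed
  moreover have "K I #>\<^bsub>FG I\<^esub> d \<in> carrier (tensor R (sub_module I) A)" if "d \<in> carrier (FG I)" for d
    unfolding tensor_def FactGroup_def RCOSETS_def using that by auto
  moreover have "T (K I #>\<^bsub>FG I\<^esub> c) = T (K I #>\<^bsub>FG I\<^esub> 0)" using TK[OF cK] TK[OF k(1)] by simp
  ultimately have "K I #>\<^bsub>FG I\<^esub> c = K I #>\<^bsub>FG I\<^esub> 0"
    using cI kI(1,4) by (meson inj_onD)
  moreover have "0 + c \<in> K I #>\<^bsub>FG I\<^esub> c" unfolding r_coset_def using kI(1) by auto
  ultimately show ?thesis unfolding r_coset_def by auto
qed

lemma tensor_value_add:
  assumes "tensor_value A I d y" "tensor_value A I c x"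
  shows "tensor_value A I (c + d) (x \<oplus>\<^bsub>A\<^esub> y)"
  using assms
proof (induction rule: tensor_value.induct)
  case zero then show ?case using tensor_value_carrier by simp
next
  case (step d y r a)
  interpret I: ideal I R by (rule ideal)
  have "tensor_value A I (c + d + frag_of (r, a)) ((x \<oplus>\<^bsub>A\<^esub> y) \<oplus>\<^bsub>A\<^esub> r \<odot>\<^bsub>A\<^esub> a)"
    using step by (intro tensor_value.step)
  moreover have "(x \<oplus>\<^bsub>A\<^esub> y) \<oplus>\<^bsub>A\<^esub> r \<odot>\<^bsub>A\<^esub> a = x \<oplus>\<^bsub>A\<^esub> (y \<oplus>\<^bsub>A\<^esub> r \<odot>\<^bsub>A\<^esub> a)"
    using step tensor_value_carrier I.Icarr by (intro M.a_assoc) auto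
  ultimately show ?case by (simp add: add.assoc)
qed

lemma tensor_value_minus:
  assumes "tensor_value A I c x"
  shows "\<exists>d. tensor_value A I d (\<ominus>\<^bsub>A\<^esub> x) \<and> frag_lin (\<lambda>(r, a). \<mu> r a) d = - frag_lin (\<lambda>(r, a). \<mu> r a) c"
  using assms
proof (induction rule: tensor_value.induct)
  case zero
  have "\<ominus>\<^bsub>A\<^esub> \<zero>\<^bsub>A\<^esub> = \<zero>\<^bsub>A\<^esub>" by (rule M.minus_equality) simp_all
  then have "tensor_value A I 0 (\<ominus>\<^bsub>A\<^esub> \<zero>\<^bsub>A\<^esub>)" by (simp only: tensor_value.zero)
  then show ?case by (intro exI[of _ 0] conjI) simp_all
next
  case (step c x r a)
  interpret I: ideal I R by (rule ideal)
  obtain d where d: "tensor_value A I d (\<ominus>\<^bsub>A\<^esub> x)" "frag_lin (\<lambda>(r, a). \<mu> r a) d = - frag_lin (\<lambda>(r, a). \<mu> r a) c"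
    using step by blast
  have x: "x \<in> carrier A" "r \<in> carrier R" using step tensor_value_carrier I.Icarr by auto
  have "\<mu> r (a \<oplus>\<^bsub>A\<^esub> \<ominus>\<^bsub>A\<^esub> a) = \<mu> r a + \<mu> r (\<ominus>\<^bsub>A\<^esub> a)" "\<mu> r (\<zero>\<^bsub>A\<^esub> \<oplus>\<^bsub>A\<^esub> \<zero>\<^bsub>A\<^esub>) = \<mu> r \<zero>\<^bsub>A\<^esub> + \<mu> r \<zero>\<^bsub>A\<^esub>"
    using step by (intro lam_add2; simp)+
  then have neg: "\<mu> r (\<ominus>\<^bsub>A\<^esub> a) = - \<mu> r a" using step.hyps by (simp add: M.r_neg eq_neg_iff_add_eq_0 add.commute)
  have "tensor_value A I (d + frag_of (r, \<ominus>\<^bsub>A\<^esub> a)) (\<ominus>\<^bsub>A\<^esub> x \<oplus>\<^bsub>A\<^esub> r \<odot>\<^bsub>A\<^esub> (\<ominus>\<^bsub>A\<^esub> a))"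
    using step d by (intro tensor_value.step) auto
  moreover have "\<ominus>\<^bsub>A\<^esub> x \<oplus>\<^bsub>A\<^esub> r \<odot>\<^bsub>A\<^esub> (\<ominus>\<^bsub>A\<^esub> a) = \<ominus>\<^bsub>A\<^esub> (x \<oplus>\<^bsub>A\<^esub> r \<odot>\<^bsub>A\<^esub> a)"
    using x step by (simp add: M.minus_add smult_r_minus)
  ultimately show ?case
    using d(2) neg by (intro exI[of _ "d + frag_of (r, \<ominus>\<^bsub>A\<^esub> a)"]) (simp add: frag_lin_add)
qed

text \<open>
  A balanced map on \<open>I \<times> A\<close> therefore induces a well-defined map on the submodule \<open>I A\<close> of \<open>A\<close>.
\<close>

lemma functional:
  obtains \<sigma> where
    "\<And>c d x y. tensor_value A I c x \<Longrightarrow> tensor_value A I d y \<Longrightarrow> \<sigma> (x \<oplus>\<^bsub>A\<^esub> y) = \<sigma> x + \<sigma> y"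
    "\<And>r a. r \<in> I \<Longrightarrow> a \<in> carrier A \<Longrightarrow> \<sigma> (r \<odot>\<^bsub>A\<^esub> a) = \<mu> r a"
proof -
  interpret I: ideal I R by (rule ideal)
  let ?L = "frag_lin (\<lambda>(r, a). \<mu> r a)"
  have uniq: "?L c = ?L d" if c: "tensor_value A I c x" and d: "tensor_value A I d x" for c d x
  proof -
    obtain e where e: "tensor_value A I e (\<ominus>\<^bsub>A\<^esub> x)" "?L e = - ?L d" using tensor_value_minus[OF d] by blast
    have "tensor_value A I (c + e) (x \<oplus>\<^bsub>A\<^esub> \<ominus>\<^bsub>A\<^esub> x)" by (rule tensor_value_add[OF e(1) c])
    then have "tensor_value A I (c + e) \<zero>\<^bsub>A\<^esub>" using tensor_value_carrier[OF c] by (simp add: M.r_neg)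
    then have "?L (c + e) = 0" using tensor_value_zero_K frag_lin_K by blast
    then show ?thesis using e(2) by (simp add: frag_lin_add)
  qed
  define \<sigma> where "\<sigma> x = ?L (SOME c. tensor_value A I c x)" for x
  have \<sigma>: "\<sigma> x = ?L c" if "tensor_value A I c x" for c x
    unfolding \<sigma>_def using that by (intro uniq[of _ x]) (rule someI)
  show thesis
  proof (rule that[of \<sigma>])
    show "\<sigma> (x \<oplus>\<^bsub>A\<^esub> y) = \<sigma> x + \<sigma> y" if "tensor_value A I c x" "tensor_value A I d y" for c d x y
      using \<sigma>[OF tensor_value_add[OF that(2,1)]] \<sigma>[OF that(1)] \<sigma>[OF that(2)] by (simp add: frag_lin_add)
    show "\<sigma> (r \<odot>\<^bsub>A\<^esub> a) = \<mu> r a" if "r \<in> I" "a \<in> carrier A" for r a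
      using \<sigma>[OF tensor_value.step[OF tensor_value.zero that]] that I.Icarr by simp
  qed
qed

end

section \<open>Homogeneous components and the filtration by degrees of the base\<close>

definition component :: "('r, 'a) gr_alg \<Rightarrow> nat \<Rightarrow> 'a \<Rightarrow> 'a" where
  "component A d x = (THE f. (\<forall>i. f i \<in> grade A i) \<and> finite {i. f i \<noteq> \<zero>\<^bsub>A\<^esub>} \<and>
     x = finsum A f {i. f i \<noteq> \<zero>\<^bsub>A\<^esub>}) d"

context graded_algebra
begin

lemma grade_carrier: "x \<in> grade A i \<Longrightarrow> x \<in> carrier A"
  using additive_subgroup.a_subset[OF grade_subgroup] by blast
lemma grade_zero: "\<zero>\<^bsub>A\<^esub> \<in> grade A i"
  using additive_subgroup.zero_closed[OF grade_subgroup] .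
lemma grade_add: "x \<in> grade A i \<Longrightarrow> y \<in> grade A i \<Longrightarrow> x \<oplus>\<^bsub>A\<^esub> y \<in> grade A i"
  using additive_subgroup.a_closed[OF grade_subgroup] .
lemma grade_minus: "x \<in> grade A i \<Longrightarrow> \<ominus>\<^bsub>A\<^esub> x \<in> grade A i"
  using additive_subgroup.a_inv_closed[OF grade_subgroup] M.abelian_group_axioms by blast

lemma component_unique:
  assumes f: "\<And>i. f i \<in> grade A i" and T: "finite T" "\<And>i. i \<notin> T \<Longrightarrow> f i = \<zero>\<^bsub>A\<^esub>"
    and x: "x = finsum A f T"
  shows "component A i x = f i"
proof -
  define Pr where "Pr = (\<lambda>f. (\<forall>i. f i \<in> grade A i) \<and> finite {i. f i \<noteq> \<zero>\<^bsub>A\<^esub>} \<and>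
    x = finsum A f {i. f i \<noteq> \<zero>\<^bsub>A\<^esub>})"
  have sub: "{i. f i \<noteq> \<zero>\<^bsub>A\<^esub>} \<subseteq> T" using T(2) by blast
  have fc: "f i \<in> carrier A" for i using f grade_carrier by blast
  have "finsum A f {i. f i \<noteq> \<zero>\<^bsub>A\<^esub>} = finsum A f T"
    using sub T(1) fc by (intro add.finprod_mono_neutral_cong_left) auto
  then have P: "Pr f" unfolding Pr_def using f x finite_subset[OF sub T(1)] by simp
  have "finsum A f T \<in> carrier A" using fc by (intro finsum_closed) auto
  then have "x \<in> carrier A" unfolding x .
  then have "\<exists>!f. Pr f" unfolding Pr_def by (rule grade_decomp)
  then have "(THE f. Pr f) = f" using P by - (erule the1_equality)
  then have "component A i x = f i" unfolding component_def Pr_def by (rule fun_cong)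
  then show ?thesis .
qed

lemma component_props:
  assumes "x \<in> carrier A"
  shows "component A i x \<in> grade A i" "finite {i. component A i x \<noteq> \<zero>\<^bsub>A\<^esub>}"
    "x = finsum A (\<lambda>i. component A i x) {i. component A i x \<noteq> \<zero>\<^bsub>A\<^esub>}"
proof -
  obtain f where f: "\<And>i. f i \<in> grade A i" "finite {i. f i \<noteq> \<zero>\<^bsub>A\<^esub>}" "x = finsum A f {i. f i \<noteq> \<zero>\<^bsub>A\<^esub>}"
    using grade_decomp[OF assms] by blast
  have "component A i x = f i" for i
    by (rule component_unique[OF f(1,2) _ f(3)]) simp
  then have "(\<lambda>i. component A i x) = f" by auto
  then show "component A i x \<in> grade A i" "finite {i. component A i x \<noteq> \<zero>\<^bsub>A\<^esub>}"
    "x = finsum A (\<lambda>i. component A i x) {i. component A i x \<noteq> \<zero>\<^bsub>A\<^esub>}"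
    using f by (simp_all add: fun_eq_iff)
qed

lemma component_carrier: "x \<in> carrier A \<Longrightarrow> component A i x \<in> carrier A"
  using component_props(1) grade_carrier by blast

lemma component_finsum:
  assumes "x \<in> carrier A" "finite T" "{i. component A i x \<noteq> \<zero>\<^bsub>A\<^esub>} \<subseteq> T"
  shows "finsum A (\<lambda>i. component A i x) T = x"
proof -
  have "finsum A (\<lambda>i. component A i x) {i. component A i x \<noteq> \<zero>\<^bsub>A\<^esub>} = finsum A (\<lambda>i. component A i x) T"
    using assms component_carrier by (intro add.finprod_mono_neutral_cong_left) auto
  then show ?thesis using component_props(3)[OF assms(1)] by simp
qed

lemma component_add:
  assumes "x \<in> carrier A" "y \<in> carrier A"
  shows "component A i (x \<oplus>\<^bsub>A\<^esub> y) = component A i x \<oplus>\<^bsub>A\<^esub> component A i y"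
proof -
  define T where "T = {i. component A i x \<noteq> \<zero>\<^bsub>A\<^esub>} \<union> {i. component A i y \<noteq> \<zero>\<^bsub>A\<^esub>}"
  have T: "finite T" using component_props(2) assms by (simp add: T_def)
  have "x \<oplus>\<^bsub>A\<^esub> y = finsum A (\<lambda>i. component A i x) T \<oplus>\<^bsub>A\<^esub> finsum A (\<lambda>i. component A i y) T"
    using component_finsum[OF _ T] assms by (simp add: T_def)
  also have "\<dots> = finsum A (\<lambda>i. component A i x \<oplus>\<^bsub>A\<^esub> component A i y) T"
    using component_carrier assms by (intro finsum_addf[symmetric]) auto
  finally show ?thesis
    using assms T by (intro component_unique[OF _ T]) (auto simp: T_def intro!: grade_add component_props)
qed

lemma component_homog:
  assumes "x \<in> grade A d" shows "component A i x = (if i = d then x else \<zero>\<^bsub>A\<^esub>)"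
proof (rule component_unique[where T = "{d}"])
  show "x = finsum A (\<lambda>i. if i = d then x else \<zero>\<^bsub>A\<^esub>) {d}"
    using grade_carrier[OF assms] by simp
qed (use assms grade_zero in auto)

lemma component_zero: "component A i \<zero>\<^bsub>A\<^esub> = \<zero>\<^bsub>A\<^esub>"
  using component_homog[OF grade_zero] by simp

lemma component_smult:
  assumes r: "r \<in> grade R j" "r \<in> carrier R" and x: "x \<in> carrier A"
  shows "component A i (r \<odot>\<^bsub>A\<^esub> x) = (if j \<le> i then r \<odot>\<^bsub>A\<^esub> component A (i - j) x else \<zero>\<^bsub>A\<^esub>)"
proof -
  define S where "S = {i. component A i x \<noteq> \<zero>\<^bsub>A\<^esub>}"
  have S: "finite S" using component_props(2)[OF x] by (simp add: S_def)
  show ?thesis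
  proof (rule component_unique[where T = "(\<lambda>i. i + j) ` S"])
    show "(if j \<le> i then r \<odot>\<^bsub>A\<^esub> component A (i - j) x else \<zero>\<^bsub>A\<^esub>) \<in> grade A i" for i
      using grade_smult[OF r(1) component_props(1)[OF x, of "i - j"]] grade_zero by auto
    show "(if j \<le> i then r \<odot>\<^bsub>A\<^esub> component A (i - j) x else \<zero>\<^bsub>A\<^esub>) = \<zero>\<^bsub>A\<^esub>" if "i \<notin> (\<lambda>i. i + j) ` S" for i
    proof (cases "j \<le> i")
      case True
      then have "i - j \<notin> S" using that by (metis image_eqI le_add_diff_inverse2)
      then show ?thesis using r(2) by (simp add: S_def)
    qed simp
    have "r \<odot>\<^bsub>A\<^esub> x = r \<odot>\<^bsub>A\<^esub> finsum A (\<lambda>i. component A i x) S"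
      using component_props(3)[OF x] by (simp add: S_def)
    also have "\<dots> = finsum A (\<lambda>i. r \<odot>\<^bsub>A\<^esub> component A i x) S"
      using S r(2) component_carrier[OF x] by (intro finsum_smult_ldistr) auto
    also have "\<dots> = finsum A (\<lambda>i. if j \<le> i + j then r \<odot>\<^bsub>A\<^esub> component A (i + j - j) x else \<zero>\<^bsub>A\<^esub>) S" by simp
    also have "\<dots> = finsum A (\<lambda>i. if j \<le> i then r \<odot>\<^bsub>A\<^esub> component A (i - j) x else \<zero>\<^bsub>A\<^esub>) ((\<lambda>i. i + j) ` S)"
      using r(2) component_carrier[OF x] by (intro finsum_reindex[symmetric]) (auto simp: inj_on_def)
    finally show "r \<odot>\<^bsub>A\<^esub> x = finsum A (\<lambda>i. if j \<le> i then r \<odot>\<^bsub>A\<^esub> component A (i - j) x else \<zero>\<^bsub>A\<^esub>) ((\<lambda>i. i + j) ` S)" .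
  qed (use S in simp)
qed

lemma components_zero:
  assumes "x \<in> carrier A" "\<And>i. component A i x = \<zero>\<^bsub>A\<^esub>" shows "x = \<zero>\<^bsub>A\<^esub>"
  using component_finsum[of x "{}"] assms by simp

lemma homog_induct [consumes 1, case_names zero add]:
  assumes "x \<in> carrier A" and zero: "Pr \<zero>\<^bsub>A\<^esub>"
    and add: "\<And>d x y. x \<in> carrier A \<Longrightarrow> Pr x \<Longrightarrow> y \<in> grade A d \<Longrightarrow> Pr (x \<oplus>\<^bsub>A\<^esub> y)"
  shows "Pr x"
proof -
  have "finite T \<Longrightarrow> Pr (finsum A (\<lambda>i. component A i x) T)" for T
  proof (induction T rule: finite_induct)
    case empty then show ?case using zero by simp
  next
    case (insert i T)
    have c: "component A j x \<in> carrier A" for j using component_carrier assms(1) by blast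
    have cl: "finsum A (\<lambda>i. component A i x) T \<in> carrier A" using c by (intro finsum_closed) auto
    have "finsum A (\<lambda>i. component A i x) (insert i T) = finsum A (\<lambda>i. component A i x) T \<oplus>\<^bsub>A\<^esub> component A i x"
      using insert c cl by (subst finsum_insert) (auto intro: a_comm)
    then show ?case using add[OF cl insert.IH component_props(1)[OF assms(1)]] by simp
  qed
  from this[OF component_props(2)[OF assms(1)]] show ?thesis using component_props(3)[OF assms(1)] by simp
qed

end

text \<open>
  The submodule \<open>R\<^bsub>\<ge>k\<^esub> A\<close>.
\<close>

inductive_set fil :: "('k, 'r) gr_alg \<Rightarrow> ('r, 'a) gr_alg \<Rightarrow> nat \<Rightarrow> 'a set"
  for R :: "('k, 'r) gr_alg" and A :: "('r, 'a) gr_alg" and k :: nat where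
  zero: "\<zero>\<^bsub>A\<^esub> \<in> fil R A k"
| step: "x \<in> fil R A k \<Longrightarrow> k \<le> j \<Longrightarrow> r \<in> grade R j \<Longrightarrow> a \<in> carrier A \<Longrightarrow> x \<oplus>\<^bsub>A\<^esub> r \<odot>\<^bsub>A\<^esub> a \<in> fil R A k"

locale connected_base = base: graded_algebra complex_base R for R :: "(complex, 'r) gr_alg" +
  assumes base_0: "bij_betw (\<lambda>c. c \<odot>\<^bsub>R\<^esub> \<one>\<^bsub>R\<^esub>) UNIV (grade R 0)"
begin

abbreviation scalar :: "complex \<Rightarrow> 'r" where "scalar c \<equiv> c \<odot>\<^bsub>R\<^esub> \<one>\<^bsub>R\<^esub>"

lemma base_simps: "carrier complex_base = UNIV" "monoid.mult complex_base = (*)" "add complex_base = (+)"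
  "\<one>\<^bsub>complex_base\<^esub> = 1" "\<zero>\<^bsub>complex_base\<^esub> = 0"
  by (simp_all add: complex_base_def)

lemma scalar_grade: "scalar c \<in> grade R 0"
  using base_0 by (auto simp: bij_betw_def)

lemma scalar_carrier: "scalar c \<in> carrier R"
  using scalar_grade base.grade_carrier by blast

lemma scalar_mult: "r \<in> carrier R \<Longrightarrow> scalar c \<otimes>\<^bsub>R\<^esub> r = c \<odot>\<^bsub>R\<^esub> r"
  using base.smult_assoc2[of c "\<one>\<^bsub>R\<^esub>" r] by (simp add: base_simps)

lemma scalar_surj: "r \<in> grade R 0 \<Longrightarrow> \<exists>c. r = scalar c"
  using base_0 by (auto simp: bij_betw_def image_iff)

end

locale graded_over = connected_base R + alg: graded_algebra R A for R :: "(complex, 'r) gr_alg" and A :: "('r, 'a) gr_alg"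
begin

lemma grade_R_carrier: "r \<in> grade R j \<Longrightarrow> r \<in> carrier R"
  by (rule base.grade_carrier)

lemma fil_carrier: "x \<in> fil R A k \<Longrightarrow> x \<in> carrier A"
  by (induction rule: fil.induct) (auto dest: grade_R_carrier)

lemma fil_gen: "k \<le> j \<Longrightarrow> r \<in> grade R j \<Longrightarrow> a \<in> carrier A \<Longrightarrow> r \<odot>\<^bsub>A\<^esub> a \<in> fil R A k"
  using fil.step[OF fil.zero, of k j r R a A] grade_R_carrier by simp

lemma fil_add: 
  assumes "x \<in> fil R A k" "y \<in> fil R A k" shows "x \<oplus>\<^bsub>A\<^esub> y \<in> fil R A k"
  using assms(2,1)
proof (induction arbitrary: x rule: fil.induct)
  case zero then show ?case using fil_carrier by simp
next
  case (step y j r a)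
  have "x \<oplus>\<^bsub>A\<^esub> (y \<oplus>\<^bsub>A\<^esub> r \<odot>\<^bsub>A\<^esub> a) = (x \<oplus>\<^bsub>A\<^esub> y) \<oplus>\<^bsub>A\<^esub> r \<odot>\<^bsub>A\<^esub> a"
    using step fil_carrier grade_R_carrier by (intro alg.a_assoc[symmetric]) auto
  then show ?case using fil.step[OF step.IH[OF step.prems] step.hyps(2,3,4)] by simp
qed

text \<open>
  To check that an additive map respects the filtrations it is enough to look at the generators.
\<close>

lemma fil_image:
  assumes "x \<in> fil R A k" and zero: "f \<zero>\<^bsub>A\<^esub> \<in> fil R A l"
    and add: "\<And>x y. x \<in> carrier A \<Longrightarrow> y \<in> carrier A \<Longrightarrow> f (x \<oplus>\<^bsub>A\<^esub> y) = f x \<oplus>\<^bsub>A\<^esub> f y"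
    and gen: "\<And>j r a. k \<le> j \<Longrightarrow> r \<in> grade R j \<Longrightarrow> a \<in> carrier A \<Longrightarrow> f (r \<odot>\<^bsub>A\<^esub> a) \<in> fil R A l"
  shows "f x \<in> fil R A l"
  using assms(1)
proof (induction rule: fil.induct)
  case (step x j r a)
  then show ?case using add[of x "r \<odot>\<^bsub>A\<^esub> a"] gen fil_carrier grade_R_carrier fil_add by auto
qed (rule zero)

lemma fil_minus: "x \<in> fil R A k \<Longrightarrow> \<ominus>\<^bsub>A\<^esub> x \<in> fil R A k"
  by (erule fil_image)
    (auto simp: alg.minus_add fil.zero alg.smult_r_minus[symmetric] grade_R_carrier intro: fil_gen)

lemma fil_diff: "x \<in> fil R A k \<Longrightarrow> y \<in> fil R A k \<Longrightarrow> x \<ominus>\<^bsub>A\<^esub> y \<in> fil R A k"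
  unfolding a_minus_def by (intro fil_add fil_minus)

lemma fil_antimono: "x \<in> fil R A k \<Longrightarrow> l \<le> k \<Longrightarrow> x \<in> fil R A l"
  by (erule fil_image[where f="\<lambda>x. x"]) (auto intro: fil_gen[OF order_trans] fil.zero)

lemma fil_0: "x \<in> carrier A \<Longrightarrow> x \<in> fil R A 0"
  using fil_gen[of 0 0 "\<one>\<^bsub>R\<^esub>" x] base.grade_one by simp

lemma fil_smult_homog: "s \<in> grade R i \<Longrightarrow> x \<in> fil R A k \<Longrightarrow> s \<odot>\<^bsub>A\<^esub> x \<in> fil R A (i + k)"
proof (erule fil_image[where f="\<lambda>x. s \<odot>\<^bsub>A\<^esub> x"])
  assume s: "s \<in> grade R i"
  then have sc: "s \<in> carrier R" by (rule grade_R_carrier)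
  show "s \<odot>\<^bsub>A\<^esub> \<zero>\<^bsub>A\<^esub> \<in> fil R A (i + k)" using sc fil.zero by simp
  show "s \<odot>\<^bsub>A\<^esub> (x \<oplus>\<^bsub>A\<^esub> y) = s \<odot>\<^bsub>A\<^esub> x \<oplus>\<^bsub>A\<^esub> s \<odot>\<^bsub>A\<^esub> y" if "x \<in> carrier A" "y \<in> carrier A" for x y
    using sc that by (rule alg.smult_r_distr)
  fix j r a assume *: "k \<le> j" "r \<in> grade R j" "a \<in> carrier A"
  have "s \<otimes>\<^bsub>R\<^esub> r \<in> grade R (i + j)" using s *(2) by (rule base.grade_mult)
  then have "(s \<otimes>\<^bsub>R\<^esub> r) \<odot>\<^bsub>A\<^esub> a \<in> fil R A (i + k)" using * by (intro fil_gen) auto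
  then show "s \<odot>\<^bsub>A\<^esub> (r \<odot>\<^bsub>A\<^esub> a) \<in> fil R A (i + k)"
    using * sc grade_R_carrier by (simp add: alg.smult_assoc1)
qed

lemma fil_mult: "x \<in> fil R A k \<Longrightarrow> a \<in> carrier A \<Longrightarrow> x \<otimes>\<^bsub>A\<^esub> a \<in> fil R A k"
  by (erule fil_image[where f="\<lambda>x. x \<otimes>\<^bsub>A\<^esub> a"])
    (auto simp: alg.l_distr fil.zero alg.smult_assoc2 grade_R_carrier intro: fil_gen)

lemma fil_mult_fil: "x \<in> fil R A k \<Longrightarrow> y \<in> fil R A l \<Longrightarrow> x \<otimes>\<^bsub>A\<^esub> y \<in> fil R A (k + l)"
proof (erule fil_image[where f="\<lambda>x. x \<otimes>\<^bsub>A\<^esub> y"])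
  assume y: "y \<in> fil R A l"
  note yc = fil_carrier[OF y]
  show "\<zero>\<^bsub>A\<^esub> \<otimes>\<^bsub>A\<^esub> y \<in> fil R A (k + l)" using yc fil.zero by simp
  show "(x \<oplus>\<^bsub>A\<^esub> z) \<otimes>\<^bsub>A\<^esub> y = x \<otimes>\<^bsub>A\<^esub> y \<oplus>\<^bsub>A\<^esub> z \<otimes>\<^bsub>A\<^esub> y" if "x \<in> carrier A" "z \<in> carrier A" for x z
    using yc that by (simp add: alg.l_distr)
  fix j r a assume *: "k \<le> j" "r \<in> grade R j" "a \<in> carrier A"
  have "r \<odot>\<^bsub>A\<^esub> (y \<otimes>\<^bsub>A\<^esub> a) \<in> fil R A (j + l)" using y * by (intro fil_smult_homog fil_mult)
  moreover have "(r \<odot>\<^bsub>A\<^esub> a) \<otimes>\<^bsub>A\<^esub> y = r \<odot>\<^bsub>A\<^esub> (y \<otimes>\<^bsub>A\<^esub> a)"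
    using alg.smult_assoc2[OF grade_R_carrier[OF *(2)] *(3) yc] alg.m_comm[OF *(3) yc] by simp
  ultimately show "(r \<odot>\<^bsub>A\<^esub> a) \<otimes>\<^bsub>A\<^esub> y \<in> fil R A (k + l)"
    using *(1) fil_antimono by simp
qed

lemma fil_component: "x \<in> fil R A k \<Longrightarrow> component A d x \<in> fil R A k"
  by (erule fil_image[where f="component A d"])
    (auto simp: alg.component_zero fil.zero alg.component_add alg.component_smult grade_R_carrier
      intro: fil_gen alg.component_carrier)

text \<open>
  \<open>A\<close> lives in nonnegative degrees, so multiples of elements of \<open>R\<^sub>j\<close> live in degrees \<open>\<ge> j\<close>.
\<close>

lemma fil_degree: "x \<in> fil R A k \<Longrightarrow> d < k \<Longrightarrow> component A d x = \<zero>\<^bsub>A\<^esub>"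
proof (induction rule: fil.induct)
  case (step x j r a)
  then show ?case
    by (simp add: alg.component_add alg.component_smult fil_carrier grade_R_carrier)
qed (rule alg.component_zero)

lemma fil_grade_zero: "x \<in> fil R A k \<Longrightarrow> x \<in> grade A d \<Longrightarrow> d < k \<Longrightarrow> x = \<zero>\<^bsub>A\<^esub>"
  using fil_degree alg.component_homog by fastforce

lemma fil_Inter: "x \<in> carrier A \<Longrightarrow> (\<And>k. x \<in> fil R A k) \<Longrightarrow> x = \<zero>\<^bsub>A\<^esub>"
  by (rule alg.components_zero) (auto intro: fil_degree[OF _ lessI])

end

section \<open>Bases of the homogeneous parts of the base\<close>

lemma (in Module.module) finsum_smult_rdistr:
  assumes "finite T" "f \<in> T \<rightarrow> carrier R" "x \<in> carrier M"
  shows "finsum R f T \<odot>\<^bsub>M\<^esub> x = (\<Oplus>\<^bsub>M\<^esub>i\<in>T. f i \<odot>\<^bsub>M\<^esub> x)"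
  using assms
proof (induction T rule: finite_induct)
  case (insert i T)
  then have f: "f \<in> T \<rightarrow> carrier R" "f i \<in> carrier R" by auto
  have "finsum R f (insert i T) = f i \<oplus>\<^bsub>R\<^esub> finsum R f T"
    using insert f by (intro R.finsum_insert)
  moreover have "finsum R f T \<in> carrier R" using f by (intro R.finsum_closed)
  moreover have "(\<Oplus>\<^bsub>M\<^esub>i\<in>insert i T. f i \<odot>\<^bsub>M\<^esub> x) = f i \<odot>\<^bsub>M\<^esub> x \<oplus>\<^bsub>M\<^esub> (\<Oplus>\<^bsub>M\<^esub>i\<in>T. f i \<odot>\<^bsub>M\<^esub> x)"
    using insert f by (intro M.finsum_insert) auto
  ultimately show ?case using insert f by (simp add: smult_l_distr)
qed simp

context connected_base
begin

text \<open>
  \<open>v\<close> is a basis of the complex vector space \<open>E\<close>, and \<open>l\<close> is the dual basis of coordinate functionals.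
\<close>

definition is_frame :: "'r set \<Rightarrow> nat \<Rightarrow> (nat \<Rightarrow> 'r) \<Rightarrow> (nat \<Rightarrow> 'r \<Rightarrow> complex) \<Rightarrow> bool" where
  "is_frame E m v l \<longleftrightarrow> (\<forall>i<m. v i \<in> E) \<and>
     (\<forall>r\<in>E. r = (\<Oplus>\<^bsub>R\<^esub>i\<in>{..<m}. l i r \<odot>\<^bsub>R\<^esub> v i)) \<and>
     (\<forall>i<m. \<forall>r\<in>E. \<forall>s\<in>E. l i (r \<oplus>\<^bsub>R\<^esub> s) = l i r + l i s) \<and>
     (\<forall>i<m. \<forall>r\<in>E. \<forall>c. l i (c \<odot>\<^bsub>R\<^esub> r) = c * l i r) \<and>
     (\<forall>i<m. \<forall>j<m. l i (v j) = (if i = j then 1 else 0))"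

definition subspace :: "'r set \<Rightarrow> bool" where
  "subspace E \<longleftrightarrow> E \<subseteq> carrier R \<and> \<zero>\<^bsub>R\<^esub> \<in> E \<and> (\<forall>r\<in>E. \<forall>s\<in>E. r \<oplus>\<^bsub>R\<^esub> s \<in> E) \<and> (\<forall>r\<in>E. \<forall>c. c \<odot>\<^bsub>R\<^esub> r \<in> E)"

lemma smult_R_closed: "r \<in> carrier R \<Longrightarrow> c \<odot>\<^bsub>R\<^esub> r \<in> carrier R"
  using base.smult_closed[of c r] by (simp add: base_simps)
lemma smult_R_simps:
  "r \<in> carrier R \<Longrightarrow> (c + d) \<odot>\<^bsub>R\<^esub> r = c \<odot>\<^bsub>R\<^esub> r \<oplus>\<^bsub>R\<^esub> d \<odot>\<^bsub>R\<^esub> r"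
  "r \<in> carrier R \<Longrightarrow> s \<in> carrier R \<Longrightarrow> c \<odot>\<^bsub>R\<^esub> (r \<oplus>\<^bsub>R\<^esub> s) = c \<odot>\<^bsub>R\<^esub> r \<oplus>\<^bsub>R\<^esub> c \<odot>\<^bsub>R\<^esub> s"
  "r \<in> carrier R \<Longrightarrow> (c * d) \<odot>\<^bsub>R\<^esub> r = c \<odot>\<^bsub>R\<^esub> (d \<odot>\<^bsub>R\<^esub> r)"
  "r \<in> carrier R \<Longrightarrow> 1 \<odot>\<^bsub>R\<^esub> r = r" "r \<in> carrier R \<Longrightarrow> 0 \<odot>\<^bsub>R\<^esub> r = \<zero>\<^bsub>R\<^esub>"
  using base.smult_l_distr[of c d r] base.smult_r_distr[of c r s] base.smult_assoc1[of c d r] base.smult_one[of r]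
    base.smult_l_null[of r]
  by (simp_all add: base_simps)

text \<open>
  The new coordinate of \<open>c w + e\<close> is \<open>c\<close>; it is well defined because a nonzero multiple of \<open>w\<close> does not lie in \<open>E\<close>.
\<close>

lemma frame_extend:
  assumes E: "subspace E" and fr: "is_frame E m v l" and w: "w \<in> carrier R" "w \<notin> E"
    and E': "E' = {c \<odot>\<^bsub>R\<^esub> w \<oplus>\<^bsub>R\<^esub> e | c e. e \<in> E}"
  shows "subspace E' \<and> (\<exists>v' l'. is_frame E' (Suc m) v' l')"
proof -
  have Ec: "e \<in> carrier R" if "e \<in> E" for e using E that by (auto simp: subspace_def)
  note E_add = E[unfolded subspace_def, THEN conjunct2, THEN conjunct2, THEN conjunct1, rule_format]
  note E_sm = E[unfolded subspace_def, THEN conjunct2, THEN conjunct2, THEN conjunct2, rule_format]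
  note E0 = E[unfolded subspace_def, THEN conjunct2, THEN conjunct1]
  note cl = smult_R_closed[OF w(1)]
  have add': "(c \<odot>\<^bsub>R\<^esub> w \<oplus>\<^bsub>R\<^esub> e) \<oplus>\<^bsub>R\<^esub> (d \<odot>\<^bsub>R\<^esub> w \<oplus>\<^bsub>R\<^esub> f) = (c + d) \<odot>\<^bsub>R\<^esub> w \<oplus>\<^bsub>R\<^esub> (e \<oplus>\<^bsub>R\<^esub> f)"
    if "e \<in> E" "f \<in> E" for c d e f
    using that Ec cl w(1) by (simp add: smult_R_simps base.a_ac)
  have sm': "c \<odot>\<^bsub>R\<^esub> (d \<odot>\<^bsub>R\<^esub> w \<oplus>\<^bsub>R\<^esub> f) = (c * d) \<odot>\<^bsub>R\<^esub> w \<oplus>\<^bsub>R\<^esub> (c \<odot>\<^bsub>R\<^esub> f)" if "f \<in> E" for c d f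
    using that Ec cl w(1) by (simp add: smult_R_simps)
  have sub: "subspace E'"
    unfolding subspace_def
  proof (intro conjI ballI allI)
    show "E' \<subseteq> carrier R" using cl Ec by (auto simp: E')
    have "\<zero>\<^bsub>R\<^esub> = 0 \<odot>\<^bsub>R\<^esub> w \<oplus>\<^bsub>R\<^esub> \<zero>\<^bsub>R\<^esub>" using w(1) by (simp add: smult_R_simps)
    then show "\<zero>\<^bsub>R\<^esub> \<in> E'" unfolding E' using E0 by blast
    fix r assume "r \<in> E'"
    then obtain c e where r: "r = c \<odot>\<^bsub>R\<^esub> w \<oplus>\<^bsub>R\<^esub> e" "e \<in> E" unfolding E' by blast
    show "d \<odot>\<^bsub>R\<^esub> r \<in> E'" for d unfolding r sm'[OF r(2)] E' using E_sm[OF r(2)] by blast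
    fix s assume "s \<in> E'"
    then obtain d f where s: "s = d \<odot>\<^bsub>R\<^esub> w \<oplus>\<^bsub>R\<^esub> f" "f \<in> E" unfolding E' by blast
    show "r \<oplus>\<^bsub>R\<^esub> s \<in> E'" unfolding r(1) s(1) add'[OF r(2) s(2)] E' using E_add[OF r(2) s(2)] by blast
  qed
  have uniq: "c = d \<and> e = f" if eq: "c \<odot>\<^bsub>R\<^esub> w \<oplus>\<^bsub>R\<^esub> e = d \<odot>\<^bsub>R\<^esub> w \<oplus>\<^bsub>R\<^esub> f" and ef: "e \<in> E" "f \<in> E" for c d e f
  proof -
    have cd: "c = d"
    proof (rule ccontr)
      assume ne: "c \<noteq> d"
      have "((c - d) \<odot>\<^bsub>R\<^esub> w \<oplus>\<^bsub>R\<^esub> e) \<oplus>\<^bsub>R\<^esub> d \<odot>\<^bsub>R\<^esub> w = ((c - d) \<odot>\<^bsub>R\<^esub> w \<oplus>\<^bsub>R\<^esub> d \<odot>\<^bsub>R\<^esub> w) \<oplus>\<^bsub>R\<^esub> e"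
        using cl Ec ef by (simp add: base.a_ac)
      also have "(c - d) \<odot>\<^bsub>R\<^esub> w \<oplus>\<^bsub>R\<^esub> d \<odot>\<^bsub>R\<^esub> w = c \<odot>\<^bsub>R\<^esub> w"
        using smult_R_simps(1)[OF w(1), of "c - d" d] by simp
      also have "c \<odot>\<^bsub>R\<^esub> w \<oplus>\<^bsub>R\<^esub> e = f \<oplus>\<^bsub>R\<^esub> d \<odot>\<^bsub>R\<^esub> w" using eq cl Ec ef by (simp add: base.a_comm)
      finally have f: "f = (c - d) \<odot>\<^bsub>R\<^esub> w \<oplus>\<^bsub>R\<^esub> e"
        using cl Ec ef by simp
      have "(-1) \<odot>\<^bsub>R\<^esub> e \<oplus>\<^bsub>R\<^esub> e = \<zero>\<^bsub>R\<^esub>"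
        using smult_R_simps(1)[of e "-1" 1] smult_R_simps(4,5)[of e] Ec ef by simp
      then have "f \<oplus>\<^bsub>R\<^esub> (-1) \<odot>\<^bsub>R\<^esub> e = (c - d) \<odot>\<^bsub>R\<^esub> w"
        unfolding f using cl Ec[OF ef(1)] smult_R_closed[OF Ec[OF ef(1)]]
        by (simp add: base.a_assoc base.a_comm[of e "(-1) \<odot>\<^bsub>R\<^esub> e"])
      then have "(c - d) \<odot>\<^bsub>R\<^esub> w \<in> E" using E_add[OF ef(2) E_sm[OF ef(1)]] by metis
      then have "inverse (c - d) \<odot>\<^bsub>R\<^esub> ((c - d) \<odot>\<^bsub>R\<^esub> w) \<in> E" by (rule E_sm)
      moreover have "inverse (c - d) \<odot>\<^bsub>R\<^esub> ((c - d) \<odot>\<^bsub>R\<^esub> w) = w"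
        using ne smult_R_simps(3,4)[OF w(1)] by (metis left_inverse right_minus_eq)
      ultimately show False using w(2) by simp
    qed
    then show ?thesis using eq cl Ec ef by simp
  qed
  define coef where "coef r = (THE c. \<exists>e\<in>E. r = c \<odot>\<^bsub>R\<^esub> w \<oplus>\<^bsub>R\<^esub> e)" for r
  define rest where "rest r = (THE e. e \<in> E \<and> r = coef r \<odot>\<^bsub>R\<^esub> w \<oplus>\<^bsub>R\<^esub> e)" for r
  have coef: "coef (c \<odot>\<^bsub>R\<^esub> w \<oplus>\<^bsub>R\<^esub> e) = c" if "e \<in> E" for c e
    unfolding coef_def by (rule the_equality) (use uniq that in blast)+
  have rest: "rest (c \<odot>\<^bsub>R\<^esub> w \<oplus>\<^bsub>R\<^esub> e) = e" if "e \<in> E" for c e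
    unfolding rest_def coef[OF that] by (rule the_equality) (use uniq that in blast)+
  define v' where "v' i = (if i = m then w else v i)" for i
  define l' where "l' i r = (if i = m then coef r else l i (rest r))" for i r
  note fr' = fr[unfolded is_frame_def]
  have "is_frame E' (Suc m) v' l'"
    unfolding is_frame_def
  proof (intro conjI ballI allI impI)
    have wE: "w = 1 \<odot>\<^bsub>R\<^esub> w \<oplus>\<^bsub>R\<^esub> \<zero>\<^bsub>R\<^esub>" using w(1) by (simp add: smult_R_simps)
    have vE: "v i = 0 \<odot>\<^bsub>R\<^esub> w \<oplus>\<^bsub>R\<^esub> v i" "v i \<in> E" if "i < m" for i
      using fr' w(1) that Ec by (simp_all add: smult_R_simps)
    have "w \<in> E'" unfolding E' using wE E0 by blast
    moreover have "v i \<in> E'" if "i < m" for i unfolding E' using vE[OF that] by blast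
    ultimately show "v' i \<in> E'" if "i < Suc m" for i using that by (auto simp: v'_def)
    have cr: "coef w = 1" "rest w = \<zero>\<^bsub>R\<^esub>" using coef[OF E0, of 1] rest[OF E0, of 1] wE by simp_all
    have cv: "coef (v i) = 0" "rest (v i) = v i" if "i < m" for i
      using coef[OF vE(2)[OF that], of 0] rest[OF vE(2)[OF that], of 0] vE(1)[OF that] by simp_all
    have l0: "l i \<zero>\<^bsub>R\<^esub> = 0" if "i < m" for i
    proof -
      have "l i (0 \<odot>\<^bsub>R\<^esub> \<zero>\<^bsub>R\<^esub>) = 0 * l i \<zero>\<^bsub>R\<^esub>" using fr' that E0 by blast
      then show ?thesis by (simp add: smult_R_simps)
    qed
    show "l' i (v' j) = (if i = j then 1 else 0)" if "i < Suc m" "j < Suc m" for i j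
      using that fr' by (auto simp: l'_def v'_def cr cv l0 less_Suc_eq)
    fix r assume "r \<in> E'"
    then obtain c e where r: "r = c \<odot>\<^bsub>R\<^esub> w \<oplus>\<^bsub>R\<^esub> e" "e \<in> E" unfolding E' by blast
    have "(\<Oplus>\<^bsub>R\<^esub>i\<in>{..<Suc m}. l' i r \<odot>\<^bsub>R\<^esub> v' i) = l' m r \<odot>\<^bsub>R\<^esub> v' m \<oplus>\<^bsub>R\<^esub> (\<Oplus>\<^bsub>R\<^esub>i\<in>{..<m}. l' i r \<odot>\<^bsub>R\<^esub> v' i)"
      unfolding lessThan_Suc using vE(2) Ec cl by (intro base.finsum_insert) (auto simp: v'_def intro!: smult_R_closed)
    also have "(\<Oplus>\<^bsub>R\<^esub>i\<in>{..<m}. l' i r \<odot>\<^bsub>R\<^esub> v' i) = (\<Oplus>\<^bsub>R\<^esub>i\<in>{..<m}. l i e \<odot>\<^bsub>R\<^esub> v i)"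
      using vE(2) Ec by (intro base.finsum_cong') (auto simp: v'_def l'_def r rest intro!: smult_R_closed)
    also have "\<dots> = e" using fr' r(2) by simp
    also have "l' m r \<odot>\<^bsub>R\<^esub> v' m = c \<odot>\<^bsub>R\<^esub> w" by (simp add: l'_def v'_def r coef)
    finally show "r = (\<Oplus>\<^bsub>R\<^esub>i\<in>{..<Suc m}. l' i r \<odot>\<^bsub>R\<^esub> v' i)" using r(1) by simp
    show "l' i (d \<odot>\<^bsub>R\<^esub> r) = d * l' i r" if "i < Suc m" for i d
      using that fr' r(2) E_sm[OF r(2)] unfolding r(1) sm'[OF r(2)] l'_def by (auto simp: coef rest less_Suc_eq)
    fix s assume "s \<in> E'"
    then obtain d f where s: "s = d \<odot>\<^bsub>R\<^esub> w \<oplus>\<^bsub>R\<^esub> f" "f \<in> E" unfolding E' by blast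
    show "l' i (r \<oplus>\<^bsub>R\<^esub> s) = l' i r + l' i s" if "i < Suc m" for i
      using that fr' r(2) s(2) E_add[OF r(2) s(2)] unfolding r(1) s(1) add'[OF r(2) s(2)] l'_def
      by (auto simp: coef rest less_Suc_eq)
  qed
  then show ?thesis using sub by blast
qed

lemma frame_exists:
  assumes "ring.dimension R n (grade R 0) E"
  shows "subspace E \<and> (\<exists>v l. is_frame E n v l)"
  using assms
proof (induction n "grade R 0" E rule: base.dimension.induct)
  case zero_dim
  have "is_frame {\<zero>\<^bsub>R\<^esub>} 0 v l" for v l by (simp add: is_frame_def)
  moreover have "c \<odot>\<^bsub>R\<^esub> \<zero>\<^bsub>R\<^esub> = \<zero>\<^bsub>R\<^esub>" for c
    using base.smult_r_null[of c] by (simp add: base_simps)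
  ultimately show ?case by (auto simp: subspace_def)
next
  case (Suc_dim w E n)
  have eq: "base.line_extension (grade R 0) w E = {c \<odot>\<^bsub>R\<^esub> w \<oplus>\<^bsub>R\<^esub> e | c e. e \<in> E}"
  proof (intro Set.set_eqI iffI)
    fix u assume "u \<in> base.line_extension (grade R 0) w E"
    then obtain k e where k: "k \<in> grade R 0" "e \<in> E" "u = k \<otimes>\<^bsub>R\<^esub> w \<oplus>\<^bsub>R\<^esub> e"
      unfolding base.line_extension_mem_iff by blast
    obtain c where "k = scalar c" using scalar_surj k(1) by blast
    then show "u \<in> {c \<odot>\<^bsub>R\<^esub> w \<oplus>\<^bsub>R\<^esub> e | c e. e \<in> E}" using k scalar_mult Suc_dim by auto
  next
    fix u assume "u \<in> {c \<odot>\<^bsub>R\<^esub> w \<oplus>\<^bsub>R\<^esub> e | c e. e \<in> E}"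
    then obtain c e where "e \<in> E" "u = scalar c \<otimes>\<^bsub>R\<^esub> w \<oplus>\<^bsub>R\<^esub> e"
      using scalar_mult Suc_dim by auto
    then show "u \<in> base.line_extension (grade R 0) w E"
      unfolding base.line_extension_mem_iff using scalar_grade by blast
  qed
  obtain v l where "subspace E" "is_frame E n v l" using Suc_dim by blast
  then show ?case using frame_extend[OF _ _ _ _ eq] Suc_dim by blast
qed

end

locale finite_base = connected_base R for R :: "(complex, 'r) gr_alg" +
  assumes finite_dim: "\<And>j. ring.finite_dimension R (grade R 0) (grade R j)"
begin

lemma all_frames: "\<exists>m v l. \<forall>j. is_frame (grade R j) (m j) (v j) (l j)"
proof -
  have "\<exists>m v l. is_frame (grade R j) m v l" for j
    using finite_dim[of j] frame_exists unfolding base.finite_dimension_def by blast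
  then show ?thesis by metis
qed

definition frames :: "(nat \<Rightarrow> nat) \<times> (nat \<Rightarrow> nat \<Rightarrow> 'r) \<times> (nat \<Rightarrow> nat \<Rightarrow> 'r \<Rightarrow> complex)" where
  "frames = (SOME (m, v, l). \<forall>j. is_frame (grade R j) (m j) (v j) (l j))"
definition "fdim = fst frames"
definition "fvec = fst (snd frames)"
definition "fcoord = snd (snd frames)"

lemma is_frame: "is_frame (grade R j) (fdim j) (fvec j) (fcoord j)"
proof -
  have "case frames of (m, v, l) \<Rightarrow> \<forall>j. is_frame (grade R j) (m j) (v j) (l j)"
    unfolding frames_def by (rule someI_ex) (use all_frames in auto)
  then show ?thesis by (simp add: fdim_def fvec_def fcoord_def split_beta)
qed

lemma fvec: "i < fdim j \<Longrightarrow> fvec j i \<in> grade R j"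
  and fexpand: "r \<in> grade R j \<Longrightarrow> r = (\<Oplus>\<^bsub>R\<^esub>i\<in>{..<fdim j}. fcoord j i r \<odot>\<^bsub>R\<^esub> fvec j i)"
  and fcoord_add: "i < fdim j \<Longrightarrow> r \<in> grade R j \<Longrightarrow> s \<in> grade R j \<Longrightarrow> fcoord j i (r \<oplus>\<^bsub>R\<^esub> s) = fcoord j i r + fcoord j i s"
  and fcoord_smult: "i < fdim j \<Longrightarrow> r \<in> grade R j \<Longrightarrow> fcoord j i (c \<odot>\<^bsub>R\<^esub> r) = c * fcoord j i r"
  and fcoord_fvec: "i < fdim j \<Longrightarrow> k < fdim j \<Longrightarrow> fcoord j i (fvec j k) = (if i = k then 1 else 0)"
  using is_frame[of j] unfolding is_frame_def by blast+

end

section \<open>The base as an algebra over itself\<close>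

text \<open>
  Regarding \<open>R\<close> as an \<open>R\<close>-algebra makes the ideals \<open>R\<^bsub>\<ge>n\<^esub>\<close> and their properties instances of the filtration of \<open>A\<close>.
\<close>

definition self_algebra :: "(complex, 'r) gr_alg \<Rightarrow> ('r, 'r) gr_alg" where
  "self_algebra R = \<lparr>carrier = carrier R, monoid.mult = monoid.mult R, one = one R, ring.zero = ring.zero R,
     add = add R, module.smult = monoid.mult R, grade = grade R\<rparr>"

lemma self_algebra_simps [simp]:
  "carrier (self_algebra R) = carrier R" "monoid.mult (self_algebra R) = monoid.mult R"
  "one (self_algebra R) = one R" "ring.zero (self_algebra R) = ring.zero R" "add (self_algebra R) = add R"
  "module.smult (self_algebra R) = monoid.mult R" "grade (self_algebra R) = grade R"
  by (simp_all add: self_algebra_def)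

lemma self_algebra_finsum: "finsum (self_algebra R) = finsum R"
  by (simp add: finsum_def finprod_def fun_eq_iff)

lemma self_algebra_component: "component (self_algebra R) = component R"
  by (simp add: component_def fun_eq_iff self_algebra_finsum)

context connected_base
begin

sublocale self: graded_over R "self_algebra R"
proof -
  have c: "cring (self_algebra R)"
  proof -
    have neg: "x \<in> carrier (self_algebra R) \<Longrightarrow>
        \<exists>y\<in>carrier (self_algebra R). y \<oplus>\<^bsub>self_algebra R\<^esub> x = \<zero>\<^bsub>self_algebra R\<^esub>" for x
      using base.l_neg by (auto intro!: bexI[of _ "\<ominus>\<^bsub>R\<^esub> x"])
    show ?thesis
      by (rule cringI[OF abelian_groupI comm_monoidI];
          (erule neg | simp add: base.a_ac base.m_ac base.l_distr base.r_distr))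
  qed
  have alg: "Module.algebra R (self_algebra R)"
    by (rule algebraI) (auto simp: base.M_cring c base.l_distr base.r_distr base.m_assoc)
  show "graded_over R (self_algebra R)"
  proof (intro graded_over.intro connected_base_axioms graded_algebra.intro graded_algebra_axioms.intro alg)
    show "additive_subgroup (grade (self_algebra R) i) (self_algebra R)" for i
    proof (rule additive_subgroupI, rule subgroup.intro)
      fix x assume "x \<in> grade (self_algebra R) i"
      moreover have "inv\<^bsub>add_monoid (self_algebra R)\<^esub> x = \<ominus>\<^bsub>R\<^esub> x"
        by (simp add: a_inv_def m_inv_def)
      ultimately show "inv\<^bsub>add_monoid (self_algebra R)\<^esub> x \<in> grade (self_algebra R) i"
        using base.grade_minus by simp
    qed (auto simp: base.grade_carrier base.grade_add base.grade_zero)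
    show "\<exists>!f. (\<forall>i. f i \<in> grade (self_algebra R) i) \<and> finite {i. f i \<noteq> \<zero>\<^bsub>self_algebra R\<^esub>} \<and>
        x = finsum (self_algebra R) f {i. f i \<noteq> \<zero>\<^bsub>self_algebra R\<^esub>}"
      if "x \<in> carrier (self_algebra R)" for x
      using base.grade_decomp[of x] that by (simp only: self_algebra_simps self_algebra_finsum)
  qed (auto simp: base.grade_one base.grade_mult)
qed

lemma self_component_smult_low:
  assumes "r \<in> fil R (self_algebra R) n" "j < n"
  shows "component R j r = \<zero>\<^bsub>R\<^esub>"
  using self.fil_degree[OF assms] by (simp add: self_algebra_component)

lemma self_filI:
  assumes r: "r \<in> carrier R" and low: "\<And>j. j < n \<Longrightarrow> component R j r = \<zero>\<^bsub>R\<^esub>"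
  shows "r \<in> fil R (self_algebra R) n"
proof -
  have c: "component R j r \<in> fil R (self_algebra R) n" for j
  proof (cases "j < n")
    case True then show ?thesis using low fil.zero[of "self_algebra R"] by simp
  next
    case False
    then have "component R j r \<otimes>\<^bsub>self_algebra R\<^esub> \<one>\<^bsub>R\<^esub> \<in> fil R (self_algebra R) n"
      using self.fil_gen[of n j "component R j r" "\<one>\<^bsub>R\<^esub>"] base.component_props(1)[OF r] by simp
    then show ?thesis using base.component_carrier[OF r] by simp
  qed
  have "finite T \<Longrightarrow> finsum (self_algebra R) (\<lambda>j. component R j r) T \<in> fil R (self_algebra R) n" for T
  proof (induction T rule: finite_induct)
    case empty then show ?case using fil.zero[of "self_algebra R"] self_algebra_finsum[of R] by simp
  next
    case (insert j T)
    then show ?case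
      using base.component_carrier[OF r] self.fil_add[OF c] by (subst self.alg.M.finsum_insert) auto
  qed
  then show ?thesis
    using base.component_props(2,3)[OF r] by (metis self_algebra_finsum)
qed

lemma fil_self_ideal: "ideal (fil R (self_algebra R) n) R"
proof (rule idealI)
  show "subgroup (fil R (self_algebra R) n) (add_monoid R)"
  proof (rule subgroup.intro)
    fix x assume x: "x \<in> fil R (self_algebra R) n"
    have "inv\<^bsub>add_monoid R\<^esub> x = \<ominus>\<^bsub>self_algebra R\<^esub> x"
      by (simp add: a_inv_def m_inv_def)
    then show "inv\<^bsub>add_monoid R\<^esub> x \<in> fil R (self_algebra R) n" using self.fil_minus[OF x] by simp
  next
    show "\<one>\<^bsub>add_monoid R\<^esub> \<in> fil R (self_algebra R) n" using fil.zero[of "self_algebra R"] by simp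
    show "x \<otimes>\<^bsub>add_monoid R\<^esub> y \<in> fil R (self_algebra R) n"
      if "x \<in> fil R (self_algebra R) n" "y \<in> fil R (self_algebra R) n" for x y
      using self.fil_add[OF that] by simp
  qed (use self.fil_carrier in auto)
  fix a x assume a: "a \<in> fil R (self_algebra R) n" and x: "x \<in> carrier R"
  show "a \<otimes>\<^bsub>R\<^esub> x \<in> fil R (self_algebra R) n" using self.fil_mult[OF a, of x] x by simp
  then show "x \<otimes>\<^bsub>R\<^esub> a \<in> fil R (self_algebra R) n"
    using self.fil_carrier[OF a] x by (simp add: base.m_comm)
qed (rule cring.axioms(1)[OF base.M_cring])

lemma component_R_smult:
  "r \<in> carrier R \<Longrightarrow> component R j (c \<odot>\<^bsub>R\<^esub> r) = c \<odot>\<^bsub>R\<^esub> component R j r"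
  using base.component_smult[of c 0 r j] by (simp add: complex_base_def)

lemma component_R_mult:
  "s \<in> grade R i \<Longrightarrow> r \<in> carrier R \<Longrightarrow>
    component R j (s \<otimes>\<^bsub>R\<^esub> r) = (if i \<le> j then s \<otimes>\<^bsub>R\<^esub> component R (j - i) r else \<zero>\<^bsub>R\<^esub>)"
  using self.alg.component_smult[of s i r j] base.grade_carrier by (simp add: self_algebra_component)

end

section \<open>Algebras with a given special fibre\<close>

text \<open>
  A deformation of \<open>P\<close> without the flatness condition: \<open>\<pi>\<close> plays the role of the composite \<open>A \<rightarrow> A / \<mm>A \<rightarrow> P\<close>.
  Working with a map on elements avoids the cosets of the special fibre.
\<close>

locale fibred = graded_over R A for R :: "(complex, 'r) gr_alg" and A :: "('r, 'a) gr_alg" +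
  fixes \<pi> :: "'a \<Rightarrow> complex poly poly" and P :: "complex poly poly set"
  assumes \<pi>_add: "x \<in> carrier A \<Longrightarrow> y \<in> carrier A \<Longrightarrow> \<pi> (x \<oplus>\<^bsub>A\<^esub> y) = \<pi> x + \<pi> y"
    and \<pi>_mult: "x \<in> carrier A \<Longrightarrow> y \<in> carrier A \<Longrightarrow> \<pi> (x \<otimes>\<^bsub>A\<^esub> y) = \<pi> x * \<pi> y"
    and \<pi>_scalar: "x \<in> carrier A \<Longrightarrow> \<pi> ((c \<odot>\<^bsub>R\<^esub> \<one>\<^bsub>R\<^esub>) \<odot>\<^bsub>A\<^esub> x) = const2 c * \<pi> x"
    and \<pi>_grade: "\<pi> ` grade A d = {p \<in> P. homog d p}"
    and \<pi>_carrier: "\<pi> ` carrier A = P"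
    and \<pi>_ker: "x \<in> carrier A \<Longrightarrow> \<pi> x = 0 \<Longrightarrow> x \<in> fil R A 1"
    and \<pi>_fil: "x \<in> fil R A 1 \<Longrightarrow> \<pi> x = 0"
begin

lemma \<pi>_zero: "\<pi> \<zero>\<^bsub>A\<^esub> = 0"
  using \<pi>_fil fil.zero by blast

lemma \<pi>_P: "x \<in> carrier A \<Longrightarrow> \<pi> x \<in> P"
  using \<pi>_carrier by blast

lemma \<pi>_surj: "p \<in> P \<Longrightarrow> \<exists>x\<in>carrier A. \<pi> x = p"
  using \<pi>_carrier by blast

lemma \<pi>_surj_grade: "p \<in> P \<Longrightarrow> homog d p \<Longrightarrow> \<exists>x\<in>grade A d. \<pi> x = p"
proof -
  assume "p \<in> P" "homog d p"
  then have "p \<in> \<pi> ` grade A d" unfolding \<pi>_grade by blast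
  then show ?thesis by blast
qed

lemma \<pi>_homog: "x \<in> grade A d \<Longrightarrow> homog d (\<pi> x)"
  using \<pi>_grade by blast

lemma \<pi>_minus: "x \<in> carrier A \<Longrightarrow> \<pi> (\<ominus>\<^bsub>A\<^esub> x) = - \<pi> x"
  using \<pi>_add[of x "\<ominus>\<^bsub>A\<^esub> x"] \<pi>_zero by (simp add: alg.M.r_neg eq_neg_iff_add_eq_0 add.commute)

lemma \<pi>_diff: "x \<in> carrier A \<Longrightarrow> y \<in> carrier A \<Longrightarrow> \<pi> (x \<ominus>\<^bsub>A\<^esub> y) = \<pi> x - \<pi> y"
  by (simp add: a_minus_def \<pi>_add \<pi>_minus)

lemma \<pi>_pos: "r \<in> grade R j \<Longrightarrow> 0 < j \<Longrightarrow> x \<in> carrier A \<Longrightarrow> \<pi> (r \<odot>\<^bsub>A\<^esub> x) = 0"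
  by (intro \<pi>_fil fil_gen[of 1 j]) auto

lemma \<pi>_finsum:
  assumes "finite T" "f \<in> T \<rightarrow> carrier A" shows "\<pi> (finsum A f T) = (\<Sum>i\<in>T. \<pi> (f i))"
  using assms
proof (induction T rule: finite_induct)
  case (insert i T)
  then show ?case by (subst alg.M.finsum_insert) (auto simp: \<pi>_add Pi_iff)
qed (simp add: \<pi>_zero)

lemma graded_set_P: "graded_set P"
  unfolding graded_set_def
proof
  fix p assume "p \<in> P"
  then obtain x where x: "x \<in> carrier A" "\<pi> x = p" using \<pi>_surj by blast
  obtain N where N: "{i. component A i x \<noteq> \<zero>\<^bsub>A\<^esub>} \<subseteq> {..<N}"
    using finite_nat_iff_bounded[THEN iffD1, OF alg.component_props(2)[OF x(1)]] by blast
  have "p = \<pi> (finsum A (\<lambda>i. component A i x) {..<N})"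
    using alg.component_finsum[OF x(1) _ N] x(2) by simp
  also have "\<dots> = (\<Sum>d<N. \<pi> (component A d x))"
    using alg.component_carrier[OF x(1)] by (intro \<pi>_finsum) auto
  finally show "\<exists>f N. (\<forall>d. f d \<in> P \<and> homog d (f d)) \<and> p = (\<Sum>d<N::nat. f d)"
    using \<pi>_homog[OF alg.component_props(1)[OF x(1)]] \<pi>_P[OF alg.component_carrier[OF x(1)]]
    by (intro exI[of _ "\<lambda>d. \<pi> (component A d x)"] exI[of _ N]) auto
qed

text \<open>
  Induction on the degree of a homogeneous element: modulo \<open>M\<close> it lies in \<open>R\<^bsub>>0\<^esub> A\<close>, so it is a combination of
  elements of lower degree.
\<close>

lemma nakayama:
  assumes zero: "\<zero>\<^bsub>A\<^esub> \<in> M" and add: "\<And>x y. x \<in> M \<Longrightarrow> y \<in> M \<Longrightarrow> x \<oplus>\<^bsub>A\<^esub> y \<in> M"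
    and smult: "\<And>r j x. r \<in> grade R j \<Longrightarrow> x \<in> M \<Longrightarrow> r \<odot>\<^bsub>A\<^esub> x \<in> M"
    and gen: "\<And>d x. x \<in> grade A d \<Longrightarrow> \<exists>m\<in>M. m \<in> grade A d \<and> \<pi> m = \<pi> x"
    and x: "x \<in> carrier A"
  shows "x \<in> M"
proof -
  have homog: "x \<in> grade A d \<Longrightarrow> x \<in> M" for d x
  proof (induction d arbitrary: x rule: less_induct)
    case (less d)
    have low: "component A d z \<in> M" if "z \<in> fil R A 1" for z
      using that
    proof (induction rule: fil.induct)
      case zero then show ?case using assms(1) by (simp add: alg.component_zero)
    next
      case (step z j r a)
      have "component A d (r \<odot>\<^bsub>A\<^esub> a) \<in> M"
        using step smult[OF step.hyps(3) less.IH[of "d - j" "component A (d - j) a"]] assms(1)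
        by (auto simp: alg.component_smult grade_R_carrier alg.component_props(1))
      then show ?case
        using step add by (simp add: alg.component_add fil_carrier grade_R_carrier)
    qed
    obtain m where m: "m \<in> M" "m \<in> grade A d" "\<pi> m = \<pi> x" using gen less.prems by blast
    have c: "x \<in> carrier A" "m \<in> carrier A" using m less.prems alg.grade_carrier by auto
    have g: "x \<ominus>\<^bsub>A\<^esub> m \<in> grade A d" using m less.prems by (simp add: a_minus_def alg.grade_add alg.grade_minus)
    have "x \<ominus>\<^bsub>A\<^esub> m \<in> fil R A 1" using c m by (intro \<pi>_ker) (auto simp: \<pi>_diff)
    from low[OF this] have "x \<ominus>\<^bsub>A\<^esub> m \<in> M" using alg.component_homog[OF g, of d] by simp
    then have "(x \<ominus>\<^bsub>A\<^esub> m) \<oplus>\<^bsub>A\<^esub> m \<in> M" using add m by blast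
    moreover have "(x \<ominus>\<^bsub>A\<^esub> m) \<oplus>\<^bsub>A\<^esub> m = x" using c by (simp add: a_minus_def alg.M.a_assoc alg.M.l_neg)
    ultimately show ?case by simp
  qed
  show ?thesis using x
    by (induction rule: alg.homog_induct) (auto intro: zero add homog)
qed

end

section \<open>Symbols\<close>

lemma const2_add: "const2 (c + d) = const2 c + const2 d" by simp

lemma smult_const_one: "Polynomial.smult [:1:] p = (p :: complex poly poly)"
  by (simp add: one_pCons[symmetric])

lemma shifted_0 [simp]: "shifted n d 0" by (simp add: shifted_def)
lemma shifted_add: "shifted n d p \<Longrightarrow> shifted n d q \<Longrightarrow> shifted n d (p + q)"
  unfolding shifted_def by (metis add.left_neutral coeff_add)
lemma shifted_const2: "shifted n d p \<Longrightarrow> shifted n d (const2 k * p)"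
  unfolding shifted_def coeff_const2 by auto
lemma homog_shifted: "homog d p \<Longrightarrow> shifted n (d + n) p"
  by (auto simp: shifted_def)
lemma shifted_homog: "shifted n d p \<Longrightarrow> n \<le> d \<Longrightarrow> homog (d - n) p"
  unfolding shifted_def by (metis add_diff_cancel_right' add_0_right)
lemma shifted_small: "shifted n d p \<Longrightarrow> d < n \<Longrightarrow> p = 0"
  by (auto simp: shifted_def poly_eq_iff)

abbreviation base_fil :: "(complex, 'r) gr_alg \<Rightarrow> nat \<Rightarrow> 'r set" where
  "base_fil R n \<equiv> fil R (self_algebra R) n"

context connected_base
begin

lemma base_fil_grade: "r \<in> grade R j \<Longrightarrow> n \<le> j \<Longrightarrow> r \<in> base_fil R n"
  using base.component_homog[of r j] by (intro self_filI) (auto simp: base.grade_carrier)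

lemma base_fil_carrier: "r \<in> base_fil R n \<Longrightarrow> r \<in> carrier R"
  using self.fil_carrier by simp

end

context fibred
begin

lemma P_add: "p \<in> P \<Longrightarrow> q \<in> P \<Longrightarrow> p + q \<in> P"
  using \<pi>_surj[of p] \<pi>_surj[of q] \<pi>_add \<pi>_P alg.M.a_closed by metis
lemma P_const: "p \<in> P \<Longrightarrow> const2 c * p \<in> P"
  using \<pi>_surj[of p] \<pi>_scalar \<pi>_P alg.smult_closed[OF scalar_carrier] by metis
lemma P_zero: "0 \<in> P"
  using \<pi>_P[of "\<zero>\<^bsub>A\<^esub>"] \<pi>_zero by simp

lemma base_fil_smult: "r \<in> base_fil R n \<Longrightarrow> a \<in> carrier A \<Longrightarrow> r \<odot>\<^bsub>A\<^esub> a \<in> fil R A n"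
proof (induction rule: fil.induct)
  case zero then show ?case using fil.zero[of A] by simp
next
  case (step x j r b)
  have "x \<in> carrier R" "r \<in> carrier R" "b \<in> carrier R" using step base_fil_carrier grade_R_carrier by auto
  then have "(x \<oplus>\<^bsub>R\<^esub> r \<otimes>\<^bsub>R\<^esub> b) \<odot>\<^bsub>A\<^esub> a = x \<odot>\<^bsub>A\<^esub> a \<oplus>\<^bsub>A\<^esub> r \<odot>\<^bsub>A\<^esub> (b \<odot>\<^bsub>A\<^esub> a)"
    using step.prems by (simp add: alg.smult_l_distr alg.smult_assoc1)
  moreover have "r \<odot>\<^bsub>A\<^esub> (b \<odot>\<^bsub>A\<^esub> a) \<in> fil R A n"
    using step \<open>b \<in> carrier R\<close> by (intro fil_gen) auto
  ultimately show ?case using fil_add[OF step.IH[OF step.prems]] by simp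
qed

text \<open>
  \<open>\<sigma>\<close> is the map \<open>R\<^bsub>\<ge>n\<^esub> A \<rightarrow> R\<^sub>n \<otimes> P \<rightarrow> P\<close> that is given by the functional \<open>l\<close> on \<open>R\<^sub>n\<close>.
\<close>

definition is_symbol :: "nat \<Rightarrow> ('r \<Rightarrow> complex) \<Rightarrow> ('a \<Rightarrow> complex poly poly) \<Rightarrow> bool" where
  "is_symbol n l \<sigma> \<longleftrightarrow> (\<forall>x\<in>fil R A n. \<forall>y\<in>fil R A n. \<sigma> (x \<oplus>\<^bsub>A\<^esub> y) = \<sigma> x + \<sigma> y) \<and>
     (\<forall>r\<in>base_fil R n. \<forall>a\<in>carrier A. \<sigma> (r \<odot>\<^bsub>A\<^esub> a) = const2 (l (component R n r)) * \<pi> a)"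

text \<open>
  The bilinear map \<open>(r, a) \<mapsto> l(r\<^sub>n) \<pi>(a)\<close> on \<open>R\<^bsub>\<ge>n\<^esub> \<times> A\<close> is balanced: scalars act in the same way on both sides, and
  elements of positive degree act by zero on both sides.
\<close>

lemma symbol_exists:
  assumes flat: "flat R A"
    and l_add: "\<And>r s. r \<in> grade R n \<Longrightarrow> s \<in> grade R n \<Longrightarrow> l (r \<oplus>\<^bsub>R\<^esub> s) = l r + l s"
    and l_smult: "\<And>r c. r \<in> grade R n \<Longrightarrow> l (c \<odot>\<^bsub>R\<^esub> r) = c * l r"
  shows "\<exists>\<sigma>. is_symbol n l \<sigma>"
proof -
  let ?\<mu> = "\<lambda>r a. const2 (l (component R n r)) * \<pi> a"
  have l0: "l \<zero>\<^bsub>R\<^esub> = 0"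
    using l_add[OF base.grade_zero base.grade_zero] by simp
  note comp = base.component_props(1)
  have bal: "?\<mu> (s \<otimes>\<^bsub>R\<^esub> r) a = ?\<mu> r (s \<odot>\<^bsub>A\<^esub> a)"
    if s: "s \<in> carrier R" and r: "r \<in> base_fil R n" and a: "a \<in> carrier A" for s r a
    using s
  proof (induction rule: base.homog_induct)
    case zero
    show ?case using base_fil_carrier[OF r] a by (simp add: base.component_zero l0 \<pi>_zero)
  next
    case (add d s t)
    have rc: "r \<in> carrier R" and tc: "t \<in> carrier R" using base_fil_carrier[OF r] grade_R_carrier add by auto
    have t: "?\<mu> (t \<otimes>\<^bsub>R\<^esub> r) a = ?\<mu> r (t \<odot>\<^bsub>A\<^esub> a)"
    proof (cases "d = 0")
      case True
      then obtain c where c: "t = scalar c" using scalar_surj add by blast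
      have "component R n (t \<otimes>\<^bsub>R\<^esub> r) = c \<odot>\<^bsub>R\<^esub> component R n r"
        using rc by (simp add: c scalar_mult component_R_smult)
      then show ?thesis using l_smult[OF comp[OF rc]] a by (simp add: c \<pi>_scalar mult.commute)
    next
      case False
      have "component R n (t \<otimes>\<^bsub>R\<^esub> r) = \<zero>\<^bsub>R\<^esub>"
        using component_R_mult[OF add.hyps(2) rc, of n] self_component_smult_low[OF r, of "n - d"] False tc by auto
      then show ?thesis using False \<pi>_pos[OF add.hyps(2) _ a] by (simp add: l0)
    qed
    have "(s \<oplus>\<^bsub>R\<^esub> t) \<otimes>\<^bsub>R\<^esub> r = s \<otimes>\<^bsub>R\<^esub> r \<oplus>\<^bsub>R\<^esub> t \<otimes>\<^bsub>R\<^esub> r" using add rc tc by (simp add: base.l_distr)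
    then have "l (component R n ((s \<oplus>\<^bsub>R\<^esub> t) \<otimes>\<^bsub>R\<^esub> r)) =
        l (component R n (s \<otimes>\<^bsub>R\<^esub> r)) + l (component R n (t \<otimes>\<^bsub>R\<^esub> r))"
      using add.hyps rc tc by (simp add: base.component_add l_add comp)
    then have "?\<mu> ((s \<oplus>\<^bsub>R\<^esub> t) \<otimes>\<^bsub>R\<^esub> r) a = ?\<mu> (s \<otimes>\<^bsub>R\<^esub> r) a + ?\<mu> (t \<otimes>\<^bsub>R\<^esub> r) a"
      by (simp only: const2_add distrib_right)
    also have "\<dots> = const2 (l (component R n r)) * (\<pi> (s \<odot>\<^bsub>A\<^esub> a) + \<pi> (t \<odot>\<^bsub>A\<^esub> a))"
      unfolding t add.IH by (simp only: distrib_left)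
    also have "\<pi> (s \<odot>\<^bsub>A\<^esub> a) + \<pi> (t \<odot>\<^bsub>A\<^esub> a) = \<pi> ((s \<oplus>\<^bsub>R\<^esub> t) \<odot>\<^bsub>A\<^esub> a)"
      using add tc a by (simp add: alg.smult_l_distr \<pi>_add)
    finally show ?case .
  qed
  interpret flat_ideal R A "base_fil R n" ?\<mu>
  proof (intro flat_ideal.intro flat_ideal_axioms.intro alg.module flat fil_self_ideal bal)
    show "?\<mu> (r \<oplus>\<^bsub>R\<^esub> s) a = ?\<mu> r a + ?\<mu> s a" if "r \<in> base_fil R n" "s \<in> base_fil R n" for r s a
    proof -
      have "l (component R n (r \<oplus>\<^bsub>R\<^esub> s)) = l (component R n r) + l (component R n s)"
        using base_fil_carrier[OF that(1)] base_fil_carrier[OF that(2)] by (simp add: base.component_add l_add comp)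
      then show ?thesis by (simp only: const2_add distrib_right)
    qed
    show "?\<mu> r (a \<oplus>\<^bsub>A\<^esub> b) = ?\<mu> r a + ?\<mu> r b" if "a \<in> carrier A" "b \<in> carrier A" for r a b
      using that by (simp only: \<pi>_add distrib_left)
  qed
  obtain \<sigma> where \<sigma>:
    "\<And>c d x y. tensor_value A (base_fil R n) c x \<Longrightarrow> tensor_value A (base_fil R n) d y \<Longrightarrow> \<sigma> (x \<oplus>\<^bsub>A\<^esub> y) = \<sigma> x + \<sigma> y"
    "\<And>r a. r \<in> base_fil R n \<Longrightarrow> a \<in> carrier A \<Longrightarrow> \<sigma> (r \<odot>\<^bsub>A\<^esub> a) = ?\<mu> r a"
    using functional by blast
  have tv: "\<exists>c. tensor_value A (base_fil R n) c x" if "x \<in> fil R A n" for x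
    using that
  proof (induction rule: fil.induct)
    case zero then show ?case using tensor_value.zero by blast
  next
    case (step x j r a)
    then obtain c where "tensor_value A (base_fil R n) c x" by blast
    from tensor_value.step[OF this base_fil_grade[OF step(3,2)] step(4)] show ?case by blast
  qed
  have "is_symbol n l \<sigma>"
    unfolding is_symbol_def
  proof (intro conjI ballI)
    fix x y assume "x \<in> fil R A n" "y \<in> fil R A n"
    then obtain c d where "tensor_value A (base_fil R n) c x" "tensor_value A (base_fil R n) d y" using tv by metis
    then show "\<sigma> (x \<oplus>\<^bsub>A\<^esub> y) = \<sigma> x + \<sigma> y" by (rule \<sigma>(1))
  qed (rule \<sigma>(2))
  then show ?thesis by blast
qed

end

locale flat_fibred = fibred R A \<pi> P + finite_base R
  for R :: "(complex, 'r) gr_alg" and A :: "('r, 'a) gr_alg" and \<pi> P +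
  assumes flat: "flat R A"
begin

text \<open>
  The coefficient in \<open>P\<close> of the \<open>i\<close>-th basis vector of \<open>R\<^sub>n\<close>.
\<close>

definition symbol :: "nat \<Rightarrow> nat \<Rightarrow> 'a \<Rightarrow> complex poly poly" where
  "symbol n i = (SOME \<sigma>. is_symbol n (fcoord n i) \<sigma>)"

lemma is_symbol: "i < fdim n \<Longrightarrow> is_symbol n (fcoord n i) (symbol n i)"
  unfolding symbol_def
  by (rule someI_ex[of "is_symbol n (fcoord n i)"], rule symbol_exists) (auto intro: flat fcoord_add fcoord_smult)

lemma symbol_add: "i < fdim n \<Longrightarrow> x \<in> fil R A n \<Longrightarrow> y \<in> fil R A n \<Longrightarrow>
    symbol n i (x \<oplus>\<^bsub>A\<^esub> y) = symbol n i x + symbol n i y"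
  and symbol_smult: "i < fdim n \<Longrightarrow> r \<in> base_fil R n \<Longrightarrow> a \<in> carrier A \<Longrightarrow>
    symbol n i (r \<odot>\<^bsub>A\<^esub> a) = const2 (fcoord n i (component R n r)) * \<pi> a"
  using is_symbol[of i n] by (auto simp: is_symbol_def)

lemma fcoord_zero: "i < fdim n \<Longrightarrow> fcoord n i \<zero>\<^bsub>R\<^esub> = 0"
  using fcoord_add[of i n "\<zero>\<^bsub>R\<^esub>" "\<zero>\<^bsub>R\<^esub>"] base.grade_zero by simp

lemma symbol_gen: "i < fdim n \<Longrightarrow> r \<in> grade R n \<Longrightarrow> a \<in> carrier A \<Longrightarrow>
    symbol n i (r \<odot>\<^bsub>A\<^esub> a) = const2 (fcoord n i r) * \<pi> a"
  using symbol_smult[of i n r a] base_fil_grade[of r n n] base.component_homog[of r n n] by simp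

lemma symbol_gen_high: "i < fdim n \<Longrightarrow> n < j \<Longrightarrow> r \<in> grade R j \<Longrightarrow> a \<in> carrier A \<Longrightarrow>
    symbol n i (r \<odot>\<^bsub>A\<^esub> a) = 0"
  using symbol_smult[of i n r a] base_fil_grade[of r j n] base.component_homog[of r j n] by (simp add: fcoord_zero)

lemma symbol_zero: "i < fdim n \<Longrightarrow> symbol n i \<zero>\<^bsub>A\<^esub> = 0"
  using symbol_add[of i n "\<zero>\<^bsub>A\<^esub>" "\<zero>\<^bsub>A\<^esub>"] fil.zero[of A R n] by simp

lemma symbol_minus: "i < fdim n \<Longrightarrow> x \<in> fil R A n \<Longrightarrow> symbol n i (\<ominus>\<^bsub>A\<^esub> x) = - symbol n i x"
  using symbol_add[of i n x "\<ominus>\<^bsub>A\<^esub> x"] fil_carrier[of x n]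
  by (simp add: fil_minus alg.M.r_neg symbol_zero eq_neg_iff_add_eq_0 add.commute)

lemma symbol_diff: "i < fdim n \<Longrightarrow> x \<in> fil R A n \<Longrightarrow> y \<in> fil R A n \<Longrightarrow>
    symbol n i (x \<ominus>\<^bsub>A\<^esub> y) = symbol n i x - symbol n i y"
  by (simp add: a_minus_def symbol_add fil_minus symbol_minus)

lemma symbol_image:
  assumes x: "x \<in> fil R A n" and i: "i < fdim n"
    and f_fil: "\<And>x. x \<in> fil R A n \<Longrightarrow> f x \<in> fil R A n"
    and f_add: "\<And>x y. x \<in> carrier A \<Longrightarrow> y \<in> carrier A \<Longrightarrow> f (x \<oplus>\<^bsub>A\<^esub> y) = f x \<oplus>\<^bsub>A\<^esub> f y"
    and zero: "Pr 0 0" and add: "\<And>p q r s. Pr p q \<Longrightarrow> Pr r s \<Longrightarrow> Pr (p + r) (q + s)"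
    and gen: "\<And>j r a. n \<le> j \<Longrightarrow> r \<in> grade R j \<Longrightarrow> a \<in> carrier A \<Longrightarrow>
      Pr (symbol n i (r \<odot>\<^bsub>A\<^esub> a)) (symbol n i (f (r \<odot>\<^bsub>A\<^esub> a)))"
  shows "Pr (symbol n i x) (symbol n i (f x))"
  using x
proof (induction rule: fil.induct)
  case zero
  have c: "f \<zero>\<^bsub>A\<^esub> \<in> carrier A" using f_fil[OF fil.zero] fil_carrier by blast
  have "f \<zero>\<^bsub>A\<^esub> = f \<zero>\<^bsub>A\<^esub> \<oplus>\<^bsub>A\<^esub> f \<zero>\<^bsub>A\<^esub>" using f_add[of "\<zero>\<^bsub>A\<^esub>" "\<zero>\<^bsub>A\<^esub>"] by simp
  then have "f \<zero>\<^bsub>A\<^esub> = \<zero>\<^bsub>A\<^esub>" using c by (metis alg.M.add.l_cancel_one')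
  then show ?case using assms(5) symbol_zero[OF i] by simp
next
  case (step x j r a)
  have g: "r \<odot>\<^bsub>A\<^esub> a \<in> fil R A n" using step by (intro fil_gen)
  show ?case
    using add[OF step.IH gen[OF step.hyps(2-4)]] step.hyps(1) g f_add[of x "r \<odot>\<^bsub>A\<^esub> a"] i
    by (simp add: symbol_add fil_carrier f_fil)
qed

lemma symbol_mult: "i < fdim n \<Longrightarrow> x \<in> fil R A n \<Longrightarrow> b \<in> carrier A \<Longrightarrow>
    symbol n i (x \<otimes>\<^bsub>A\<^esub> b) = symbol n i x * \<pi> b"
proof (rule symbol_image[where Pr = "\<lambda>p q. q = p * \<pi> b" and f = "\<lambda>x. x \<otimes>\<^bsub>A\<^esub> b"])
  assume i: "i < fdim n" and b: "b \<in> carrier A"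
  fix j r a assume *: "n \<le> j" "r \<in> grade R j" "a \<in> carrier A"
  have "(r \<odot>\<^bsub>A\<^esub> a) \<otimes>\<^bsub>A\<^esub> b = r \<odot>\<^bsub>A\<^esub> (a \<otimes>\<^bsub>A\<^esub> b)"
    using * b grade_R_carrier by (simp add: alg.smult_assoc2)
  then show "symbol n i ((r \<odot>\<^bsub>A\<^esub> a) \<otimes>\<^bsub>A\<^esub> b) = symbol n i (r \<odot>\<^bsub>A\<^esub> a) * \<pi> b"
    using * b i by (cases "j = n") (simp_all add: symbol_gen symbol_gen_high[of i n j] \<pi>_mult)
qed (auto simp: fil_mult alg.l_distr algebra_simps)

lemma symbol_high: 
  assumes i: "i < fdim n" and x: "x \<in> fil R A (Suc n)" shows "symbol n i x = 0"
  using x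
proof (induction rule: fil.induct)
  case (step x j r a)
  then have "x \<in> fil R A n" "r \<odot>\<^bsub>A\<^esub> a \<in> fil R A n" using fil_antimono fil_gen[of n j] by auto
  then show ?case using step i by (simp add: symbol_add symbol_gen_high[of i n j])
qed (rule symbol_zero[OF i])

lemma symbol_smult_pos:
  "i < fdim n \<Longrightarrow> 0 < j \<Longrightarrow> r \<in> grade R j \<Longrightarrow> x \<in> fil R A n \<Longrightarrow> symbol n i (r \<odot>\<^bsub>A\<^esub> x) = 0"
  using fil_smult_homog[of r j x n] fil_antimono[of _ "j + n" "Suc n"] by (intro symbol_high) auto

lemma symbol_scalar:
  "i < fdim n \<Longrightarrow> x \<in> fil R A n \<Longrightarrow> symbol n i (scalar c \<odot>\<^bsub>A\<^esub> x) = const2 c * symbol n i x"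
proof (rule symbol_image[where Pr = "\<lambda>p q. q = const2 c * p" and f = "\<lambda>x. scalar c \<odot>\<^bsub>A\<^esub> x"])
  assume i: "i < fdim n"
  fix j r a assume *: "n \<le> j" "r \<in> grade R j" "a \<in> carrier A"
  have rc: "r \<in> carrier R" using * grade_R_carrier by simp
  have "scalar c \<odot>\<^bsub>A\<^esub> (r \<odot>\<^bsub>A\<^esub> a) = (scalar c \<otimes>\<^bsub>R\<^esub> r) \<odot>\<^bsub>A\<^esub> a"
    using * rc scalar_carrier by (simp add: alg.smult_assoc1)
  also have "scalar c \<otimes>\<^bsub>R\<^esub> r = c \<odot>\<^bsub>R\<^esub> r" using rc by (rule scalar_mult)
  finally have e: "scalar c \<odot>\<^bsub>A\<^esub> (r \<odot>\<^bsub>A\<^esub> a) = (c \<odot>\<^bsub>R\<^esub> r) \<odot>\<^bsub>A\<^esub> a" .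
  have "scalar c \<otimes>\<^bsub>R\<^esub> r \<in> grade R (0 + j)" using scalar_grade *(2) by (rule base.grade_mult)
  then have g: "c \<odot>\<^bsub>R\<^esub> r \<in> grade R j" using scalar_mult[OF rc] by simp
  show "symbol n i (scalar c \<odot>\<^bsub>A\<^esub> (r \<odot>\<^bsub>A\<^esub> a)) = const2 c * symbol n i (r \<odot>\<^bsub>A\<^esub> a)"
    unfolding e using * i g by (cases "j = n") (simp_all add: symbol_gen symbol_gen_high[of i n j] fcoord_smult)
next
  fix x assume "x \<in> fil R A n"
  then show "scalar c \<odot>\<^bsub>A\<^esub> x \<in> fil R A n" using fil_smult_homog[OF scalar_grade] by fastforce
qed (auto simp: alg.smult_r_distr scalar_carrier smult_add_right)

lemma symbol_P: "i < fdim n \<Longrightarrow> x \<in> fil R A n \<Longrightarrow> symbol n i x \<in> P"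
proof (rule symbol_image[where Pr = "\<lambda>p q. q \<in> P" and f = "\<lambda>x. x"])
  assume i: "i < fdim n"
  fix j r a assume *: "n \<le> j" "r \<in> grade R j" "a \<in> carrier A"
  show "symbol n i (r \<odot>\<^bsub>A\<^esub> a) \<in> P"
    using * i P_const[OF \<pi>_P] P_zero by (cases "j = n") (simp_all add: symbol_gen symbol_gen_high[of i n j])
qed (auto simp: P_zero P_add)

lemma symbol_component: "i < fdim n \<Longrightarrow> x \<in> fil R A n \<Longrightarrow> shifted n d (symbol n i (component A d x))"
proof (rule symbol_image[where Pr = "\<lambda>p q. shifted n d q" and f = "component A d"])
  assume i: "i < fdim n"
  fix j r a assume *: "n \<le> j" "r \<in> grade R j" "a \<in> carrier A"
  have c: "component A d (r \<odot>\<^bsub>A\<^esub> a) = (if j \<le> d then r \<odot>\<^bsub>A\<^esub> component A (d - j) a else \<zero>\<^bsub>A\<^esub>)"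
    using * grade_R_carrier by (intro alg.component_smult)
  have cc: "component A e a \<in> carrier A" for e using alg.component_carrier *(3) by blast
  show "shifted n d (symbol n i (component A d (r \<odot>\<^bsub>A\<^esub> a)))"
  proof (cases "j = n \<and> n \<le> d")
    case True
    then have "shifted n d (\<pi> (component A (d - n) a))"
      using homog_shifted[OF \<pi>_homog[OF alg.component_props(1)[OF *(3), of "d - n"]], of n] by simp
    then show ?thesis unfolding c using True * i cc by (simp add: symbol_gen shifted_const2 del: mult_pCons_left)
  next
    case False
    then show ?thesis unfolding c using * i cc by (auto simp: symbol_gen_high[of i n j] symbol_zero)
  qed
qed (auto simp: fil_component alg.component_add shifted_add)

text \<open>
  Write \<open>x\<close> modulo \<open>R\<^bsub>>n\<^esub> A\<close> as a combination of the basis vectors of \<open>R\<^sub>n\<close>.  The coefficients lift the symbols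
  of \<open>x\<close>, so they lie in \<open>R\<^bsub>>0\<^esub> A\<close> if all symbols vanish.
\<close>

lemma symbol_test:
  assumes x: "x \<in> fil R A n" and zero: "\<And>i. i < fdim n \<Longrightarrow> symbol n i x = 0"
  shows "x \<in> fil R A (Suc n)"
proof -
  let ?S = "\<lambda>a. finsum A (\<lambda>i. fvec n i \<odot>\<^bsub>A\<^esub> a i) {..<fdim n}"
  have vc: "fvec n i \<in> carrier R" if "i < fdim n" for i using fvec[OF that] grade_R_carrier by blast
  have "\<exists>a z. (\<forall>i<fdim n. a i \<in> carrier A \<and> \<pi> (a i) = symbol n i x) \<and> z \<in> fil R A (Suc n) \<and> x = ?S a \<oplus>\<^bsub>A\<^esub> z"
    using x
  proof (induction rule: fil.induct)
    case zero
    have "?S (\<lambda>i. \<zero>\<^bsub>A\<^esub>) = finsum A (\<lambda>i. \<zero>\<^bsub>A\<^esub>) {..<fdim n}" 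
      by (intro alg.M.finsum_cong') (auto simp: vc)
    then have "?S (\<lambda>i. \<zero>\<^bsub>A\<^esub>) = \<zero>\<^bsub>A\<^esub>" by simp
    then show ?case
      by (intro exI[of _ "\<lambda>i. \<zero>\<^bsub>A\<^esub>"] exI[of _ "\<zero>\<^bsub>A\<^esub>"]) (auto simp: symbol_zero \<pi>_zero fil.zero)
  next
    case (step x j r b)
    obtain a z where a: "\<And>i. i < fdim n \<Longrightarrow> a i \<in> carrier A" "\<And>i. i < fdim n \<Longrightarrow> \<pi> (a i) = symbol n i x"
      and z: "z \<in> fil R A (Suc n)" and xe: "x = ?S a \<oplus>\<^bsub>A\<^esub> z" using step.IH by blast
    note zc = fil_carrier[OF z]
    have rc: "r \<in> carrier R" using step grade_R_carrier by blast
    have rb: "r \<odot>\<^bsub>A\<^esub> b \<in> fil R A n" "r \<odot>\<^bsub>A\<^esub> b \<in> carrier A" using step rc by (auto intro: fil_gen)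
    have Sc: "?S a \<in> carrier A" using a(1) vc by (intro alg.M.finsum_closed) auto
    have sx: "symbol n i (x \<oplus>\<^bsub>A\<^esub> r \<odot>\<^bsub>A\<^esub> b) = symbol n i x + symbol n i (r \<odot>\<^bsub>A\<^esub> b)" if "i < fdim n" for i
      using that step rb by (simp add: symbol_add)
    show ?case
    proof (cases "j = n")
      case False
      then have "r \<odot>\<^bsub>A\<^esub> b \<in> fil R A (Suc n)" using step by (intro fil_gen) auto
      then have "z \<oplus>\<^bsub>A\<^esub> r \<odot>\<^bsub>A\<^esub> b \<in> fil R A (Suc n)" using z fil_add by blast
      moreover have "x \<oplus>\<^bsub>A\<^esub> r \<odot>\<^bsub>A\<^esub> b = ?S a \<oplus>\<^bsub>A\<^esub> (z \<oplus>\<^bsub>A\<^esub> r \<odot>\<^bsub>A\<^esub> b)"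
        unfolding xe using Sc zc rb by (simp add: alg.M.a_assoc)
      moreover have "\<pi> (a i) = symbol n i (x \<oplus>\<^bsub>A\<^esub> r \<odot>\<^bsub>A\<^esub> b)" if "i < fdim n" for i
        using that a sx False step by (simp add: symbol_gen_high[of i n j])
      ultimately show ?thesis using a(1) by blast
    next
      case True
      define a' where "a' i = a i \<oplus>\<^bsub>A\<^esub> scalar (fcoord n i r) \<odot>\<^bsub>A\<^esub> b" for i
      have sb: "scalar c \<odot>\<^bsub>A\<^esub> b \<in> carrier A" for c using step scalar_carrier by simp
      have a'c: "a' i \<in> carrier A" if "i < fdim n" for i using a(1)[OF that] sb by (simp add: a'_def)
      have "?S a' = finsum A (\<lambda>i. fvec n i \<odot>\<^bsub>A\<^esub> a i \<oplus>\<^bsub>A\<^esub> (fcoord n i r \<odot>\<^bsub>R\<^esub> fvec n i) \<odot>\<^bsub>A\<^esub> b) {..<fdim n}"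
      proof (intro alg.M.finsum_cong' refl)
        fix i assume i: "i \<in> {..<fdim n}"
        have "fvec n i \<odot>\<^bsub>A\<^esub> (scalar (fcoord n i r) \<odot>\<^bsub>A\<^esub> b) = (scalar (fcoord n i r) \<otimes>\<^bsub>R\<^esub> fvec n i) \<odot>\<^bsub>A\<^esub> b"
          using i vc step scalar_carrier by (simp add: alg.smult_assoc1[symmetric] base.m_comm)
        then show "fvec n i \<odot>\<^bsub>A\<^esub> a' i = fvec n i \<odot>\<^bsub>A\<^esub> a i \<oplus>\<^bsub>A\<^esub> (fcoord n i r \<odot>\<^bsub>R\<^esub> fvec n i) \<odot>\<^bsub>A\<^esub> b"
          using i vc a(1) sb by (simp add: a'_def alg.smult_r_distr scalar_mult)
      qed (use vc a(1) step smult_R_closed in auto)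
      also have "\<dots> = ?S a \<oplus>\<^bsub>A\<^esub> finsum A (\<lambda>i. (fcoord n i r \<odot>\<^bsub>R\<^esub> fvec n i) \<odot>\<^bsub>A\<^esub> b) {..<fdim n}"
        using vc a(1) step smult_R_closed by (intro alg.M.finsum_addf) auto
      also have "finsum A (\<lambda>i. (fcoord n i r \<odot>\<^bsub>R\<^esub> fvec n i) \<odot>\<^bsub>A\<^esub> b) {..<fdim n} = r \<odot>\<^bsub>A\<^esub> b"
        using fexpand[of r n] step True vc smult_R_closed
        by (subst alg.finsum_smult_rdistr[symmetric]) auto
      finally have S: "?S a' = ?S a \<oplus>\<^bsub>A\<^esub> r \<odot>\<^bsub>A\<^esub> b" .
      have "x \<oplus>\<^bsub>A\<^esub> r \<odot>\<^bsub>A\<^esub> b = ?S a' \<oplus>\<^bsub>A\<^esub> z"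
        unfolding xe S using Sc zc rb by (simp add: alg.M.a_ac)
      moreover have "\<pi> (a' i) = symbol n i (x \<oplus>\<^bsub>A\<^esub> r \<odot>\<^bsub>A\<^esub> b)" if "i < fdim n" for i
        using that a sx True step sb by (simp add: symbol_gen a'_def \<pi>_add \<pi>_scalar)
      ultimately show ?thesis using a'c z by blast
    qed
  qed
  then obtain a z where a: "\<And>i. i < fdim n \<Longrightarrow> a i \<in> carrier A" "\<And>i. i < fdim n \<Longrightarrow> \<pi> (a i) = 0"
    and z: "z \<in> fil R A (Suc n)" and xe: "x = ?S a \<oplus>\<^bsub>A\<^esub> z" using zero by auto
  have gen: "fvec n i \<odot>\<^bsub>A\<^esub> a i \<in> fil R A (Suc n)" if "i < fdim n" for i
    using fil_smult_homog[OF fvec[OF that] \<pi>_ker[OF a(1)[OF that] a(2)[OF that]]] by simp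
  have "finite T \<Longrightarrow> T \<subseteq> {..<fdim n} \<Longrightarrow> finsum A (\<lambda>i. fvec n i \<odot>\<^bsub>A\<^esub> a i) T \<in> fil R A (Suc n)" for T
  proof (induction T rule: finite_induct)
    case (insert i T)
    then show ?case
      using gen a(1) vc by (subst alg.M.finsum_insert) (auto intro!: fil_add)
  qed (simp add: fil.zero)
  then show ?thesis unfolding xe using z fil_add by blast
qed

end

section \<open>Freeness of flat deformations\<close>

locale based_fibred = flat_fibred R A \<pi> P
  for R :: "(complex, 'r) gr_alg" and A :: "('r, 'a) gr_alg" and \<pi> P +
  fixes B :: "complex poly poly set" and dg :: "complex poly poly \<Rightarrow> nat"
  assumes B_P: "b \<in> B \<Longrightarrow> b \<in> P" and B_homog: "b \<in> B \<Longrightarrow> homog (dg b) b"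
    and B_indep: "finite T \<Longrightarrow> T \<subseteq> B \<Longrightarrow> (\<Sum>b\<in>T. const2 (c b) * b) = 0 \<Longrightarrow> b \<in> T \<Longrightarrow> c b = 0"
    and B_span: "p \<in> P \<Longrightarrow> homog d p \<Longrightarrow>
      \<exists>T c. finite T \<and> T \<subseteq> B \<and> (\<forall>b\<in>T. dg b = d) \<and> p = (\<Sum>b\<in>T. const2 (c b) * b)"
begin

definition lift :: "complex poly poly \<Rightarrow> 'a" where
  "lift b = (SOME x. x \<in> grade A (dg b) \<and> \<pi> x = b)"

lemma lift: "b \<in> B \<Longrightarrow> lift b \<in> grade A (dg b)" "b \<in> B \<Longrightarrow> \<pi> (lift b) = b"
proof -
  assume "b \<in> B"
  then have "\<exists>x. x \<in> grade A (dg b) \<and> \<pi> x = b" using \<pi>_surj_grade B_P B_homog by blast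
  from someI_ex[OF this] show "lift b \<in> grade A (dg b)" "\<pi> (lift b) = b" by (simp_all add: lift_def)
qed

lemma lift_carrier: "b \<in> B \<Longrightarrow> lift b \<in> carrier A"
  using lift(1) alg.grade_carrier by blast

text \<open>
  The lifts of the basis generate \<open>A\<close> as an \<open>R\<close>-module, by the graded Nakayama lemma.
\<close>

lemma lift_induct [consumes 1, case_names zero add smult lift]:
  assumes x: "x \<in> carrier A" and zero: "Pr \<zero>\<^bsub>A\<^esub>"
    and add: "\<And>x y. x \<in> carrier A \<Longrightarrow> Pr x \<Longrightarrow> y \<in> carrier A \<Longrightarrow> Pr y \<Longrightarrow> Pr (x \<oplus>\<^bsub>A\<^esub> y)"
    and smult: "\<And>r j x. r \<in> grade R j \<Longrightarrow> x \<in> carrier A \<Longrightarrow> Pr x \<Longrightarrow> Pr (r \<odot>\<^bsub>A\<^esub> x)"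
    and lifts: "\<And>b. b \<in> B \<Longrightarrow> Pr (lift b)"
  shows "Pr x"
proof -
  define M where "M = {x \<in> carrier A. Pr x}"
  have M_zero: "\<zero>\<^bsub>A\<^esub> \<in> M" using zero by (simp add: M_def)
  have M_add: "x \<oplus>\<^bsub>A\<^esub> y \<in> M" if "x \<in> M" "y \<in> M" for x y using that add by (simp add: M_def)
  have M_smult: "r \<odot>\<^bsub>A\<^esub> x \<in> M" if "r \<in> grade R j" "x \<in> M" for r j x
    using that smult[OF that(1)] grade_R_carrier[OF that(1)] by (simp add: M_def)
  have M_lift: "lift b \<in> M" if "b \<in> B" for b using that lifts lift_carrier by (simp add: M_def)
  have "x \<in> M"
  proof (rule nakayama[OF M_zero M_add M_smult _ x])
    fix d x assume x: "x \<in> grade A d"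
    obtain T c where T: "finite T" "T \<subseteq> B" "\<forall>b\<in>T. dg b = d" "\<pi> x = (\<Sum>b\<in>T. const2 (c b) * b)"
      using B_span[OF \<pi>_P[OF alg.grade_carrier[OF x]] \<pi>_homog[OF x]] by blast
    have "\<exists>m. m \<in> M \<and> m \<in> grade A d \<and> \<pi> m = (\<Sum>b\<in>T. const2 (c b) * b)"
      using T(1-3)
    proof (induction T rule: finite_induct)
      case empty
      then show ?case using M_zero alg.grade_zero \<pi>_zero by force
    next
      case (insert b T)
      then obtain m where m: "m \<in> M" "m \<in> grade A d" "\<pi> m = (\<Sum>b\<in>T. const2 (c b) * b)" by auto
      have b: "b \<in> B" "dg b = d" using insert by auto
      let ?m = "m \<oplus>\<^bsub>A\<^esub> scalar (c b) \<odot>\<^bsub>A\<^esub> lift b"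
      have "scalar (c b) \<odot>\<^bsub>A\<^esub> lift b \<in> grade A (0 + d)"
        using lift(1)[OF b(1)] b(2) by (intro alg.grade_smult scalar_grade) simp
      then have "?m \<in> grade A d" using alg.grade_add[OF m(2)] by simp
      moreover have "?m \<in> M"
        by (rule M_add[OF m(1) M_smult[OF scalar_grade M_lift[OF b(1)]]])
      moreover have "\<pi> ?m = (\<Sum>b\<in>insert b T. const2 (c b) * b)"
        using m insert(1,2) lift_carrier[OF b(1)] lift(2)[OF b(1)] alg.grade_carrier[OF m(2)] scalar_carrier
        by (simp add: \<pi>_add \<pi>_scalar add.commute del: mult_pCons_left)
      ultimately show ?case by blast
    qed
    then show "\<exists>m\<in>M. m \<in> grade A d \<and> \<pi> m = \<pi> x" using T(4) by auto
  qed
  then show ?thesis by (simp add: M_def)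
qed

lemma combination_symbol:
  assumes "finite T" "T \<subseteq> B" "\<And>b. b \<in> T \<Longrightarrow> f b \<in> base_fil R n" "i < fdim n"
  shows "finsum A (\<lambda>b. f b \<odot>\<^bsub>A\<^esub> lift b) T \<in> fil R A n \<and>
    symbol n i (finsum A (\<lambda>b. f b \<odot>\<^bsub>A\<^esub> lift b) T) = (\<Sum>b\<in>T. const2 (fcoord n i (component R n (f b))) * b)"
  using assms
proof (induction T rule: finite_induct)
  case empty then show ?case by (simp add: fil.zero symbol_zero)
next
  case (insert b T)
  then have b: "f b \<in> base_fil R n" "b \<in> B" by auto
  have fc: "f c \<in> carrier R" if "c \<in> insert b T" for c
    using base_fil_carrier insert.prems(2) that by blast
  have g: "f b \<odot>\<^bsub>A\<^esub> lift b \<in> fil R A n" using b lift_carrier by (intro base_fil_smult)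
  have "finsum A (\<lambda>b. f b \<odot>\<^bsub>A\<^esub> lift b) (insert b T) = f b \<odot>\<^bsub>A\<^esub> lift b \<oplus>\<^bsub>A\<^esub> finsum A (\<lambda>b. f b \<odot>\<^bsub>A\<^esub> lift b) T"
    using insert.hyps insert.prems(1) fc lift_carrier by (intro alg.M.finsum_insert) auto
  then show ?case
    using insert g b lift_carrier by (simp add: fil_add symbol_add symbol_smult lift(2))
qed

text \<open>
  Suppose that all coefficients of a relation lie in \<open>R\<^bsub>\<ge>n\<^esub>\<close>.  The symbols of the relation are linear
  relations between basis elements of \<open>P\<close>, so the components of degree \<open>n\<close> of the coefficients vanish too.
\<close>

lemma lift_independent:
  assumes T: "finite T" "T \<subseteq> B" and f: "\<And>b. b \<in> T \<Longrightarrow> f b \<in> carrier R"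
    and zero: "finsum A (\<lambda>b. f b \<odot>\<^bsub>A\<^esub> lift b) T = \<zero>\<^bsub>A\<^esub>" and b: "b \<in> T"
  shows "f b = \<zero>\<^bsub>R\<^esub>"
proof -
  have "\<forall>b\<in>T. f b \<in> base_fil R n" for n
  proof (induction n)
    case 0
    then show ?case using f self.fil_0 by simp
  next
    case (Suc n)
    show ?case
    proof
      fix b assume b: "b \<in> T"
      have comp: "component R n (f b) \<in> grade R n" using base.component_props(1)[OF f[OF b]] .
      have co: "fcoord n i (component R n (f b)) = 0" if i: "i < fdim n" for i
      proof (rule B_indep[OF T _ b])
        show "(\<Sum>b\<in>T. const2 (fcoord n i (component R n (f b))) * b) = 0"
          using combination_symbol[OF T, of f n i] Suc i zero symbol_zero[OF i] by simp
      qed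
      have "component R n (f b) = (\<Oplus>\<^bsub>R\<^esub>i\<in>{..<fdim n}. fcoord n i (component R n (f b)) \<odot>\<^bsub>R\<^esub> fvec n i)"
        by (rule fexpand[OF comp])
      also have "\<dots> = (\<Oplus>\<^bsub>R\<^esub>i\<in>{..<fdim n}. \<zero>\<^bsub>R\<^esub>)"
        using grade_R_carrier[OF fvec[of _ n]] by (intro base.finsum_cong') (auto simp: co smult_R_simps)
      also have "\<dots> = \<zero>\<^bsub>R\<^esub>" by simp
      finally have "component R n (f b) = \<zero>\<^bsub>R\<^esub>" .
      then show "f b \<in> base_fil R (Suc n)"
        using Suc b f self_component_smult_low[of "f b" n]
        by (intro self_filI) (auto simp: less_Suc_eq)
    qed
  qed
  then have "f b \<in> fil R (self_algebra R) n" for n using b by blast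
  then show ?thesis using self.fil_Inter[of "f b"] f[OF b] by simp
qed

lemma combination_extend:
  assumes "graded_over R C" and T: "finite T" and s: "\<And>b. b \<in> insert b0 T \<Longrightarrow> s b \<in> carrier C"
    and f: "\<And>b. b \<in> T \<Longrightarrow> f b \<in> carrier R" and r: "r \<in> carrier R"
  shows "finsum C (\<lambda>b. ((if b \<in> T then f b else \<zero>\<^bsub>R\<^esub>) \<oplus>\<^bsub>R\<^esub> (if b = b0 then r else \<zero>\<^bsub>R\<^esub>)) \<odot>\<^bsub>C\<^esub> s b) (insert b0 T) =
    finsum C (\<lambda>b. f b \<odot>\<^bsub>C\<^esub> s b) T \<oplus>\<^bsub>C\<^esub> r \<odot>\<^bsub>C\<^esub> s b0"
proof -
  interpret C: graded_over R C by fact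
  let ?g = "\<lambda>b. if b \<in> T then f b else \<zero>\<^bsub>R\<^esub>" and ?h = "\<lambda>b. if b = b0 then r else \<zero>\<^bsub>R\<^esub>"
  have g: "?g b \<in> carrier R" and h: "?h b \<in> carrier R" for b using f r by auto
  have "finsum C (\<lambda>b. (?g b \<oplus>\<^bsub>R\<^esub> ?h b) \<odot>\<^bsub>C\<^esub> s b) (insert b0 T) =
      finsum C (\<lambda>b. ?g b \<odot>\<^bsub>C\<^esub> s b \<oplus>\<^bsub>C\<^esub> ?h b \<odot>\<^bsub>C\<^esub> s b) (insert b0 T)"
    using s f r by (intro C.alg.M.finsum_cong' refl C.alg.smult_l_distr g h) auto
  also have "\<dots> = finsum C (\<lambda>b. ?g b \<odot>\<^bsub>C\<^esub> s b) (insert b0 T) \<oplus>\<^bsub>C\<^esub> finsum C (\<lambda>b. ?h b \<odot>\<^bsub>C\<^esub> s b) (insert b0 T)"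
    by (rule C.alg.M.finsum_addf) (auto intro!: C.alg.smult_closed s f r)
  also have "finsum C (\<lambda>b. ?g b \<odot>\<^bsub>C\<^esub> s b) (insert b0 T) = finsum C (\<lambda>b. f b \<odot>\<^bsub>C\<^esub> s b) T"
    using T s f by (intro C.alg.M.add.finprod_mono_neutral_cong_right) auto
  also have "finsum C (\<lambda>b. ?h b \<odot>\<^bsub>C\<^esub> s b) (insert b0 T) = finsum C (\<lambda>b. r \<odot>\<^bsub>C\<^esub> s b) {b0}"
    using T s r by (intro C.alg.M.add.finprod_mono_neutral_cong_right) auto
  also have "\<dots> = r \<odot>\<^bsub>C\<^esub> s b0" using s r by simp
  finally show ?thesis .
qed

text \<open>
  Conversely all families of symbols of the appropriate degree occur; take lifts as coefficients of
  the basis vectors of \<open>R\<^sub>n\<close>.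
\<close>

lemma symbol_realize:
  assumes p: "\<And>i. i < fdim n \<Longrightarrow> p i \<in> P" "\<And>i. i < fdim n \<Longrightarrow> shifted n d (p i)"
  obtains K where "K \<in> fil R A n" "K \<in> grade A d" "\<And>i. i < fdim n \<Longrightarrow> symbol n i K = p i"
proof -
  have "\<exists>a. a \<in> carrier A \<and> \<pi> a = p i \<and> fvec n i \<odot>\<^bsub>A\<^esub> a \<in> grade A d" if i: "i < fdim n" for i
  proof (cases "n \<le> d")
    case True
    obtain a where a: "a \<in> grade A (d - n)" "\<pi> a = p i"
      using \<pi>_surj_grade[OF p(1)[OF i] shifted_homog[OF p(2)[OF i] True]] by blast
    have "fvec n i \<odot>\<^bsub>A\<^esub> a \<in> grade A (n + (d - n))" by (rule alg.grade_smult[OF fvec[OF i] a(1)])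
    then show ?thesis using True a alg.grade_carrier by auto
  next
    case False
    then have "p i = 0" using shifted_small[OF p(2)[OF i]] by simp
    then show ?thesis
      using \<pi>_zero alg.grade_zero grade_R_carrier[OF fvec[OF i]] by (intro exI[of _ "\<zero>\<^bsub>A\<^esub>"]) simp
  qed
  then obtain a where a: "\<And>i. i < fdim n \<Longrightarrow> a i \<in> carrier A" "\<And>i. i < fdim n \<Longrightarrow> \<pi> (a i) = p i"
    "\<And>i. i < fdim n \<Longrightarrow> fvec n i \<odot>\<^bsub>A\<^esub> a i \<in> grade A d" by metis
  have vc: "fvec n i \<in> carrier R" if "i < fdim n" for i using fvec[OF that] grade_R_carrier by blast
  have *: "finite T \<Longrightarrow> T \<subseteq> {..<fdim n} \<Longrightarrow> finsum A (\<lambda>i. fvec n i \<odot>\<^bsub>A\<^esub> a i) T \<in> fil R A n \<and>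
      finsum A (\<lambda>i. fvec n i \<odot>\<^bsub>A\<^esub> a i) T \<in> grade A d \<and>
      (\<forall>j<fdim n. symbol n j (finsum A (\<lambda>i. fvec n i \<odot>\<^bsub>A\<^esub> a i) T) = (\<Sum>i\<in>T. if j = i then p i else 0))" for T
  proof (induction T rule: finite_induct)
    case empty then show ?case by (simp add: fil.zero alg.grade_zero symbol_zero)
  next
    case (insert i T)
    have i: "i < fdim n" using insert by simp
    have e: "finsum A (\<lambda>i. fvec n i \<odot>\<^bsub>A\<^esub> a i) (insert i T) = fvec n i \<odot>\<^bsub>A\<^esub> a i \<oplus>\<^bsub>A\<^esub> finsum A (\<lambda>i. fvec n i \<odot>\<^bsub>A\<^esub> a i) T"
      using insert.hyps insert.prems vc a(1) by (intro alg.M.finsum_insert) auto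
    have g: "fvec n i \<odot>\<^bsub>A\<^esub> a i \<in> fil R A n" using fil_gen[OF order_refl fvec[OF i] a(1)[OF i]] .
    show ?case
      unfolding e using insert g a(3)[OF i] i
      by (auto simp: fil_add alg.grade_add symbol_add symbol_gen fvec a fcoord_fvec smult_const_one)
  qed
  show thesis
  proof (rule that[of "finsum A (\<lambda>i. fvec n i \<odot>\<^bsub>A\<^esub> a i) {..<fdim n}"])
    show "symbol n i (finsum A (\<lambda>i. fvec n i \<odot>\<^bsub>A\<^esub> a i) {..<fdim n}) = p i" if "i < fdim n" for i
      using *[of "{..<fdim n}"] that by simp
  qed (use *[of "{..<fdim n}"] in simp_all)
qed

end

text \<open>
  The graph of the \<open>R\<close>-linear map that sends \<open>s b\<close> to \<open>t b\<close>, as long as such a map exists.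
\<close>

inductive_set combinations :: "(complex, 'r) gr_alg \<Rightarrow> ('r, 'a) gr_alg \<Rightarrow> ('r, 'c) gr_alg \<Rightarrow> 'b set \<Rightarrow> ('b \<Rightarrow> 'a) \<Rightarrow> ('b \<Rightarrow> 'c) \<Rightarrow> ('a \<times> 'c) set"
  for R A C B s t where
  zero: "(\<zero>\<^bsub>A\<^esub>, \<zero>\<^bsub>C\<^esub>) \<in> combinations R A C B s t"
| step: "(x, y) \<in> combinations R A C B s t \<Longrightarrow> r \<in> grade R j \<Longrightarrow> b \<in> B \<Longrightarrow>
    (x \<oplus>\<^bsub>A\<^esub> r \<odot>\<^bsub>A\<^esub> s b, y \<oplus>\<^bsub>C\<^esub> r \<odot>\<^bsub>C\<^esub> t b) \<in> combinations R A C B s t"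

text \<open>
  The universal property of a free module, for degree preserving maps.  The graph \<open>G\<close> is total since the
  lifts generate \<open>A\<close>, and it is single-valued since they are independent.
\<close>

lemma (in based_fibred) free_extension:
  fixes C :: "('r, 'c) gr_alg"
  assumes C: "graded_over R C" and t: "\<And>b. b \<in> B \<Longrightarrow> t b \<in> grade C (dg b)"
  obtains g where "\<And>x. x \<in> carrier A \<Longrightarrow> g x \<in> carrier C"
    "\<And>x y. x \<in> carrier A \<Longrightarrow> y \<in> carrier A \<Longrightarrow> g (x \<oplus>\<^bsub>A\<^esub> y) = g x \<oplus>\<^bsub>C\<^esub> g y"
    "\<And>r x. r \<in> carrier R \<Longrightarrow> x \<in> carrier A \<Longrightarrow> g (r \<odot>\<^bsub>A\<^esub> x) = r \<odot>\<^bsub>C\<^esub> g x"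
    "\<And>d x. x \<in> grade A d \<Longrightarrow> g x \<in> grade C d"
    "\<And>b. b \<in> B \<Longrightarrow> g (lift b) = t b"
proof -
  interpret C: graded_over R C by fact
  define G where "G = combinations R A C B lift t"
  have tc: "t b \<in> carrier C" if "b \<in> B" for b using t[OF that] C.alg.grade_carrier by blast
  have carr: "x \<in> carrier A \<and> y \<in> carrier C" if "(x, y) \<in> G" for x y
    using that unfolding G_def
    by (induction rule: combinations.induct) (auto simp: lift_carrier tc grade_R_carrier)
  have G_zero: "(\<zero>\<^bsub>A\<^esub>, \<zero>\<^bsub>C\<^esub>) \<in> G"
    unfolding G_def by (rule combinations.zero)
  have form: "\<exists>T f. finite T \<and> T \<subseteq> B \<and> (\<forall>b\<in>T. f b \<in> carrier R) \<and>
      x = finsum A (\<lambda>b. f b \<odot>\<^bsub>A\<^esub> lift b) T \<and> y = finsum C (\<lambda>b. f b \<odot>\<^bsub>C\<^esub> t b) T" if "(x, y) \<in> G" for x y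
    using that unfolding G_def
  proof (induction rule: combinations.induct)
    case zero
    show ?case by (intro exI[of _ "{}"]) simp
  next
    case (step x y r j b)
    then obtain T f where T: "finite T" "T \<subseteq> B" "\<forall>b\<in>T. f b \<in> carrier R"
      and xy: "x = finsum A (\<lambda>b. f b \<odot>\<^bsub>A\<^esub> lift b) T" "y = finsum C (\<lambda>b. f b \<odot>\<^bsub>C\<^esub> t b) T" by blast
    have r: "r \<in> carrier R" using step grade_R_carrier by blast
    let ?f = "\<lambda>c. (if c \<in> T then f c else \<zero>\<^bsub>R\<^esub>) \<oplus>\<^bsub>R\<^esub> (if c = b then r else \<zero>\<^bsub>R\<^esub>)"
    have "x \<oplus>\<^bsub>A\<^esub> r \<odot>\<^bsub>A\<^esub> lift b = finsum A (\<lambda>b. ?f b \<odot>\<^bsub>A\<^esub> lift b) (insert b T)"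
      unfolding xy using T r step(3) lift_carrier
      by (intro combination_extend[symmetric] graded_over_axioms) auto
    moreover have "y \<oplus>\<^bsub>C\<^esub> r \<odot>\<^bsub>C\<^esub> t b = finsum C (\<lambda>b. ?f b \<odot>\<^bsub>C\<^esub> t b) (insert b T)"
      unfolding xy using T r step(3) tc
      by (intro combination_extend[symmetric] C) auto
    moreover have "\<forall>c\<in>insert b T. ?f c \<in> carrier R" using T r by auto
    moreover have "finite (insert b T)" "insert b T \<subseteq> B" using T step(3) by auto
    ultimately show ?case by (intro exI[of _ "insert b T"] exI[of _ ?f] conjI)
  qed
  have fun0: "y = \<zero>\<^bsub>C\<^esub>" if y0: "(\<zero>\<^bsub>A\<^esub>, y) \<in> G" for y
  proof -
    obtain T f where T: "finite T" "T \<subseteq> B" "\<And>b. b \<in> T \<Longrightarrow> f b \<in> carrier R"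
      and xy: "\<zero>\<^bsub>A\<^esub> = finsum A (\<lambda>b. f b \<odot>\<^bsub>A\<^esub> lift b) T" "y = finsum C (\<lambda>b. f b \<odot>\<^bsub>C\<^esub> t b) T"
      using form[OF y0] by blast
    have "f b = \<zero>\<^bsub>R\<^esub>" if "b \<in> T" for b using lift_independent[OF T xy(1)[symmetric] that] .
    then have "y = finsum C (\<lambda>b. \<zero>\<^bsub>C\<^esub>) T"
      unfolding xy(2) using T(2) tc by (intro C.alg.M.finsum_cong') auto
    then show ?thesis by simp
  qed
  have G_add: "(x \<oplus>\<^bsub>A\<^esub> x', y \<oplus>\<^bsub>C\<^esub> y') \<in> G" if "(x', y') \<in> G" "(x, y) \<in> G" for x y x' y'
    using that(1) unfolding G_def
  proof (induction rule: combinations.induct)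
    case zero then show ?case using carr[OF that(2)] that(2) by (simp add: G_def)
  next
    case (step x' y' r j b)
    have c: "x' \<in> carrier A" "y' \<in> carrier C" "r \<in> carrier R" using carr step grade_R_carrier by (auto simp: G_def)
    have "(x \<oplus>\<^bsub>A\<^esub> x' \<oplus>\<^bsub>A\<^esub> r \<odot>\<^bsub>A\<^esub> lift b, y \<oplus>\<^bsub>C\<^esub> y' \<oplus>\<^bsub>C\<^esub> r \<odot>\<^bsub>C\<^esub> t b) \<in> combinations R A C B lift t"
      by (rule combinations.step[OF step.IH step.hyps(2,3)])
    then show ?case
      using c carr[OF that(2)] step.hyps(3) lift_carrier tc by (simp add: alg.M.a_assoc C.alg.M.a_assoc)
  qed
  have G_homog: "(r \<odot>\<^bsub>A\<^esub> x, r \<odot>\<^bsub>C\<^esub> y) \<in> G" if "(x, y) \<in> G" "r \<in> grade R j" for x y r j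
    using that(1) unfolding G_def
  proof (induction rule: combinations.induct)
    case zero then show ?case using combinations.zero grade_R_carrier[OF that(2)] by simp
  next
    case (step x y s k b)
    have c: "x \<in> carrier A" "y \<in> carrier C" "s \<in> carrier R" "r \<in> carrier R"
      using carr step grade_R_carrier that(2) by (auto simp: G_def)
    have "(r \<odot>\<^bsub>A\<^esub> x \<oplus>\<^bsub>A\<^esub> (r \<otimes>\<^bsub>R\<^esub> s) \<odot>\<^bsub>A\<^esub> lift b, r \<odot>\<^bsub>C\<^esub> y \<oplus>\<^bsub>C\<^esub> (r \<otimes>\<^bsub>R\<^esub> s) \<odot>\<^bsub>C\<^esub> t b) \<in> combinations R A C B lift t"
      by (rule combinations.step[OF step.IH base.grade_mult[OF that(2) step.hyps(2)] step.hyps(3)])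
    then show ?case
      using c step.hyps(3) lift_carrier tc
      by (simp add: alg.smult_r_distr C.alg.smult_r_distr alg.smult_assoc1 C.alg.smult_assoc1)
  qed
  have G_smult: "(r \<odot>\<^bsub>A\<^esub> x, r \<odot>\<^bsub>C\<^esub> y) \<in> G" if "r \<in> carrier R" "(x, y) \<in> G" for x y r
    using that(1)
  proof (induction rule: base.homog_induct)
    case zero then show ?case using carr[OF that(2)] combinations.zero by (simp add: G_def)
  next
    case (add d r s)
    then show ?case
      using G_add[OF G_homog[OF that(2) add.hyps(2)] add.IH] carr[OF that(2)] grade_R_carrier
      by (simp add: alg.smult_l_distr C.alg.smult_l_distr)
  qed
  have G_gen: "(lift b, t b) \<in> G" if "b \<in> B" for b
  proof -
    have "(\<zero>\<^bsub>A\<^esub> \<oplus>\<^bsub>A\<^esub> \<one>\<^bsub>R\<^esub> \<odot>\<^bsub>A\<^esub> lift b, \<zero>\<^bsub>C\<^esub> \<oplus>\<^bsub>C\<^esub> \<one>\<^bsub>R\<^esub> \<odot>\<^bsub>C\<^esub> t b) \<in> G"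
      unfolding G_def by (rule combinations.step[OF combinations.zero base.grade_one that])
    then show ?thesis using lift_carrier[OF that] tc[OF that] by simp
  qed
  have G_diff: "(x \<ominus>\<^bsub>A\<^esub> x', y \<ominus>\<^bsub>C\<^esub> y') \<in> G" if "(x, y) \<in> G" "(x', y') \<in> G" for x y x' y'
  proof -
    have "((\<ominus>\<^bsub>R\<^esub> \<one>\<^bsub>R\<^esub>) \<odot>\<^bsub>A\<^esub> x', (\<ominus>\<^bsub>R\<^esub> \<one>\<^bsub>R\<^esub>) \<odot>\<^bsub>C\<^esub> y') \<in> G" using that by (intro G_smult) auto
    then have "(\<ominus>\<^bsub>A\<^esub> x', \<ominus>\<^bsub>C\<^esub> y') \<in> G" using carr[OF that(2)] by (simp add: alg.smult_l_minus C.alg.smult_l_minus)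
    then show ?thesis unfolding a_minus_def using G_add that(1) by blast
  qed
  have uniq: "y = y'" if "(x, y) \<in> G" "(x, y') \<in> G" for x y y'
  proof -
    have "(x \<ominus>\<^bsub>A\<^esub> x, y \<ominus>\<^bsub>C\<^esub> y') \<in> G" using G_diff that by blast
    then have "y \<ominus>\<^bsub>C\<^esub> y' = \<zero>\<^bsub>C\<^esub>" using fun0 carr[OF that(1)] by (simp add: alg.M.r_neg a_minus_def)
    then show ?thesis using carr that C.alg.r_right_minus_eq by blast
  qed
  have total: "\<exists>y. (x, y) \<in> G" if "x \<in> carrier A" for x
    using that
  proof (induction rule: lift_induct)
    case zero then show ?case using G_zero by blast
  next
    case (add x y) then show ?case using G_add by blast
  next
    case (smult r j x) then show ?case using G_homog by blast
  next
    case (lift b) then show ?case using G_gen by blast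
  qed
  define g where "g x = (THE y. (x, y) \<in> G)" for x
  have g: "(x, y) \<in> G \<Longrightarrow> g x = y" for x y
    unfolding g_def by (rule the_equality) (auto intro: uniq)
  have gG: "(x, g x) \<in> G" if "x \<in> carrier A" for x using total[OF that] g by auto
  have G_comp: "(component A d x, component C d y) \<in> G" if "(x, y) \<in> G" for x y d
    using that unfolding G_def
  proof (induction rule: combinations.induct)
    case zero then show ?case by (simp add: alg.component_zero C.alg.component_zero combinations.zero)
  next
    case (step x y r j b)
    have c: "x \<in> carrier A" "y \<in> carrier C" "r \<in> carrier R" using carr step grade_R_carrier by (auto simp: G_def)
    have "(component A d (r \<odot>\<^bsub>A\<^esub> lift b), component C d (r \<odot>\<^bsub>C\<^esub> t b)) \<in> G"
      using c lift_carrier[OF step.hyps(3)] tc[OF step.hyps(3)] G_homog[OF G_gen[OF step.hyps(3)] step.hyps(2)] step.hyps(2) G_zero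
      by (simp add: alg.component_smult C.alg.component_smult alg.component_homog[OF lift(1)[OF step.hyps(3)]]
          C.alg.component_homog[OF t[OF step.hyps(3)]] G_def)
    from G_add[OF this step.IH[folded G_def]] show ?case
      using c lift_carrier[OF step.hyps(3)] tc[OF step.hyps(3)] by (simp add: alg.component_add C.alg.component_add G_def)
  qed
  show thesis
  proof (rule that[of g])
    show "g x \<in> carrier C" if "x \<in> carrier A" for x using carr gG that by blast
    show "g (x \<oplus>\<^bsub>A\<^esub> y) = g x \<oplus>\<^bsub>C\<^esub> g y" if "x \<in> carrier A" "y \<in> carrier A" for x y
      using g G_add gG that by blast
    show "g (r \<odot>\<^bsub>A\<^esub> x) = r \<odot>\<^bsub>C\<^esub> g x" if "r \<in> carrier R" "x \<in> carrier A" for r x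
      using g G_smult gG that by blast
    show "g (lift b) = t b" if "b \<in> B" for b using g G_gen that by blast
    show "g x \<in> grade C d" if x: "x \<in> grade A d" for d x
    proof -
      have xG: "(x, g x) \<in> G" using gG x alg.grade_carrier by blast
      have "(x, component C d (g x)) \<in> G" using G_comp[OF xG, of d] alg.component_homog[OF x, of d] by simp
      then have "component C d (g x) = g x" using uniq xG by blast
      then show ?thesis using C.alg.component_props(1) carr[OF xG] by metis
    qed
  qed
qed

section \<open>Comparison of two deformations\<close>

lemma (in cring) diff_eq_iff:
  assumes "a \<in> carrier R" "b \<in> carrier R" "c \<in> carrier R"
  shows "a \<ominus> b = c \<longleftrightarrow> a = c \<oplus> b"
  using assms by (metis a_minus_def a_assoc l_neg r_neg r_zero a_inv_closed)

text \<open>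
  If the products \<open>gab\<close>, \<open>gbc\<close>, \<open>gabc\<close> differ from the products of \<open>a\<close>, \<open>b\<close>, \<open>c\<close> by the errors \<open>w\<close>, then associativity is
  the cocycle condition for the errors: both sides are \<open>gabc - a b c\<close>.
\<close>

lemma (in cring) associator_identity:
  assumes c: "a \<in> carrier R" "b \<in> carrier R" "c \<in> carrier R" "w1 \<in> carrier R" "w2 \<in> carrier R" "w3 \<in> carrier R" "w4 \<in> carrier R"
    and bc: "gbc = w1 \<oplus> b \<otimes> c" and abc: "gabc = w2 \<oplus> a \<otimes> gbc"
    and ab: "gab = w3 \<oplus> a \<otimes> b" and abc': "gabc = w4 \<oplus> gab \<otimes> c"
  shows "w1 \<otimes> a \<oplus> w2 = w4 \<oplus> w3 \<otimes> c"
proof -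
  have "(w1 \<otimes> a \<oplus> w2) \<oplus> a \<otimes> b \<otimes> c = gabc"
    unfolding abc bc using c by (simp add: r_distr l_distr a_ac m_ac)
  moreover have "(w4 \<oplus> w3 \<otimes> c) \<oplus> a \<otimes> b \<otimes> c = gabc"
    unfolding abc' ab using c by (simp add: r_distr l_distr a_ac m_ac)
  ultimately show ?thesis using c by (metis a_closed m_closed add.right_cancel)
qed

text \<open>
  The comparison of products of \<open>e + u\<close> and \<open>e' + u'\<close> with \<open>u u'\<close>.  In the applications \<open>e\<close> and \<open>e'\<close>
  are small, so that the term \<open>e e'\<close> is negligible.
\<close>

lemma (in cring) square_zero_identity:
  assumes "u \<in> carrier R" "u' \<in> carrier R" "e \<in> carrier R" "e' \<in> carrier R" "w \<in> carrier R" "f \<in> carrier R"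
    and "w \<oplus> (e \<oplus> u) \<otimes> (e' \<oplus> u') = f \<oplus> u \<otimes> u'"
  shows "w \<oplus> (e' \<otimes> u \<oplus> (e \<otimes> u' \<oplus> e \<otimes> e')) = f"
proof -
  have "(w \<oplus> (e' \<otimes> u \<oplus> (e \<otimes> u' \<oplus> e \<otimes> e'))) \<oplus> u \<otimes> u' = w \<oplus> (e \<oplus> u) \<otimes> (e' \<oplus> u')"
    using assms(1-6) by (simp add: r_distr l_distr a_ac m_ac)
  then show ?thesis using assms by (metis a_closed m_closed add.right_cancel)
qed

context graded_over
begin

lemma fil_diff_trans:
  assumes "x \<ominus>\<^bsub>A\<^esub> y \<in> fil R A n" "y \<ominus>\<^bsub>A\<^esub> z \<in> fil R A n" "x \<in> carrier A" "y \<in> carrier A" "z \<in> carrier A"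
  shows "x \<ominus>\<^bsub>A\<^esub> z \<in> fil R A n"
proof -
  have "x \<ominus>\<^bsub>A\<^esub> z = (x \<ominus>\<^bsub>A\<^esub> y) \<oplus>\<^bsub>A\<^esub> (y \<ominus>\<^bsub>A\<^esub> z)"
    using assms(3-5) by (simp add: a_minus_def alg.M.a_assoc) (simp add: alg.M.a_assoc[symmetric] alg.M.l_neg)
  then show ?thesis using fil_add assms by simp
qed

lemma fil_diff_sym:
  assumes "x \<ominus>\<^bsub>A\<^esub> y \<in> fil R A n" "x \<in> carrier A" "y \<in> carrier A"
  shows "y \<ominus>\<^bsub>A\<^esub> x \<in> fil R A n"
proof -
  have "y \<ominus>\<^bsub>A\<^esub> x = \<ominus>\<^bsub>A\<^esub> (x \<ominus>\<^bsub>A\<^esub> y)"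
    using assms(2,3) by (simp add: a_minus_def alg.M.minus_add alg.M.a_comm)
  then show ?thesis using fil_minus assms by simp
qed

lemma fil_diff_mult:
  assumes "x \<ominus>\<^bsub>A\<^esub> y \<in> fil R A n" "x' \<ominus>\<^bsub>A\<^esub> y' \<in> fil R A n"
    "x \<in> carrier A" "y \<in> carrier A" "x' \<in> carrier A" "y' \<in> carrier A"
  shows "x \<otimes>\<^bsub>A\<^esub> x' \<ominus>\<^bsub>A\<^esub> y \<otimes>\<^bsub>A\<^esub> y' \<in> fil R A n"
proof (rule fil_diff_trans[of _ "y \<otimes>\<^bsub>A\<^esub> x'"])
  have "x \<otimes>\<^bsub>A\<^esub> x' \<ominus>\<^bsub>A\<^esub> y \<otimes>\<^bsub>A\<^esub> x' = (x \<ominus>\<^bsub>A\<^esub> y) \<otimes>\<^bsub>A\<^esub> x'"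
    using assms by (simp add: a_minus_def alg.l_distr alg.l_minus)
  then show "x \<otimes>\<^bsub>A\<^esub> x' \<ominus>\<^bsub>A\<^esub> y \<otimes>\<^bsub>A\<^esub> x' \<in> fil R A n" using fil_mult assms by simp
  have "y \<otimes>\<^bsub>A\<^esub> x' \<ominus>\<^bsub>A\<^esub> y \<otimes>\<^bsub>A\<^esub> y' = (x' \<ominus>\<^bsub>A\<^esub> y') \<otimes>\<^bsub>A\<^esub> y"
    using assms by (simp add: a_minus_def alg.r_distr alg.r_minus alg.m_comm[of _ y])
  then show "y \<otimes>\<^bsub>A\<^esub> x' \<ominus>\<^bsub>A\<^esub> y \<otimes>\<^bsub>A\<^esub> y' \<in> fil R A n" using fil_mult assms by simp
qed (use assms in auto)

lemma fil_diff_eq: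
  assumes "x \<in> carrier A" "y \<in> carrier A" "\<And>n. x \<ominus>\<^bsub>A\<^esub> y \<in> fil R A n" shows "x = y"
  using fil_Inter[of "x \<ominus>\<^bsub>A\<^esub> y"] assms alg.r_right_minus_eq by simp

lemma diff_self: "x \<in> carrier A \<Longrightarrow> x \<ominus>\<^bsub>A\<^esub> x = \<zero>\<^bsub>A\<^esub>"
  by (simp add: a_minus_def alg.M.r_neg)

lemma diff_add:
  "x \<in> carrier A \<Longrightarrow> x' \<in> carrier A \<Longrightarrow> y \<in> carrier A \<Longrightarrow> y' \<in> carrier A \<Longrightarrow>
    (x \<oplus>\<^bsub>A\<^esub> x') \<ominus>\<^bsub>A\<^esub> (y \<oplus>\<^bsub>A\<^esub> y') = (x \<ominus>\<^bsub>A\<^esub> y) \<oplus>\<^bsub>A\<^esub> (x' \<ominus>\<^bsub>A\<^esub> y')"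
  by (simp add: a_minus_def alg.M.minus_add alg.M.a_ac)

lemma diff_smult:
  "r \<in> carrier R \<Longrightarrow> x \<in> carrier A \<Longrightarrow> y \<in> carrier A \<Longrightarrow>
    r \<odot>\<^bsub>A\<^esub> x \<ominus>\<^bsub>A\<^esub> r \<odot>\<^bsub>A\<^esub> y = r \<odot>\<^bsub>A\<^esub> (x \<ominus>\<^bsub>A\<^esub> y)"
  by (simp add: a_minus_def alg.smult_r_distr alg.smult_r_minus)

lemma diff_closed: "x \<in> carrier A \<Longrightarrow> y \<in> carrier A \<Longrightarrow> x \<ominus>\<^bsub>A\<^esub> y \<in> carrier A"
  by (simp add: a_minus_def)

lemma diff_add_cancel: "x \<in> carrier A \<Longrightarrow> y \<in> carrier A \<Longrightarrow> (x \<ominus>\<^bsub>A\<^esub> y) \<oplus>\<^bsub>A\<^esub> y = x"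
  by (simp add: a_minus_def alg.M.a_assoc alg.M.l_neg)

lemma grade_diff: "x \<in> grade A d \<Longrightarrow> y \<in> grade A d \<Longrightarrow> x \<ominus>\<^bsub>A\<^esub> y \<in> grade A d"
  by (simp add: a_minus_def alg.grade_add alg.grade_minus)

end

definition graded_linear :: "('k, 'r) gr_alg \<Rightarrow> ('r, 'a) gr_alg \<Rightarrow> ('r, 'c) gr_alg \<Rightarrow> ('a \<Rightarrow> 'c) \<Rightarrow> bool" where
  "graded_linear R A C g \<longleftrightarrow> (\<forall>x\<in>carrier A. g x \<in> carrier C) \<and>
     (\<forall>x\<in>carrier A. \<forall>y\<in>carrier A. g (x \<oplus>\<^bsub>A\<^esub> y) = g x \<oplus>\<^bsub>C\<^esub> g y) \<and>
     (\<forall>r\<in>carrier R. \<forall>x\<in>carrier A. g (r \<odot>\<^bsub>A\<^esub> x) = r \<odot>\<^bsub>C\<^esub> g x) \<and>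
     (\<forall>d. \<forall>x\<in>grade A d. g x \<in> grade C d)"

lemma graded_linearD:
  assumes "graded_linear R A C g"
  shows "x \<in> carrier A \<Longrightarrow> g x \<in> carrier C"
    "x \<in> carrier A \<Longrightarrow> y \<in> carrier A \<Longrightarrow> g (x \<oplus>\<^bsub>A\<^esub> y) = g x \<oplus>\<^bsub>C\<^esub> g y"
    "r \<in> carrier R \<Longrightarrow> x \<in> carrier A \<Longrightarrow> g (r \<odot>\<^bsub>A\<^esub> x) = r \<odot>\<^bsub>C\<^esub> g x"
    "x \<in> grade A d \<Longrightarrow> g x \<in> grade C d"
  using assms by (auto simp: graded_linear_def)

locale two_deformations =
  PQ: finite_SL2_pair G1 G2 +
  A1: based_fibred R A1 \<pi>1 "finite_SL2_pair.P G1" Bs dg +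
  A2: based_fibred R A2 \<pi>2 "finite_SL2_pair.P G1" Bs dg +
  BB: fibred R BB \<pi>B "finite_SL2_pair.Q G2"
  for G1 G2 :: "(complex^2^2) set" and R :: "(complex, 'r) gr_alg"
    and A1 :: "('r, 'a) gr_alg" and \<pi>1 and A2 :: "('r, 'c) gr_alg" and \<pi>2
    and BB :: "('r, 'b) gr_alg" and \<pi>B and Bs dg +
  fixes F1 :: "'b \<Rightarrow> 'a" and F2 :: "'b \<Rightarrow> 'c"
  assumes F1_lin: "graded_linear R BB A1 F1" and F2_lin: "graded_linear R BB A2 F2"
    and F1_mult: "\<And>x y. x \<in> carrier BB \<Longrightarrow> y \<in> carrier BB \<Longrightarrow> F1 (x \<otimes>\<^bsub>BB\<^esub> y) = F1 x \<otimes>\<^bsub>A1\<^esub> F1 y"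
    and F2_mult: "\<And>x y. x \<in> carrier BB \<Longrightarrow> y \<in> carrier BB \<Longrightarrow> F2 (x \<otimes>\<^bsub>BB\<^esub> y) = F2 x \<otimes>\<^bsub>A2\<^esub> F2 y"
    and F1_\<pi>: "\<And>x. x \<in> carrier BB \<Longrightarrow> \<pi>1 (F1 x) = \<pi>B x"
    and F2_\<pi>: "\<And>x. x \<in> carrier BB \<Longrightarrow> \<pi>2 (F2 x) = \<pi>B x"
begin

text \<open>
  Isomorphisms of deformations under \<open>B\<close>, up to errors in \<open>R\<^bsub>\<ge>n\<^esub> A\<^sub>2\<close>.
\<close>

definition approx :: "nat \<Rightarrow> ('a \<Rightarrow> 'c) \<Rightarrow> bool" where
  "approx n g \<longleftrightarrow> graded_linear R A1 A2 g \<and> (\<forall>x\<in>carrier A1. \<pi>2 (g x) = \<pi>1 x) \<and>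
     (\<forall>x\<in>carrier A1. \<forall>y\<in>carrier A1. g (x \<otimes>\<^bsub>A1\<^esub> y) \<ominus>\<^bsub>A2\<^esub> g x \<otimes>\<^bsub>A2\<^esub> g y \<in> fil R A2 n) \<and>
     (\<forall>x\<in>carrier BB. g (F1 x) \<ominus>\<^bsub>A2\<^esub> F2 x \<in> fil R A2 n)"

lemma extension:
  assumes "\<And>b. b \<in> Bs \<Longrightarrow> t b \<in> grade A2 (dg b)"
  obtains g where "graded_linear R A1 A2 g" "\<And>b. b \<in> Bs \<Longrightarrow> g (A1.lift b) = t b"
proof -
  obtain g where "\<And>x. x \<in> carrier A1 \<Longrightarrow> g x \<in> carrier A2"
    "\<And>x y. x \<in> carrier A1 \<Longrightarrow> y \<in> carrier A1 \<Longrightarrow> g (x \<oplus>\<^bsub>A1\<^esub> y) = g x \<oplus>\<^bsub>A2\<^esub> g y"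
    "\<And>r x. r \<in> carrier R \<Longrightarrow> x \<in> carrier A1 \<Longrightarrow> g (r \<odot>\<^bsub>A1\<^esub> x) = r \<odot>\<^bsub>A2\<^esub> g x"
    "\<And>d x. x \<in> grade A1 d \<Longrightarrow> g x \<in> grade A2 d"
    "\<And>b. b \<in> Bs \<Longrightarrow> g (A1.lift b) = t b"
    using A1.free_extension[OF A2.graded_over_axioms assms] by blast
  then show thesis by (intro that[of g]) (auto simp: graded_linear_def)
qed

lemma graded_linear_zero:
  assumes "graded_linear R A1 A2 g" shows "g \<zero>\<^bsub>A1\<^esub> = \<zero>\<^bsub>A2\<^esub>"
  using graded_linearD(3)[OF assms, of "\<zero>\<^bsub>R\<^esub>" "\<zero>\<^bsub>A1\<^esub>"] graded_linearD(1)[OF assms, of "\<zero>\<^bsub>A1\<^esub>"] by simp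

lemma approx_start: "\<exists>g. approx 1 g"
proof -
  obtain g where g: "graded_linear R A1 A2 g" "\<And>b. b \<in> Bs \<Longrightarrow> g (A1.lift b) = A2.lift b"
    using extension[OF A2.lift(1)] by blast
  note gl = graded_linearD[OF g(1)]
  have \<pi>: "\<pi>2 (g x) = \<pi>1 x" if "x \<in> carrier A1" for x
    using that
  proof (induction rule: A1.lift_induct)
    case zero then show ?case by (simp add: graded_linear_zero[OF g(1)] A1.\<pi>_zero A2.\<pi>_zero)
  next
    case (add x y) then show ?case by (simp add: gl A1.\<pi>_add A2.\<pi>_add)
  next
    case (smult r j x)
    have r: "r \<in> carrier R" using smult A1.grade_R_carrier by blast
    show ?case
    proof (cases "j = 0")
      case True
      then obtain c where "r = A1.scalar c" using smult A1.scalar_surj by blast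
      then show ?thesis using smult r by (simp add: gl A1.\<pi>_scalar A2.\<pi>_scalar)
    next
      case False
      then show ?thesis using smult r by (simp add: gl A1.\<pi>_pos[of r j] A2.\<pi>_pos[of r j])
    qed
  next
    case (lift b) then show ?case by (simp add: g A1.lift A2.lift)
  qed
  have "approx 1 g"
    unfolding approx_def
  proof (intro conjI ballI g(1) \<pi>)
    show "g (x \<otimes>\<^bsub>A1\<^esub> y) \<ominus>\<^bsub>A2\<^esub> g x \<otimes>\<^bsub>A2\<^esub> g y \<in> fil R A2 1" if "x \<in> carrier A1" "y \<in> carrier A1" for x y
      using that by (intro A2.\<pi>_ker A2.diff_closed) (auto simp: gl A2.\<pi>_diff A2.\<pi>_mult A1.\<pi>_mult \<pi>)
    show "g (F1 x) \<ominus>\<^bsub>A2\<^esub> F2 x \<in> fil R A2 1" if "x \<in> carrier BB" for x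
      using that graded_linearD(1)[OF F1_lin] graded_linearD(1)[OF F2_lin]
      by (intro A2.\<pi>_ker A2.diff_closed) (auto simp: gl A2.\<pi>_diff \<pi> F1_\<pi> F2_\<pi>)
  qed
  then show ?thesis by blast
qed

context
  fixes n g
  assumes n: "0 < n" and approx: "approx n g"
begin

lemma g_lin: "graded_linear R A1 A2 g"
  and g_\<pi>: "x \<in> carrier A1 \<Longrightarrow> \<pi>2 (g x) = \<pi>1 x"
  and g_mult_fil: "x \<in> carrier A1 \<Longrightarrow> y \<in> carrier A1 \<Longrightarrow> g (x \<otimes>\<^bsub>A1\<^esub> y) \<ominus>\<^bsub>A2\<^esub> g x \<otimes>\<^bsub>A2\<^esub> g y \<in> fil R A2 n"
  and g_F_fil: "b \<in> carrier BB \<Longrightarrow> g (F1 b) \<ominus>\<^bsub>A2\<^esub> F2 b \<in> fil R A2 n"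
  using approx by (auto simp: approx_def)

lemmas gl = graded_linearD[OF g_lin]
lemmas Fl1 = graded_linearD[OF F1_lin] and Fl2 = graded_linearD[OF F2_lin]

text \<open>
  The two errors of an approximate isomorphism \<open>g\<close>: \<open>w\<close> measures how far \<open>g\<close> is from being
  multiplicative, \<open>D\<close> how far it is from being compatible with \<open>F1\<close> and \<open>F2\<close>.
\<close>

definition w where "w x y = g (x \<otimes>\<^bsub>A1\<^esub> y) \<ominus>\<^bsub>A2\<^esub> g x \<otimes>\<^bsub>A2\<^esub> g y"
definition D where "D b = g (F1 b) \<ominus>\<^bsub>A2\<^esub> F2 b"

lemma w_fil: "x \<in> carrier A1 \<Longrightarrow> y \<in> carrier A1 \<Longrightarrow> w x y \<in> fil R A2 n"
  unfolding w_def by (rule g_mult_fil)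
lemma w_carrier: "x \<in> carrier A1 \<Longrightarrow> y \<in> carrier A1 \<Longrightarrow> w x y \<in> carrier A2"
  using w_fil A2.fil_carrier by blast
lemma D_fil: "b \<in> carrier BB \<Longrightarrow> D b \<in> fil R A2 n"
  unfolding D_def by (rule g_F_fil)
lemma D_carrier: "b \<in> carrier BB \<Longrightarrow> D b \<in> carrier A2"
  using D_fil A2.fil_carrier by blast

lemma w_eq: "x \<in> carrier A1 \<Longrightarrow> y \<in> carrier A1 \<Longrightarrow> g (x \<otimes>\<^bsub>A1\<^esub> y) = w x y \<oplus>\<^bsub>A2\<^esub> g x \<otimes>\<^bsub>A2\<^esub> g y"
  unfolding w_def by (simp add: A2.diff_add_cancel gl)
lemma D_eq: "b \<in> carrier BB \<Longrightarrow> g (F1 b) = D b \<oplus>\<^bsub>A2\<^esub> F2 b"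
  unfolding D_def by (simp add: A2.diff_add_cancel gl Fl1 Fl2)

lemma w_sym: "x \<in> carrier A1 \<Longrightarrow> y \<in> carrier A1 \<Longrightarrow> w x y = w y x"
  unfolding w_def by (simp add: A1.alg.m_comm A2.alg.m_comm gl)

lemma w_add: "x \<in> carrier A1 \<Longrightarrow> y \<in> carrier A1 \<Longrightarrow> z \<in> carrier A1 \<Longrightarrow> w (x \<oplus>\<^bsub>A1\<^esub> y) z = w x z \<oplus>\<^bsub>A2\<^esub> w y z"
  unfolding w_def by (simp add: A1.alg.l_distr A2.alg.l_distr gl A2.diff_add)

lemma w_smult: "r \<in> carrier R \<Longrightarrow> x \<in> carrier A1 \<Longrightarrow> y \<in> carrier A1 \<Longrightarrow> w (r \<odot>\<^bsub>A1\<^esub> x) y = r \<odot>\<^bsub>A2\<^esub> w x y"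
  unfolding w_def by (simp add: A1.alg.smult_assoc2 A2.alg.smult_assoc2 gl A2.diff_smult)

lemma D_add: "x \<in> carrier BB \<Longrightarrow> y \<in> carrier BB \<Longrightarrow> D (x \<oplus>\<^bsub>BB\<^esub> y) = D x \<oplus>\<^bsub>A2\<^esub> D y"
  unfolding D_def by (simp add: gl Fl1 Fl2 A2.diff_add)

lemma D_smult: "r \<in> carrier R \<Longrightarrow> x \<in> carrier BB \<Longrightarrow> D (r \<odot>\<^bsub>BB\<^esub> x) = r \<odot>\<^bsub>A2\<^esub> D x"
  unfolding D_def by (simp add: gl Fl1 Fl2 A2.diff_smult)

text \<open>
  Associativity of \<open>A\<^sub>1\<close> makes \<open>w\<close> a Hochschild cocycle.
\<close>

lemma w_assoc:
  assumes "x \<in> carrier A1" "y \<in> carrier A1" "z \<in> carrier A1"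
  shows "w y z \<otimes>\<^bsub>A2\<^esub> g x \<oplus>\<^bsub>A2\<^esub> w x (y \<otimes>\<^bsub>A1\<^esub> z) = w (x \<otimes>\<^bsub>A1\<^esub> y) z \<oplus>\<^bsub>A2\<^esub> w x y \<otimes>\<^bsub>A2\<^esub> g z"
proof (rule A2.alg.associator_identity)
  show "g (y \<otimes>\<^bsub>A1\<^esub> z) = w y z \<oplus>\<^bsub>A2\<^esub> g y \<otimes>\<^bsub>A2\<^esub> g z" using assms by (intro w_eq)
  show "g (x \<otimes>\<^bsub>A1\<^esub> (y \<otimes>\<^bsub>A1\<^esub> z)) = w x (y \<otimes>\<^bsub>A1\<^esub> z) \<oplus>\<^bsub>A2\<^esub> g x \<otimes>\<^bsub>A2\<^esub> g (y \<otimes>\<^bsub>A1\<^esub> z)" using assms by (intro w_eq) auto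
  show "g (x \<otimes>\<^bsub>A1\<^esub> y) = w x y \<oplus>\<^bsub>A2\<^esub> g x \<otimes>\<^bsub>A2\<^esub> g y" using assms by (intro w_eq)
  show "g (x \<otimes>\<^bsub>A1\<^esub> (y \<otimes>\<^bsub>A1\<^esub> z)) = w (x \<otimes>\<^bsub>A1\<^esub> y) z \<oplus>\<^bsub>A2\<^esub> g (x \<otimes>\<^bsub>A1\<^esub> y) \<otimes>\<^bsub>A2\<^esub> g z"
    using assms w_eq[of "x \<otimes>\<^bsub>A1\<^esub> y" z] by (simp add: A1.alg.m_assoc)
qed (use assms in \<open>auto simp: gl w_carrier\<close>)

text \<open>
  Multiplicativity of \<open>F1\<close> and \<open>F2\<close> makes \<open>w\<close> the coboundary of \<open>D\<close> on \<open>B\<close>, up to the product of two errors.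
\<close>

lemma w_D:
  assumes "b \<in> carrier BB" "b' \<in> carrier BB"
  shows "w (F1 b) (F1 b') \<oplus>\<^bsub>A2\<^esub> (D b' \<otimes>\<^bsub>A2\<^esub> F2 b \<oplus>\<^bsub>A2\<^esub> (D b \<otimes>\<^bsub>A2\<^esub> F2 b' \<oplus>\<^bsub>A2\<^esub> D b \<otimes>\<^bsub>A2\<^esub> D b')) = D (b \<otimes>\<^bsub>BB\<^esub> b')"
proof (rule A2.alg.square_zero_identity)
  show "w (F1 b) (F1 b') \<oplus>\<^bsub>A2\<^esub> (D b \<oplus>\<^bsub>A2\<^esub> F2 b) \<otimes>\<^bsub>A2\<^esub> (D b' \<oplus>\<^bsub>A2\<^esub> F2 b') = D (b \<otimes>\<^bsub>BB\<^esub> b') \<oplus>\<^bsub>A2\<^esub> F2 b \<otimes>\<^bsub>A2\<^esub> F2 b'"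
    using assms w_eq[of "F1 b" "F1 b'"] D_eq[of "b \<otimes>\<^bsub>BB\<^esub> b'"] D_eq[of b] D_eq[of b']
    by (simp add: Fl1 F1_mult F2_mult)
qed (use assms in \<open>auto simp: Fl1 Fl2 w_carrier D_carrier\<close>)

context
  fixes i
  assumes i: "i < A1.fdim n"
begin

abbreviation "\<sigma> \<equiv> A2.symbol n i"

text \<open>
  \<open>w\<close> is \<open>R\<close>-bilinear with values in \<open>R\<^bsub>\<ge>n\<^esub> A\<^sub>2\<close>, so its values on \<open>R\<^bsub>>0\<^esub> A\<^sub>1\<close> have vanishing symbols of order \<open>n\<close>.
\<close>

lemma w_symbol_zero:
  assumes x: "x \<in> fil R A1 1" and y: "y \<in> carrier A1" shows "\<sigma> (w x y) = 0"
  using x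
proof (induction rule: fil.induct)
  case zero
  have "w \<zero>\<^bsub>A1\<^esub> y = \<zero>\<^bsub>A2\<^esub>"
    using w_smult[of "\<zero>\<^bsub>R\<^esub>" y y] y w_carrier[OF y y] by simp
  then show ?case by (simp add: A2.symbol_zero[OF i])
next
  case (step x j r a)
  have c: "x \<in> carrier A1" "r \<in> carrier R" using step A1.fil_carrier A1.grade_R_carrier by auto
  have "r \<odot>\<^bsub>A2\<^esub> w a y \<in> fil R A2 n"
    using A2.fil_smult_homog[OF step(3) w_fil[OF step(4) y]] A2.fil_antimono[of _ "j + n" n] by simp
  then show ?case
    using step c y A2.symbol_smult_pos[OF i _ step(3) w_fil[OF step(4) y]]
    by (simp add: w_add w_smult A2.symbol_add[OF i] w_fil)
qed

lemma w_symbol_cong: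
  assumes "x \<in> carrier A1" "x' \<in> carrier A1" "y \<in> carrier A1" "y' \<in> carrier A1" "\<pi>1 x = \<pi>1 x'" "\<pi>1 y = \<pi>1 y'"
  shows "\<sigma> (w x y) = \<sigma> (w x' y')"
proof -
  have *: "\<sigma> (w x y) = \<sigma> (w x' y)" if "x \<in> carrier A1" "x' \<in> carrier A1" "y \<in> carrier A1" "\<pi>1 x = \<pi>1 x'" for x x' y
  proof -
    have "x \<ominus>\<^bsub>A1\<^esub> x' \<in> fil R A1 1" using that by (intro A1.\<pi>_ker) (auto simp: A1.\<pi>_diff A1.diff_closed)
    then have "\<sigma> (w (x \<ominus>\<^bsub>A1\<^esub> x') y) = 0" using that by (intro w_symbol_zero)
    moreover have "w x y = w (x \<ominus>\<^bsub>A1\<^esub> x') y \<oplus>\<^bsub>A2\<^esub> w x' y"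
      using w_add[of "x \<ominus>\<^bsub>A1\<^esub> x'" x' y] that by (simp add: A1.diff_closed A1.diff_add_cancel)
    ultimately show ?thesis using that by (simp add: A2.symbol_add[OF i] w_fil A1.diff_closed)
  qed
  show ?thesis using *[of x x' y] *[of y y' x'] w_sym[of x' y] w_sym[of x' y'] assms by simp
qed

lemma D_symbol_cong:
  assumes "b \<in> carrier BB" "b' \<in> carrier BB" "\<pi>B b = \<pi>B b'"
  shows "\<sigma> (D b) = \<sigma> (D b')"
proof -
  have "\<sigma> (D x) = 0" if "x \<in> fil R BB 1" for x
    using that
  proof (induction rule: fil.induct)
    case zero
    have "D \<zero>\<^bsub>BB\<^esub> = \<zero>\<^bsub>A2\<^esub>" using D_smult[of "\<zero>\<^bsub>R\<^esub>" b] assms(1) D_carrier[OF assms(1)] by simp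
    then show ?case by (simp add: A2.symbol_zero[OF i])
  next
    case (step x j r a)
    have c: "x \<in> carrier BB" "r \<in> carrier R" using step BB.fil_carrier BB.grade_R_carrier by auto
    have "r \<odot>\<^bsub>A2\<^esub> D a \<in> fil R A2 n"
      using A2.fil_smult_homog[OF step(3) D_fil[OF step(4)]] A2.fil_antimono[of _ "j + n" n] by simp
    then show ?case
      using step c A2.symbol_smult_pos[OF i _ step(3) D_fil[OF step(4)]]
      by (simp add: D_add D_smult A2.symbol_add[OF i] D_fil)
  qed
  moreover have "b \<ominus>\<^bsub>BB\<^esub> b' \<in> fil R BB 1" using assms by (intro BB.\<pi>_ker) (auto simp: BB.\<pi>_diff BB.diff_closed)
  ultimately have "\<sigma> (D (b \<ominus>\<^bsub>BB\<^esub> b')) = 0" by blast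
  moreover have "D b = D (b \<ominus>\<^bsub>BB\<^esub> b') \<oplus>\<^bsub>A2\<^esub> D b'"
    using D_add[of "b \<ominus>\<^bsub>BB\<^esub> b'" b'] assms by (simp add: BB.diff_closed BB.diff_add_cancel)
  ultimately show ?thesis using assms by (simp add: A2.symbol_add[OF i] D_fil BB.diff_closed)
qed

text \<open>
  The symbols of \<open>w\<close> and \<open>D\<close> depend only on the residues in \<open>P\<close> and \<open>Q\<close> of the arguments.  The resulting
  maps \<open>c\<close> and \<open>\<beta>\<close> satisfy the hypotheses of \<open>homogeneous_cocycle_trivial\<close>.
\<close>

lemma correction_exists:
  "\<exists>h. PQ.PQ.additive h \<and> (\<forall>p\<in>PQ.P. h p \<in> PQ.P) \<and>
    (\<forall>b\<in>carrier BB. h (\<pi>B b) = \<sigma> (D b)) \<and>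
    (\<forall>x\<in>carrier A1. \<forall>y\<in>carrier A1. defect h (\<pi>1 x) (\<pi>1 y) = \<sigma> (w x y)) \<and>
    (\<forall>k. \<forall>p\<in>PQ.P. h (const2 k * p) = const2 k * h p) \<and>
    (\<forall>d. \<forall>p\<in>PQ.P. homog d p \<longrightarrow> shifted n d (h p))"
proof -
  define s where "s p = (SOME x. x \<in> carrier A1 \<and> \<pi>1 x = p)" for p
  have s: "s p \<in> carrier A1" "\<pi>1 (s p) = p" if "p \<in> PQ.P" for p
    using someI_ex[of "\<lambda>x. x \<in> carrier A1 \<and> \<pi>1 x = p"] A1.\<pi>_surj[OF that] by (auto simp: s_def)
  define sB where "sB p = (SOME x. x \<in> carrier BB \<and> \<pi>B x = p)" for p
  have sB: "sB p \<in> carrier BB" "\<pi>B (sB p) = p" if "p \<in> PQ.Q" for p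
    using someI_ex[of "\<lambda>x. x \<in> carrier BB \<and> \<pi>B x = p"] BB.\<pi>_surj[OF that] by (auto simp: sB_def)
  define c where "c p q = \<sigma> (w (s p) (s q))" for p q
  define \<beta> where "\<beta> q = \<sigma> (D (sB q))" for q
  have c: "c (\<pi>1 x) (\<pi>1 y) = \<sigma> (w x y)" if "x \<in> carrier A1" "y \<in> carrier A1" for x y
    unfolding c_def using that s A1.\<pi>_P by (intro w_symbol_cong) auto
  have \<beta>: "\<beta> (\<pi>B b) = \<sigma> (D b)" if "b \<in> carrier BB" for b
    unfolding \<beta>_def using that sB BB.\<pi>_P by (intro D_symbol_cong) auto
  have liftP: "\<exists>x\<in>carrier A1. p = \<pi>1 x" if "p \<in> PQ.P" for p using A1.\<pi>_surj[OF that] by blast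
  have liftQ: "\<exists>b\<in>carrier BB. q = \<pi>B b" if "q \<in> PQ.Q" for q using BB.\<pi>_surj[OF that] by blast
  have liftP2: "\<exists>x y. x \<in> carrier A1 \<and> y \<in> carrier A1 \<and> p = \<pi>1 x \<and> q = \<pi>1 y" if "p \<in> PQ.P" "q \<in> PQ.P" for p q
    using liftP[OF that(1)] liftP[OF that(2)] by blast
  have liftQ2: "\<exists>x y. x \<in> carrier BB \<and> y \<in> carrier BB \<and> p = \<pi>B x \<and> q = \<pi>B y" if "p \<in> PQ.Q" "q \<in> PQ.Q" for p q
    using liftQ[OF that(1)] liftQ[OF that(2)] by blast
  note sa = A2.symbol_add[OF i] and sm = A2.symbol_mult[OF i]
  have coc: "PQ.PQ.cocycle c"
    unfolding PQ.PQ.cocycle_def PQ.PQ.additive_def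
  proof (intro conjI ballI)
    fix p q assume "p \<in> PQ.P" "q \<in> PQ.P"
    then obtain x y where xy: "x \<in> carrier A1" "y \<in> carrier A1" "p = \<pi>1 x" "q = \<pi>1 y" using liftP2 by blast
    show "c p q \<in> PQ.P" unfolding xy(3,4) c[OF xy(1,2)] using xy w_fil by (intro A2.symbol_P[OF i])
    show "c p q = c q p" unfolding xy(3,4) c[OF xy(1,2)] c[OF xy(2,1)] using w_sym xy by simp
  next
    fix p q r assume "p \<in> PQ.P" "q \<in> PQ.P" "r \<in> PQ.P"
    then obtain x y z where xy: "x \<in> carrier A1" "y \<in> carrier A1" "z \<in> carrier A1"
      "p = \<pi>1 x" "q = \<pi>1 y" "r = \<pi>1 z" using liftP by metis
    have "c p (q + r) = \<sigma> (w x (y \<oplus>\<^bsub>A1\<^esub> z))"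
      unfolding xy(4-6) A1.\<pi>_add[OF xy(2,3), symmetric] using xy by (intro c) auto
    also have "w x (y \<oplus>\<^bsub>A1\<^esub> z) = w x y \<oplus>\<^bsub>A2\<^esub> w x z"
      using w_sym[of x "y \<oplus>\<^bsub>A1\<^esub> z"] w_add[of y z x] w_sym[of x y] w_sym[of x z] xy by simp
    also have "\<sigma> \<dots> = c p q + c p r" unfolding xy(4-6) using xy by (simp add: sa w_fil c)
    finally show "c p (q + r) = c p q + c p r" .
    have "c (p * q) r = \<sigma> (w (x \<otimes>\<^bsub>A1\<^esub> y) z)"
      unfolding xy(4-6) A1.\<pi>_mult[OF xy(1,2), symmetric] using xy by (intro c) auto
    moreover have "c p (q * r) = \<sigma> (w x (y \<otimes>\<^bsub>A1\<^esub> z))"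
      unfolding xy(4-6) A1.\<pi>_mult[OF xy(2,3), symmetric] using xy by (intro c) auto
    moreover have "c q r * p + \<sigma> (w x (y \<otimes>\<^bsub>A1\<^esub> z)) = \<sigma> (w (x \<otimes>\<^bsub>A1\<^esub> y) z) + c p q * r"
      using arg_cong[OF w_assoc[OF xy(1-3)], of \<sigma>] xy(1-3) unfolding xy(4-6)
      by (simp add: sa sm w_fil A2.fil_mult gl g_\<pi> c)
    ultimately show "p * c q r - c (p * q) r + c p (q * r) - c p q * r = 0"
      by (simp add: algebra_simps)
  qed
  have c_lin: "c (const2 k * p) q = const2 k * c p q" if pq: "p \<in> PQ.P" "q \<in> PQ.P" for k p q
  proof -
    obtain x y where xy: "x \<in> carrier A1" "y \<in> carrier A1" "p = \<pi>1 x" "q = \<pi>1 y" using liftP2[OF pq] by blast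
    have "c (const2 k * p) q = \<sigma> (w (A1.scalar k \<odot>\<^bsub>A1\<^esub> x) y)"
      unfolding xy(3,4) A1.\<pi>_scalar[OF xy(1), symmetric] using xy A1.scalar_carrier by (intro c) auto
    also have "\<dots> = const2 k * \<sigma> (w x y)"
      by (simp only: w_smult[OF A1.scalar_carrier xy(1,2)] A2.symbol_scalar[OF i w_fil[OF xy(1,2)]])
    finally show ?thesis unfolding xy(3,4) using c xy by simp
  qed
  have \<beta>_P: "\<beta> q \<in> PQ.P" if "q \<in> PQ.Q" for q
    unfolding \<beta>_def using sB[OF that] D_fil by (intro A2.symbol_P[OF i]) auto
  have \<beta>_add: "\<beta> (q + q') = \<beta> q + \<beta> q'" if pq: "q \<in> PQ.Q" "q' \<in> PQ.Q" for q q'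
  proof -
    obtain x y where xy: "x \<in> carrier BB" "y \<in> carrier BB" "q = \<pi>B x" "q' = \<pi>B y" using liftQ2[OF pq] by blast
    have "\<beta> (q + q') = \<sigma> (D (x \<oplus>\<^bsub>BB\<^esub> y))"
      unfolding xy(3,4) BB.\<pi>_add[OF xy(1,2), symmetric] using xy by (intro \<beta>) auto
    then show ?thesis unfolding xy(3,4) using xy by (simp add: D_add sa D_fil \<beta>)
  qed
  have \<beta>_lin: "\<beta> (const2 k * q) = const2 k * \<beta> q" if pq: "q \<in> PQ.Q" for k q
  proof -
    obtain x where xy: "x \<in> carrier BB" "q = \<pi>B x" using liftQ[OF pq] by blast
    have "\<beta> (const2 k * q) = \<sigma> (D (A1.scalar k \<odot>\<^bsub>BB\<^esub> x))"
      unfolding xy(2) BB.\<pi>_scalar[OF xy(1), symmetric] using xy A1.scalar_carrier by (intro \<beta>) auto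
    also have "\<dots> = const2 k * \<sigma> (D x)"
      by (simp only: D_smult[OF A1.scalar_carrier xy(1)] A2.symbol_scalar[OF i D_fil[OF xy(1)]])
    finally show ?thesis unfolding xy(2) using \<beta> xy by simp
  qed
  have c\<beta>: "c q q' = defect \<beta> q q'" if pq: "q \<in> PQ.Q" "q' \<in> PQ.Q" for q q'
  proof -
    obtain x y where xy: "x \<in> carrier BB" "y \<in> carrier BB" "q = \<pi>B x" "q' = \<pi>B y" using liftQ2[OF pq] by blast
    have f: "D x \<otimes>\<^bsub>A2\<^esub> D y \<in> fil R A2 (n + n)" using xy D_fil by (intro A2.fil_mult_fil)
    then have "D x \<otimes>\<^bsub>A2\<^esub> D y \<in> fil R A2 (Suc n)" using n by (elim A2.fil_antimono) simp
    then have z: "\<sigma> (D x \<otimes>\<^bsub>A2\<^esub> D y) = 0" by (rule A2.symbol_high[OF i])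
    have f': "D x \<otimes>\<^bsub>A2\<^esub> D y \<in> fil R A2 n" using f by (elim A2.fil_antimono) simp
    have "c q q' = \<sigma> (w (F1 x) (F1 y))"
      unfolding xy(3,4) using c[of "F1 x" "F1 y"] xy by (simp add: Fl1 F1_\<pi>)
    moreover have "\<beta> (q * q') = \<sigma> (D (x \<otimes>\<^bsub>BB\<^esub> y))"
      unfolding xy(3,4) BB.\<pi>_mult[OF xy(1,2), symmetric] using xy by (intro \<beta>) auto
    moreover have "\<sigma> (w (F1 x) (F1 y)) + (\<beta> q' * q + \<beta> q * q') = \<sigma> (D (x \<otimes>\<^bsub>BB\<^esub> y))"
      using arg_cong[OF w_D[OF xy(1,2)], of \<sigma>] xy(1,2) z f' unfolding xy(3,4)
      by (simp add: sa sm w_fil D_fil A2.fil_mult A2.fil_add Fl1 Fl2 F2_\<pi> \<beta>)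
    ultimately show ?thesis by (simp add: defect_def algebra_simps)
  qed
  have c_deg: "shifted n (d + e) (c p q)" if pq: "p \<in> PQ.P" "q \<in> PQ.P" "homog d p" "homog e q" for d e p q
  proof -
    obtain x where x: "x \<in> grade A1 d" "\<pi>1 x = p" using A1.\<pi>_surj_grade[OF pq(1,3)] by blast
    obtain y where y: "y \<in> grade A1 e" "\<pi>1 y = q" using A1.\<pi>_surj_grade[OF pq(2,4)] by blast
    note xyc = A1.alg.grade_carrier[OF x(1)] A1.alg.grade_carrier[OF y(1)]
    have "w x y \<in> grade A2 (d + e)"
      unfolding w_def using x y by (intro A2.grade_diff gl(4) A1.alg.grade_mult A2.alg.grade_mult)
    then have "component A2 (d + e) (w x y) = w x y" using A2.alg.component_homog by fastforce
    then show ?thesis using A2.symbol_component[OF i w_fil[OF xyc], of "d + e"] c[OF xyc] x y by simp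
  qed
  have \<beta>_deg: "shifted n d (\<beta> q)" if pq: "q \<in> PQ.Q" "homog d q" for d q
  proof -
    obtain x where x: "x \<in> grade BB d" "\<pi>B x = q" using BB.\<pi>_surj_grade[OF pq] by blast
    note xc = BB.alg.grade_carrier[OF x(1)]
    have "D x \<in> grade A2 d"
      unfolding D_def using x by (intro A2.grade_diff gl(4) Fl1(4) Fl2(4))
    then have "component A2 d (D x) = D x" using A2.alg.component_homog by fastforce
    then show ?thesis using A2.symbol_component[OF i D_fil[OF xc], of d] \<beta>[OF xc] x by simp
  qed
  obtain h where h: "PQ.PQ.additive h" "\<And>x. x \<in> PQ.P \<Longrightarrow> h x \<in> PQ.P" "\<And>q. q \<in> PQ.Q \<Longrightarrow> h q = \<beta> q"
    "\<And>x y. x \<in> PQ.P \<Longrightarrow> y \<in> PQ.P \<Longrightarrow> defect h x y = c x y"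
    "\<And>k x. x \<in> PQ.P \<Longrightarrow> h (const2 k * x) = const2 k * h x"
    "\<And>d x. x \<in> PQ.P \<Longrightarrow> homog d x \<Longrightarrow> shifted n d (h x)"
    using PQ.homogeneous_cocycle_trivial[OF coc c_lin \<beta>_P \<beta>_add \<beta>_lin c\<beta> A1.graded_set_P BB.graded_set_P c_deg \<beta>_deg]
    by blast
  show ?thesis
  proof (intro exI[of _ h] conjI ballI allI impI h)
    show "h (\<pi>B b) = \<sigma> (D b)" if "b \<in> carrier BB" for b
      using h(3)[OF BB.\<pi>_P[OF that]] \<beta>[OF that] by simp
    show "defect h (\<pi>1 x) (\<pi>1 y) = \<sigma> (w x y)" if "x \<in> carrier A1" "y \<in> carrier A1" for x y
      using h(4)[OF A1.\<pi>_P[OF that(1)] A1.\<pi>_P[OF that(2)]] c[OF that] by simp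
  qed auto
qed

end

text \<open>
  Subtract from \<open>g\<close> an \<open>R\<close>-linear map with values in \<open>R\<^bsub>\<ge>n\<^esub> A\<^sub>2\<close> whose symbols are the solutions \<open>h\<close>.  It is
  prescribed on the lifts of the basis only; that its symbols are given by \<open>h\<close> everywhere follows from linearity.
\<close>

lemma improve: "\<exists>g'. approx (Suc n) g' \<and> (\<forall>x\<in>carrier A1. g x \<ominus>\<^bsub>A2\<^esub> g' x \<in> fil R A2 n)"
proof -
  have "\<exists>h. \<forall>i. i < A1.fdim n \<longrightarrow> PQ.PQ.additive (h i) \<and> (\<forall>p\<in>PQ.P. h i p \<in> PQ.P) \<and>
    (\<forall>b\<in>carrier BB. h i (\<pi>B b) = A2.symbol n i (D b)) \<and>
    (\<forall>x\<in>carrier A1. \<forall>y\<in>carrier A1. defect (h i) (\<pi>1 x) (\<pi>1 y) = A2.symbol n i (w x y)) \<and>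
    (\<forall>k. \<forall>p\<in>PQ.P. h i (const2 k * p) = const2 k * h i p) \<and>
    (\<forall>d. \<forall>p\<in>PQ.P. homog d p \<longrightarrow> shifted n d (h i p))"
    using correction_exists by (intro choice allI) blast
  then obtain h where H: "\<forall>i. i < A1.fdim n \<longrightarrow> PQ.PQ.additive (h i) \<and> (\<forall>p\<in>PQ.P. h i p \<in> PQ.P) \<and>
    (\<forall>b\<in>carrier BB. h i (\<pi>B b) = A2.symbol n i (D b)) \<and>
    (\<forall>x\<in>carrier A1. \<forall>y\<in>carrier A1. defect (h i) (\<pi>1 x) (\<pi>1 y) = A2.symbol n i (w x y)) \<and>
    (\<forall>k. \<forall>p\<in>PQ.P. h i (const2 k * p) = const2 k * h i p) \<and>
    (\<forall>d. \<forall>p\<in>PQ.P. homog d p \<longrightarrow> shifted n d (h i p))"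
    by blast
  have h_add: "h i (p + q) = h i p + h i q" if "i < A1.fdim n" "p \<in> PQ.P" "q \<in> PQ.P" for i p q
    using H that PQ.PQ.additiveD by blast
  have h_P: "h i p \<in> PQ.P" if "i < A1.fdim n" "p \<in> PQ.P" for i p
    using H that by blast
  have h_D: "h i (\<pi>B b) = A2.symbol n i (D b)" if "i < A1.fdim n" "b \<in> carrier BB" for i b
    using H that by blast
  have h_w: "defect (h i) (\<pi>1 x) (\<pi>1 y) = A2.symbol n i (w x y)"
    if "i < A1.fdim n" "x \<in> carrier A1" "y \<in> carrier A1" for i x y
    using H that by blast
  have h_lin: "h i (const2 k * p) = const2 k * h i p" if "i < A1.fdim n" "p \<in> PQ.P" for i k p
    using H that by blast
  have h_deg: "shifted n d (h i p)" if "i < A1.fdim n" "p \<in> PQ.P" "homog d p" for i d p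
    using H that by blast
  have h0: "h i 0 = 0" if "i < A1.fdim n" for i
    using h_add[OF that PQ.PQ.zero_P PQ.PQ.zero_P] by simp
  have "\<exists>K. K \<in> fil R A2 n \<and> K \<in> grade A2 (dg b) \<and> (\<forall>i<A1.fdim n. A2.symbol n i K = h i b)" if b: "b \<in> Bs" for b
    using A2.symbol_realize[of n "\<lambda>i. h i b" "dg b"] h_P h_deg A1.B_P[OF b] A1.B_homog[OF b] by metis
  then obtain K where K: "\<And>b. b \<in> Bs \<Longrightarrow> K b \<in> fil R A2 n" "\<And>b. b \<in> Bs \<Longrightarrow> K b \<in> grade A2 (dg b)"
    "\<And>b i. b \<in> Bs \<Longrightarrow> i < A1.fdim n \<Longrightarrow> A2.symbol n i (K b) = h i b" by metis
  have "g (A1.lift b) \<ominus>\<^bsub>A2\<^esub> K b \<in> grade A2 (dg b)" if "b \<in> Bs" for b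
    using that by (intro A2.grade_diff gl(4) A1.lift(1) K(2))
  from extension[OF this] obtain g' where g': "graded_linear R A1 A2 g'"
    and g'_lift: "\<And>b. b \<in> Bs \<Longrightarrow> g' (A1.lift b) = g (A1.lift b) \<ominus>\<^bsub>A2\<^esub> K b" by blast
  note gl' = graded_linearD[OF g']
  \<comment> \<open>The correction, with the symbols \<open>h\<close>.\<close>
  define d where "d x = g x \<ominus>\<^bsub>A2\<^esub> g' x" for x
  have d: "d x \<in> fil R A2 n \<and> (\<forall>i<A1.fdim n. A2.symbol n i (d x) = h i (\<pi>1 x))" if "x \<in> carrier A1" for x
    using that
  proof (induction rule: A1.lift_induct)
    case zero
    then show ?case
      by (simp add: d_def graded_linear_zero[OF g'] graded_linear_zero[OF g_lin] A2.diff_self fil.zero A1.\<pi>_zero h0 A2.symbol_zero)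
  next
    case (add x y)
    have "d (x \<oplus>\<^bsub>A1\<^esub> y) = d x \<oplus>\<^bsub>A2\<^esub> d y" using add by (simp add: d_def gl gl' A2.diff_add)
    then show ?case using add by (simp add: A2.fil_add A2.symbol_add A1.\<pi>_add h_add A1.\<pi>_P)
  next
    case (smult r j x)
    have r: "r \<in> carrier R" using smult A1.grade_R_carrier by blast
    have e: "d (r \<odot>\<^bsub>A1\<^esub> x) = r \<odot>\<^bsub>A2\<^esub> d x" using smult r by (simp add: d_def gl gl' A2.diff_smult)
    have "r \<odot>\<^bsub>A2\<^esub> d x \<in> fil R A2 (j + n)" using smult by (intro A2.fil_smult_homog) auto
    then have f: "r \<odot>\<^bsub>A2\<^esub> d x \<in> fil R A2 n" by (rule A2.fil_antimono) simp
    show ?case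
    proof (cases "j = 0")
      case True
      then obtain c where c: "r = A1.scalar c" using smult A1.scalar_surj by blast
      have "A2.symbol n i (A1.scalar c \<odot>\<^bsub>A2\<^esub> d x) = const2 c * h i (\<pi>1 x)" if "i < A1.fdim n" for i
        using smult.IH that A2.symbol_scalar[OF that] by simp
      then show ?thesis
        unfolding e using f smult.hyps by (simp add: c A1.\<pi>_scalar h_lin A1.\<pi>_P del: mult_pCons_left)
    next
      case False
      then show ?thesis
        unfolding e using f smult A1.\<pi>_pos[of r j x] A2.symbol_smult_pos[of _ n j r "d x"] by (simp add: h0)
    qed
  next
    case (lift b)
    have "d (A1.lift b) = K b"
    proof -
      have c: "g (A1.lift b) \<in> carrier A2" "K b \<in> carrier A2"
        using gl(1)[OF A1.lift_carrier[OF lift]] A2.fil_carrier[OF K(1)[OF lift]] by auto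
      have "K b \<oplus>\<^bsub>A2\<^esub> (g (A1.lift b) \<ominus>\<^bsub>A2\<^esub> K b) = g (A1.lift b)"
        using A2.diff_add_cancel[OF c] c by (simp add: A2.alg.M.a_comm A2.diff_closed)
      then show ?thesis
        unfolding d_def g'_lift[OF lift] using c A2.alg.diff_eq_iff by (simp add: A2.diff_closed)
    qed
    then show ?case using K lift by (simp add: A1.lift)
  qed
  have dc: "d x \<in> carrier A2" if "x \<in> carrier A1" for x using d[OF that] A2.fil_carrier by blast
  have gd: "g x = d x \<oplus>\<^bsub>A2\<^esub> g' x" if "x \<in> carrier A1" for x
    unfolding d_def using that by (simp add: A2.diff_add_cancel gl gl')
  have d_\<pi>: "\<pi>2 (d x) = 0" if "x \<in> carrier A1" for x
    using d[OF that] n by (intro A2.\<pi>_fil A2.fil_antimono[of _ n 1]) auto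
  have g'_\<pi>: "\<pi>2 (g' x) = \<pi>1 x" if "x \<in> carrier A1" for x
    using gd[OF that] g_\<pi>[OF that] d_\<pi>[OF that] dc[OF that] gl'(1)[OF that] by (simp add: A2.\<pi>_add)
  have mult: "g' (x \<otimes>\<^bsub>A1\<^esub> y) \<ominus>\<^bsub>A2\<^esub> g' x \<otimes>\<^bsub>A2\<^esub> g' y \<in> fil R A2 (Suc n)" if xy: "x \<in> carrier A1" "y \<in> carrier A1" for x y
  proof -
    define w' where "w' = g' (x \<otimes>\<^bsub>A1\<^esub> y) \<ominus>\<^bsub>A2\<^esub> g' x \<otimes>\<^bsub>A2\<^esub> g' y"
    have w'c: "w' \<in> carrier A2" unfolding w'_def using xy by (intro A2.diff_closed) (auto simp: gl')
    have w'e: "g' (x \<otimes>\<^bsub>A1\<^esub> y) = w' \<oplus>\<^bsub>A2\<^esub> g' x \<otimes>\<^bsub>A2\<^esub> g' y"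
      unfolding w'_def using xy by (simp add: A2.diff_add_cancel gl')
    have eq: "w x y \<oplus>\<^bsub>A2\<^esub> (d y \<otimes>\<^bsub>A2\<^esub> g' x \<oplus>\<^bsub>A2\<^esub> (d x \<otimes>\<^bsub>A2\<^esub> g' y \<oplus>\<^bsub>A2\<^esub> d x \<otimes>\<^bsub>A2\<^esub> d y)) = d (x \<otimes>\<^bsub>A1\<^esub> y) \<oplus>\<^bsub>A2\<^esub> w'"
    proof (rule A2.alg.square_zero_identity)
      show "w x y \<oplus>\<^bsub>A2\<^esub> (d x \<oplus>\<^bsub>A2\<^esub> g' x) \<otimes>\<^bsub>A2\<^esub> (d y \<oplus>\<^bsub>A2\<^esub> g' y) = d (x \<otimes>\<^bsub>A1\<^esub> y) \<oplus>\<^bsub>A2\<^esub> w' \<oplus>\<^bsub>A2\<^esub> g' x \<otimes>\<^bsub>A2\<^esub> g' y"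
        using w_eq[OF xy] gd[of "x \<otimes>\<^bsub>A1\<^esub> y"] gd[OF xy(1)] gd[OF xy(2)] w'e xy w'c
        by (simp add: A2.alg.M.a_assoc dc gl')
    qed (use xy in \<open>auto simp: gl' w_carrier dc w'c\<close>)
    have f2: "d x \<otimes>\<^bsub>A2\<^esub> d y \<in> fil R A2 (n + n)" using xy d by (intro A2.fil_mult_fil) auto
    then have fS: "d x \<otimes>\<^bsub>A2\<^esub> d y \<in> fil R A2 (Suc n)" using n by (elim A2.fil_antimono) simp
    have f: "d x \<otimes>\<^bsub>A2\<^esub> d y \<in> fil R A2 n" using f2 by (elim A2.fil_antimono) simp
    note fl = w_fil[OF xy] A2.fil_mult[OF conjunct1[OF d[OF xy(1)]] gl'(1)[OF xy(2)]]
      A2.fil_mult[OF conjunct1[OF d[OF xy(2)]] gl'(1)[OF xy(1)]]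
    have dxy: "d (x \<otimes>\<^bsub>A1\<^esub> y) \<in> fil R A2 n" using d xy by simp
    have "w' = (d (x \<otimes>\<^bsub>A1\<^esub> y) \<oplus>\<^bsub>A2\<^esub> w') \<ominus>\<^bsub>A2\<^esub> d (x \<otimes>\<^bsub>A1\<^esub> y)"
      using w'c A2.fil_carrier[OF dxy] A2.alg.diff_eq_iff[of "d (x \<otimes>\<^bsub>A1\<^esub> y) \<oplus>\<^bsub>A2\<^esub> w'" "d (x \<otimes>\<^bsub>A1\<^esub> y)" w']
      by (simp add: A2.alg.M.a_comm)
    also have "\<dots> \<in> fil R A2 n"
      unfolding eq[symmetric] using fl f dxy by (intro A2.fil_diff A2.fil_add)
    finally have w'f: "w' \<in> fil R A2 n" .
    have "A2.symbol n i w' = 0" if i: "i < A1.fdim n" for i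
    proof -
      have "A2.symbol n i (w x y) + (h i (\<pi>1 y) * \<pi>1 x + h i (\<pi>1 x) * \<pi>1 y) = h i (\<pi>1 (x \<otimes>\<^bsub>A1\<^esub> y)) + A2.symbol n i w'"
        using arg_cong[OF eq, of "A2.symbol n i"] fl f dxy w'f d xy A2.symbol_high[OF i fS]
        by (simp add: A2.symbol_add[OF i] A2.fil_add A2.symbol_mult[OF i] i gl' g'_\<pi>)
      then show ?thesis
        using h_w[OF i xy] by (simp add: defect_def A1.\<pi>_mult xy algebra_simps)
    qed
    then show ?thesis using A2.symbol_test[OF w'f] by (simp add: w'_def)
  qed
  have comp: "g' (F1 b) \<ominus>\<^bsub>A2\<^esub> F2 b \<in> fil R A2 (Suc n)" if b: "b \<in> carrier BB" for b
  proof -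
    have c: "F1 b \<in> carrier A1" "F2 b \<in> carrier A2" using b Fl1 Fl2 by auto
    have "g' (F1 b) \<ominus>\<^bsub>A2\<^esub> F2 b = D b \<ominus>\<^bsub>A2\<^esub> d (F1 b)"
    proof -
      have "D b = (g' (F1 b) \<ominus>\<^bsub>A2\<^esub> F2 b) \<oplus>\<^bsub>A2\<^esub> d (F1 b)"
        unfolding D_def gd[OF c(1)] a_minus_def using c dc gl' by (simp add: A2.alg.M.a_ac)
      then have "D b \<ominus>\<^bsub>A2\<^esub> d (F1 b) = g' (F1 b) \<ominus>\<^bsub>A2\<^esub> F2 b"
        using A2.alg.diff_eq_iff D_carrier[OF b] dc[OF c(1)] A2.diff_closed[OF gl'(1)[OF c(1)] c(2)] by blast
      then show ?thesis by simp
    qed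
    moreover have "D b \<ominus>\<^bsub>A2\<^esub> d (F1 b) \<in> fil R A2 (Suc n)"
    proof (rule A2.symbol_test)
      show "D b \<ominus>\<^bsub>A2\<^esub> d (F1 b) \<in> fil R A2 n" using D_fil[OF b] d[OF c(1)] by (intro A2.fil_diff) auto
      show "A2.symbol n i (D b \<ominus>\<^bsub>A2\<^esub> d (F1 b)) = 0" if "i < A1.fdim n" for i
        using that D_fil[OF b] d[OF c(1)] h_D[OF that b] by (simp add: A2.symbol_diff F1_\<pi>[OF b])
    qed
    ultimately show ?thesis by simp
  qed
  have "approx (Suc n) g'" unfolding approx_def using g' g'_\<pi> mult comp by blast
  then show ?thesis using d unfolding d_def by blast
qed

end

lemma approx_sequence:
  obtains f where "\<And>n. approx (Suc n) (f n)"
    "\<And>n x. x \<in> carrier A1 \<Longrightarrow> f n x \<ominus>\<^bsub>A2\<^esub> f (Suc n) x \<in> fil R A2 (Suc n)"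
proof -
  have "\<exists>f. \<forall>n. approx (Suc n) (f n) \<and> (\<forall>x\<in>carrier A1. f n x \<ominus>\<^bsub>A2\<^esub> f (Suc n) x \<in> fil R A2 (Suc n))"
  proof (rule dependent_nat_choice)
    show "\<exists>g. approx (Suc 0) g" using approx_start by simp
    show "\<exists>g'. approx (Suc (Suc n)) g' \<and> (\<forall>x\<in>carrier A1. g x \<ominus>\<^bsub>A2\<^esub> g' x \<in> fil R A2 (Suc n))"
      if "approx (Suc n) g" for n g
      using improve[OF _ that] by simp
  qed
  then show thesis using that by blast
qed

text \<open>
  On a basis element of degree \<open>d\<close> the approximations \<open>f n\<close> with \<open>n \<ge> d\<close> agree, since two of them differ by an
  element of degree \<open>d\<close> in \<open>R\<^bsub>>d\<^esub> A\<^sub>2\<close>.  The \<open>R\<close>-linear map \<open>g\<close> with these limits as values agrees with each \<open>f n\<close> up to \<open>R\<^bsub>>n\<^esub> A\<^sub>2\<close>.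
\<close>

lemma isomorphism_exists:
  obtains g where "graded_linear R A1 A2 g"
    "\<And>x. x \<in> carrier A1 \<Longrightarrow> \<pi>2 (g x) = \<pi>1 x"
    "\<And>x y. x \<in> carrier A1 \<Longrightarrow> y \<in> carrier A1 \<Longrightarrow> g (x \<otimes>\<^bsub>A1\<^esub> y) = g x \<otimes>\<^bsub>A2\<^esub> g y"
    "\<And>b. b \<in> carrier BB \<Longrightarrow> g (F1 b) = F2 b"
    "bij_betw g (carrier A1) (carrier A2)"
proof -
  obtain f where f: "\<And>n. approx (Suc n) (f n)"
    "\<And>n x. x \<in> carrier A1 \<Longrightarrow> f n x \<ominus>\<^bsub>A2\<^esub> f (Suc n) x \<in> fil R A2 (Suc n)"
    by (rule approx_sequence) blast
  have fl: "graded_linear R A1 A2 (f n)" for n using f(1)[of n] by (simp add: approx_def)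
  note fD = graded_linearD[OF fl]
  have f_mono: "f n x \<ominus>\<^bsub>A2\<^esub> f m x \<in> fil R A2 (Suc n)" if "n \<le> m" "x \<in> carrier A1" for n m x
    using that(1)
  proof (induction m rule: dec_induct)
    case base then show ?case using that by (simp add: A2.diff_self fD fil.zero)
  next
    case (step m)
    have "f m x \<ominus>\<^bsub>A2\<^esub> f (Suc m) x \<in> fil R A2 (Suc n)"
      using step(1) by (intro A2.fil_antimono[OF f(2)[OF that(2), of m]]) simp
    then show ?case using A2.fil_diff_trans[OF step.IH] fD(1)[OF that(2)] by blast
  qed
  have "f (dg b) (A1.lift b) \<in> grade A2 (dg b)" if "b \<in> Bs" for b using that by (intro fD(4) A1.lift(1))
  from extension[OF this] obtain g where g: "graded_linear R A1 A2 g"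
    and g_lift: "\<And>b. b \<in> Bs \<Longrightarrow> g (A1.lift b) = f (dg b) (A1.lift b)" by blast
  note gD = graded_linearD[OF g]
  have close: "g x \<ominus>\<^bsub>A2\<^esub> f n x \<in> fil R A2 (Suc n)" if "x \<in> carrier A1" for x n
    using that
  proof (induction rule: A1.lift_induct)
    case zero
    then show ?case by (simp add: graded_linear_zero[OF g] graded_linear_zero[OF fl] A2.diff_self fil.zero)
  next
    case (add x y)
    then show ?case by (simp add: gD fD A2.diff_add A2.fil_add)
  next
    case (smult r j x)
    have r: "r \<in> carrier R" using smult A1.grade_R_carrier by blast
    have "r \<odot>\<^bsub>A2\<^esub> (g x \<ominus>\<^bsub>A2\<^esub> f n x) \<in> fil R A2 (j + Suc n)" using smult by (intro A2.fil_smult_homog) auto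
    then have "r \<odot>\<^bsub>A2\<^esub> (g x \<ominus>\<^bsub>A2\<^esub> f n x) \<in> fil R A2 (Suc n)" by (rule A2.fil_antimono) simp
    then show ?case using smult r by (simp add: gD fD A2.diff_smult)
  next
    case (lift b)
    note lc = A1.lift_carrier[OF lift]
    show ?case
    proof (cases "n \<le> dg b")
      case True
      then have "f n (A1.lift b) \<ominus>\<^bsub>A2\<^esub> f (dg b) (A1.lift b) \<in> fil R A2 (Suc n)" using f_mono lc by blast
      from A2.fil_diff_sym[OF this fD(1)[OF lc] fD(1)[OF lc]] show ?thesis unfolding g_lift[OF lift] .
    next
      case False
      then have "f (dg b) (A1.lift b) \<ominus>\<^bsub>A2\<^esub> f n (A1.lift b) \<in> fil R A2 (Suc (dg b))" using f_mono[of "dg b" n] lc by simp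
      moreover have "f (dg b) (A1.lift b) \<ominus>\<^bsub>A2\<^esub> f n (A1.lift b) \<in> grade A2 (dg b)"
        using A1.lift(1)[OF lift] by (intro A2.grade_diff fD(4))
      ultimately have "f (dg b) (A1.lift b) \<ominus>\<^bsub>A2\<^esub> f n (A1.lift b) = \<zero>\<^bsub>A2\<^esub>"
        using A2.fil_grade_zero by blast
      then show ?thesis unfolding g_lift[OF lift] by (simp add: fil.zero)
    qed
  qed
  have fa: "\<pi>2 (f n x) = \<pi>1 x" if "x \<in> carrier A1" for n x using f(1)[of n] that by (simp add: approx_def)
  have \<pi>: "\<pi>2 (g x) = \<pi>1 x" if x: "x \<in> carrier A1" for x
  proof -
    have "\<pi>2 (g x \<ominus>\<^bsub>A2\<^esub> f 0 x) = 0" using close[OF x, of 0] by (intro A2.\<pi>_fil) simp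
    then show ?thesis using fa[OF x] gD(1)[OF x] fD(1)[OF x] by (simp add: A2.\<pi>_diff)
  qed
  have antiS: "z \<in> fil R A2 n" if "z \<in> fil R A2 (Suc n)" for z n using that by (rule A2.fil_antimono) simp
  have mult: "g (x \<otimes>\<^bsub>A1\<^esub> y) = g x \<otimes>\<^bsub>A2\<^esub> g y" if xy: "x \<in> carrier A1" "y \<in> carrier A1" for x y
  proof (rule A2.fil_diff_eq)
    fix n
    have 1: "f n (x \<otimes>\<^bsub>A1\<^esub> y) \<ominus>\<^bsub>A2\<^esub> f n x \<otimes>\<^bsub>A2\<^esub> f n y \<in> fil R A2 (Suc n)"
      using f(1)[of n] xy by (simp add: approx_def)
    have 2: "f n x \<otimes>\<^bsub>A2\<^esub> f n y \<ominus>\<^bsub>A2\<^esub> g x \<otimes>\<^bsub>A2\<^esub> g y \<in> fil R A2 (Suc n)"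
      using xy by (intro A2.fil_diff_mult A2.fil_diff_sym[OF close]) (auto simp: gD fD)
    have 3: "g (x \<otimes>\<^bsub>A1\<^esub> y) \<ominus>\<^bsub>A2\<^esub> f n (x \<otimes>\<^bsub>A1\<^esub> y) \<in> fil R A2 (Suc n)" using xy by (intro close) auto
    have "f n (x \<otimes>\<^bsub>A1\<^esub> y) \<ominus>\<^bsub>A2\<^esub> g x \<otimes>\<^bsub>A2\<^esub> g y \<in> fil R A2 (Suc n)"
      by (rule A2.fil_diff_trans[OF 1 2]) (auto simp: gD fD xy)
    from A2.fil_diff_trans[OF 3 this] have "g (x \<otimes>\<^bsub>A1\<^esub> y) \<ominus>\<^bsub>A2\<^esub> g x \<otimes>\<^bsub>A2\<^esub> g y \<in> fil R A2 (Suc n)"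
      using xy by (simp add: gD fD)
    then show "g (x \<otimes>\<^bsub>A1\<^esub> y) \<ominus>\<^bsub>A2\<^esub> g x \<otimes>\<^bsub>A2\<^esub> g y \<in> fil R A2 n" by (rule antiS)
  qed (use xy in \<open>auto simp: gD\<close>)
  have comp: "g (F1 b) = F2 b" if b: "b \<in> carrier BB" for b
  proof (rule A2.fil_diff_eq)
    fix n
    have c: "F1 b \<in> carrier A1" "F2 b \<in> carrier A2"
      using b graded_linearD(1)[OF F1_lin] graded_linearD(1)[OF F2_lin] by auto
    have "f n (F1 b) \<ominus>\<^bsub>A2\<^esub> F2 b \<in> fil R A2 (Suc n)" using f(1)[of n] b by (simp add: approx_def)
    from A2.fil_diff_trans[OF close[OF c(1)] this] have "g (F1 b) \<ominus>\<^bsub>A2\<^esub> F2 b \<in> fil R A2 (Suc n)"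
      using c gD fD by simp
    then show "g (F1 b) \<ominus>\<^bsub>A2\<^esub> F2 b \<in> fil R A2 n" by (rule antiS)
  qed (use b graded_linearD(1)[OF F1_lin] graded_linearD(1)[OF F2_lin] gD in auto)
  \<comment> \<open>A map that lifts the identity of \<open>P\<close> preserves symbols, and an element of \<open>A\<^sub>1\<close> all of whose symbols
    vanish is zero.\<close>
  have symb: "g x \<in> fil R A2 n \<and> (\<forall>i<A1.fdim n. A2.symbol n i (g x) = A1.symbol n i x)" if "x \<in> fil R A1 n" for x n
    using that
  proof (induction rule: fil.induct)
    case zero then show ?case by (simp add: graded_linear_zero[OF g] fil.zero A1.symbol_zero A2.symbol_zero)
  next
    case (step x j r a)
    have c: "x \<in> carrier A1" "r \<in> carrier R" using step A1.fil_carrier A1.grade_R_carrier by auto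
    have e: "g (x \<oplus>\<^bsub>A1\<^esub> r \<odot>\<^bsub>A1\<^esub> a) = g x \<oplus>\<^bsub>A2\<^esub> r \<odot>\<^bsub>A2\<^esub> g a" using c step by (simp add: gD)
    have f1: "r \<odot>\<^bsub>A1\<^esub> a \<in> fil R A1 n" and f2: "r \<odot>\<^bsub>A2\<^esub> g a \<in> fil R A2 n"
      using step gD(1) by (auto intro: A1.fil_gen A2.fil_gen)
    have "A2.symbol n i (r \<odot>\<^bsub>A2\<^esub> g a) = A1.symbol n i (r \<odot>\<^bsub>A1\<^esub> a)" if i: "i < A1.fdim n" for i
      using step i gD(1)[OF step(4)]
      by (cases "j = n") (simp_all add: A1.symbol_gen A2.symbol_gen A1.symbol_gen_high[of i n j] A2.symbol_gen_high[of i n j] \<pi>)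
    then show ?case unfolding e using step f1 f2 by (simp add: A2.fil_add A1.symbol_add A2.symbol_add)
  qed
  have inj0: "x = \<zero>\<^bsub>A1\<^esub>" if x: "x \<in> carrier A1" "g x = \<zero>\<^bsub>A2\<^esub>" for x
  proof (rule A1.fil_Inter[OF x(1)])
    show "x \<in> fil R A1 n" for n
    proof (induction n)
      case 0 then show ?case using A1.fil_0 x by simp
    next
      case (Suc n)
      then show ?case using symb[OF Suc] x(2) by (intro A1.symbol_test) (auto simp: A2.symbol_zero)
    qed
  qed
  have inj: "inj_on g (carrier A1)"
  proof (rule inj_onI)
    fix x y assume xy: "x \<in> carrier A1" "y \<in> carrier A1" "g x = g y"
    have "g x = g (x \<ominus>\<^bsub>A1\<^esub> y) \<oplus>\<^bsub>A2\<^esub> g y"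
      using gD(2)[OF A1.diff_closed[OF xy(1,2)] xy(2)] A1.diff_add_cancel[OF xy(1,2)] by simp
    then have "g (x \<ominus>\<^bsub>A1\<^esub> y) = \<zero>\<^bsub>A2\<^esub>"
      using xy gD(1) A1.diff_closed[OF xy(1,2)] by (metis A2.alg.M.add.r_cancel_one')
    then have "x \<ominus>\<^bsub>A1\<^esub> y = \<zero>\<^bsub>A1\<^esub>" using inj0 A1.diff_closed[OF xy(1,2)] by blast
    then show "x = y" using xy A1.alg.r_right_minus_eq by blast
  qed
  have surj: "y \<in> g ` carrier A1" if "y \<in> carrier A2" for y
  proof (rule A2.nakayama[OF _ _ _ _ that])
    show "\<zero>\<^bsub>A2\<^esub> \<in> g ` carrier A1" using graded_linear_zero[OF g] by (metis A1.alg.M.zero_closed image_eqI)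
    show "x \<oplus>\<^bsub>A2\<^esub> y \<in> g ` carrier A1" if xy: "x \<in> g ` carrier A1" "y \<in> g ` carrier A1" for x y
    proof -
      obtain u v where "u \<in> carrier A1" "v \<in> carrier A1" "x = g u" "y = g v" using xy by blast
      then have "u \<oplus>\<^bsub>A1\<^esub> v \<in> carrier A1" "x \<oplus>\<^bsub>A2\<^esub> y = g (u \<oplus>\<^bsub>A1\<^esub> v)" by (simp_all add: gD)
      then show ?thesis by blast
    qed
    show "r \<odot>\<^bsub>A2\<^esub> x \<in> g ` carrier A1" if r: "r \<in> grade R j" and x: "x \<in> g ` carrier A1" for r j x
    proof -
      obtain u where "u \<in> carrier A1" "x = g u" using x by blast
      then have "r \<odot>\<^bsub>A1\<^esub> u \<in> carrier A1" "r \<odot>\<^bsub>A2\<^esub> x = g (r \<odot>\<^bsub>A1\<^esub> u)"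
        using A1.grade_R_carrier[OF r] by (simp_all add: gD)
      then show ?thesis by blast
    qed
    fix d x assume x: "x \<in> grade A2 d"
    obtain u where u: "u \<in> grade A1 d" "\<pi>1 u = \<pi>2 x"
      using A1.\<pi>_surj_grade[OF A2.\<pi>_P[OF A2.alg.grade_carrier[OF x]] A2.\<pi>_homog[OF x]] by blast
    have uc: "u \<in> carrier A1" using u A1.alg.grade_carrier by blast
    then show "\<exists>m\<in>g ` carrier A1. m \<in> grade A2 d \<and> \<pi>2 m = \<pi>2 x"
      using gD(4)[OF u(1)] \<pi>[OF uc] u(2) by auto
  qed
  have bij: "bij_betw g (carrier A1) (carrier A2)"
    unfolding bij_betw_def using inj surj gD(1) by auto
  show thesis
  proof (rule that)
    show "graded_linear R A1 A2 g" by (rule g)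
    show "bij_betw g (carrier A1) (carrier A2)" by (rule bij)
  qed (simp_all add: \<pi> mult comp)
qed

end

section \<open>Homogeneous bases\<close>

lemma vector_space_const2: "vector_space (\<lambda>c p :: complex poly poly. const2 c * p)"
proof unfold_locales
  show "const2 a * (x + y) = const2 a * x + const2 a * y" for a x y by (rule distrib_left)
  show "const2 (a + b) * x = const2 a * x + const2 b * x" for a b x by (simp only: const2_add distrib_right)
  show "const2 a * (const2 b * x) = const2 (a * b) * x" for a b x by simp
  show "const2 1 * x = x" for x by (simp add: smult_const_one)
qed

text \<open>
  A maximal linearly independent set of homogeneous elements.  A homogeneous polynomial is a combination
  of those of its own degree, because the other terms contribute to other coefficients.
\<close>

lemma homogeneous_basis:
  fixes P :: "complex poly poly set"
  obtains B dg where "B \<subseteq> P" "\<And>b. b \<in> B \<Longrightarrow> homog (dg b) b"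
    "\<And>T c b. finite T \<Longrightarrow> T \<subseteq> B \<Longrightarrow> (\<Sum>b\<in>T. const2 (c b) * b) = 0 \<Longrightarrow> b \<in> T \<Longrightarrow> c b = 0"
    "\<And>p d. p \<in> P \<Longrightarrow> homog d p \<Longrightarrow>
      \<exists>T c. finite T \<and> T \<subseteq> B \<and> (\<forall>b\<in>T. dg b = d) \<and> p = (\<Sum>b\<in>T. const2 (c b) * b)"
proof -
  interpret vs: vector_space "\<lambda>c p :: complex poly poly. const2 c * p" by (rule vector_space_const2)
  define V where "V = {p \<in> P. \<exists>d. homog d p}"
  obtain B where B: "B \<subseteq> V" "vs.independent B" "V \<subseteq> vs.span B"
    using vs.maximal_independent_subset[of V] by blast
  define dg where "dg b = (SOME d. homog d b)" for b
  have dg: "homog (dg b) b" if "b \<in> B" for b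
  proof -
    have "\<exists>d. homog d b" using that B(1) by (auto simp: V_def)
    then show ?thesis unfolding dg_def by (rule someI_ex)
  qed
  show thesis
  proof (rule that[of B dg])
    show "B \<subseteq> P" using B(1) by (auto simp: V_def)
    show "homog (dg b) b" if "b \<in> B" for b using dg that .
    show "c b = 0" if "finite T" "T \<subseteq> B" "(\<Sum>b\<in>T. const2 (c b) * b) = 0" "b \<in> T" for T c b
      using B(2)[unfolded vs.independent_explicit_module, rule_format, OF that] .
    fix p d assume p: "p \<in> P" "homog d p"
    then have "p \<in> vs.span B" using B(3) by (auto simp: V_def)
    then obtain T c where T: "finite T" "T \<subseteq> B" "p = (\<Sum>b\<in>T. const2 (c b) * b)"
      unfolding vs.span_explicit by auto
    let ?co = "\<lambda>p i j. Polynomial.coeff (Polynomial.coeff p j) i"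
    have co: "?co (\<Sum>b\<in>S. const2 (c b) * b) i j = (\<Sum>b\<in>S. c b * ?co b i j)" for S i j
      by (simp add: coeff_sum)
    define S where "S = {b \<in> T. dg b = d}"
    have "p = (\<Sum>b\<in>S. const2 (c b) * b)"
    proof (intro poly_eqI)
      fix j i
      show "?co p i j = ?co (\<Sum>b\<in>S. const2 (c b) * b) i j"
      proof (cases "i + j = d")
        case True
        have "(\<Sum>b\<in>S. c b * ?co b i j) = (\<Sum>b\<in>T. c b * ?co b i j)"
        proof (rule sum.mono_neutral_left[OF T(1)])
          show "\<forall>b\<in>T - S. c b * ?co b i j = 0"
            using dg T(2) True by (auto simp: S_def shifted_def)
        qed (auto simp: S_def)
        then show ?thesis unfolding T(3) co by simp
      next
        case False
        have "?co p i j = 0" using p(2) False by (auto simp: shifted_def)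
        moreover have "(\<Sum>b\<in>S. c b * ?co b i j) = 0"
          using dg T(2) False by (intro sum.neutral) (auto simp: S_def shifted_def)
        ultimately show ?thesis unfolding co by simp
      qed
    qed
    then show "\<exists>T c. finite T \<and> T \<subseteq> B \<and> (\<forall>b\<in>T. dg b = d) \<and> p = (\<Sum>b\<in>T. const2 (c b) * b)"
      using T(1,2) by (intro exI[of _ S] exI[of _ c]) (auto simp: S_def)
  qed
qed

section \<open>The special fibre\<close>

lemma restrict_scalars_simps [simp]:
  "carrier (restrict_scalars R A) = carrier A" "monoid.mult (restrict_scalars R A) = monoid.mult A"
  "one (restrict_scalars R A) = one A" "ring.zero (restrict_scalars R A) = ring.zero A"
  "add (restrict_scalars R A) = add A" "grade (restrict_scalars R A) = grade A"
  "module.smult (restrict_scalars R A) = (\<lambda>c a. (c \<odot>\<^bsub>R\<^esub> \<one>\<^bsub>R\<^esub>) \<odot>\<^bsub>A\<^esub> a)"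
  by (simp_all add: restrict_scalars_def)

lemma restrict_scalars_coset: "a_r_coset (restrict_scalars R A) I a = a_r_coset A I a"
  by (simp add: a_r_coset_def r_coset_def)

lemma restrict_scalars_set_add: "set_add (restrict_scalars R A) X Y = set_add A X Y"
  by (simp add: set_add_def set_mult_def)

lemma restrict_scalars_cosets: "A_RCOSETS (restrict_scalars R A) I = a_r_coset A I ` carrier A"
  by (auto simp: A_RCOSETS_def RCOSETS_def a_r_coset_def r_coset_def)

lemma restrict_scalars_rcoset_mult: "rcoset_mult (restrict_scalars R A) I X Y = rcoset_mult A I X Y"
  by (simp add: rcoset_mult_def restrict_scalars_coset)

lemma special_fibre_simps:
  "carrier (special_fibre R A) = a_r_coset A (ext_ideal R A) ` carrier A"
  "monoid.mult (special_fibre R A) = rcoset_mult A (ext_ideal R A)"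
  "one (special_fibre R A) = a_r_coset A (ext_ideal R A) \<one>\<^bsub>A\<^esub>"
  "add (special_fibre R A) = set_add A"
  "grade (special_fibre R A) d = a_r_coset A (ext_ideal R A) ` grade A d"
  "module.smult (special_fibre R A) c X =
     set_add A (ext_ideal R A) ((\<lambda>x. (c \<odot>\<^bsub>R\<^esub> \<one>\<^bsub>R\<^esub>) \<odot>\<^bsub>A\<^esub> x) ` X)"
  by (simp_all add: special_fibre_def quotient_algebra_def FactRing_def restrict_scalars_cosets
      restrict_scalars_coset restrict_scalars_set_add restrict_scalars_rcoset_mult fun_eq_iff)

context graded_over
begin

lemma fil_1_ideal: "ideal (fil R A 1) A"
proof (rule idealI)
  show "subgroup (fil R A 1) (add_monoid A)"
  proof (rule subgroup.intro)
    fix x assume x: "x \<in> fil R A 1"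
    have "inv\<^bsub>add_monoid A\<^esub> x = \<ominus>\<^bsub>A\<^esub> x" by (simp add: a_inv_def)
    then show "inv\<^bsub>add_monoid A\<^esub> x \<in> fil R A 1" using fil_minus[OF x] by simp
  qed (auto simp: fil.zero fil_add fil_carrier)
  fix a x assume a: "a \<in> fil R A 1" and x: "x \<in> carrier A"
  show "a \<otimes>\<^bsub>A\<^esub> x \<in> fil R A 1" using fil_mult[OF a x] .
  then show "x \<otimes>\<^bsub>A\<^esub> a \<in> fil R A 1" using fil_carrier[OF a] x by (simp add: alg.m_comm)
qed (rule cring.axioms(1)[OF alg.M_cring])

lemma positive_part_fil:
  assumes r: "r \<in> positive_part R" and a: "a \<in> carrier A"
  shows "r \<in> carrier R \<and> r \<odot>\<^bsub>A\<^esub> a \<in> fil R A 1"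
proof -
  obtain f n where f: "r = finsum R f {1..n}" "\<And>i. f i \<in> grade R i"
    using r unfolding positive_part_def by blast
  have fc: "f i \<in> carrier R" for i using f(2) grade_R_carrier by blast
  have "finite T \<Longrightarrow> T \<subseteq> {1..} \<Longrightarrow> finsum R f T \<in> carrier R \<and> finsum R f T \<odot>\<^bsub>A\<^esub> a \<in> fil R A 1" for T
  proof (induction T rule: finite_induct)
    case empty then show ?case using a by (simp add: fil.zero)
  next
    case (insert i T)
    then have "f i \<odot>\<^bsub>A\<^esub> a \<in> fil R A 1" using f(2) a by (intro fil_gen[of 1 i]) auto
    moreover have "finsum R f (insert i T) = f i \<oplus>\<^bsub>R\<^esub> finsum R f T"
      using insert fc by (intro base.finsum_insert) auto
    ultimately show ?case using insert fc a by (simp add: alg.smult_l_distr fil_add)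
  qed
  then show ?thesis unfolding f(1) by auto
qed

lemma grade_positive_part: assumes "r \<in> grade R j" "1 \<le> j" shows "r \<in> positive_part R"
proof -
  have "finsum R (\<lambda>i. if i = j then r else \<zero>\<^bsub>R\<^esub>) {1..j} = finsum R (\<lambda>i. r) {j}"
    using assms grade_R_carrier by (intro base.add.finprod_mono_neutral_cong_right) auto
  then have "r = finsum R (\<lambda>i. if i = j then r else \<zero>\<^bsub>R\<^esub>) {1..j}"
    using assms grade_R_carrier by simp
  moreover have "\<forall>i. (if i = j then r else \<zero>\<^bsub>R\<^esub>) \<in> grade R i" using assms base.grade_zero by auto
  ultimately show ?thesis unfolding positive_part_def by blast
qed

text \<open>
  The ideal generated by all products with elements of \<open>R\<^bsub>>0\<^esub>\<close> is already generated additively by them.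
\<close>

lemma ext_ideal_fil: "ext_ideal R A = fil R A 1"
proof -
  let ?S = "{r \<odot>\<^bsub>A\<^esub> a | r a. r \<in> positive_part R \<and> a \<in> carrier A}"
  have S: "?S \<subseteq> carrier A" using positive_part_fil by auto
  have "?S \<subseteq> fil R A 1" using positive_part_fil by blast
  then have sub: "ext_ideal R A \<subseteq> fil R A 1"
    unfolding ext_ideal_def by (rule alg.genideal_minimal[OF fil_1_ideal])
  interpret I: ideal "ext_ideal R A" A
    unfolding ext_ideal_def by (rule alg.genideal_ideal[OF S])
  have "x \<in> ext_ideal R A" if "x \<in> fil R A 1" for x
    using that
  proof (induction rule: fil.induct)
    case (step x j r a)
    have "r \<odot>\<^bsub>A\<^esub> a \<in> ?S" using step grade_positive_part by blast
    then have "r \<odot>\<^bsub>A\<^esub> a \<in> ext_ideal R A"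
      unfolding ext_ideal_def using alg.genideal_self[OF S] by blast
    then show ?case using step.IH by simp
  qed simp
  then show ?thesis using sub by blast
qed

text \<open>
  Both the scalar multiplication of the special fibre and the maps between special fibres send a coset to
  the saturation of its image; this computes the result on representatives.
\<close>

lemma coset_image:
  assumes C: "graded_over R C" and f_fil: "\<And>x. x \<in> fil R C 1 \<Longrightarrow> f x \<in> fil R A 1"
    and f_add: "\<And>x y. x \<in> carrier C \<Longrightarrow> y \<in> carrier C \<Longrightarrow> f (x \<oplus>\<^bsub>C\<^esub> y) = f x \<oplus>\<^bsub>A\<^esub> f y"
    and f_c: "\<And>x. x \<in> carrier C \<Longrightarrow> f x \<in> carrier A" and a: "a \<in> carrier C"
  shows "set_add A (fil R A 1) (f ` (a_r_coset C (fil R C 1) a)) = a_r_coset A (fil R A 1) (f a)"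
proof -
  interpret C: graded_over R C by (rule C)
  have fa: "f a \<in> carrier A" using f_c a .
  show ?thesis
  proof (intro Set.set_eqI iffI)
    fix y assume "y \<in> set_add A (fil R A 1) (f ` (a_r_coset C (fil R C 1) a))"
    then obtain i j where ij: "i \<in> fil R A 1" "j \<in> fil R C 1" "y = i \<oplus>\<^bsub>A\<^esub> f (j \<oplus>\<^bsub>C\<^esub> a)"
      by (auto simp: set_add_def set_mult_def a_r_coset_def r_coset_def)
    have "y = (i \<oplus>\<^bsub>A\<^esub> f j) \<oplus>\<^bsub>A\<^esub> f a"
      unfolding ij(3) f_add[OF C.fil_carrier[OF ij(2)] a]
      using fil_carrier[OF ij(1)] fil_carrier[OF f_fil[OF ij(2)]] fa by (simp add: alg.M.a_assoc)
    then show "y \<in> a_r_coset A (fil R A 1) (f a)"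
      using fil_add[OF ij(1) f_fil[OF ij(2)]] by (auto simp: a_r_coset_def r_coset_def)
  next
    fix y assume "y \<in> a_r_coset A (fil R A 1) (f a)"
    then obtain i where i: "i \<in> fil R A 1" "y = i \<oplus>\<^bsub>A\<^esub> f a" by (auto simp: a_r_coset_def r_coset_def)
    have "a = \<zero>\<^bsub>C\<^esub> \<oplus>\<^bsub>C\<^esub> a" using a by simp
    then have "a \<in> a_r_coset C (fil R C 1) a" using fil.zero[of C R 1] by (auto simp: a_r_coset_def r_coset_def)
    then show "y \<in> set_add A (fil R A 1) (f ` (a_r_coset C (fil R C 1) a))"
      using i by (auto simp: set_add_def set_mult_def)
  qed
qed

end

text \<open>
  The composite \<open>A \<rightarrow> A / \<mm>A \<rightarrow> P\<close>.
\<close>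

definition residue :: "(complex, 'r) gr_alg \<Rightarrow> ('r, 'a) gr_alg \<Rightarrow> ('a set \<Rightarrow> 'p) \<Rightarrow> 'a \<Rightarrow> 'p" where
  "residue R A \<phi> a = \<phi> (a_r_coset A (ext_ideal R A) a)"

lemma invariants_simps [simp]:
  "carrier (invariants G) = {p. \<forall>g\<in>G. poly_act g p = p}" "monoid.mult (invariants G) = (*)"
  "one (invariants G) = 1" "add (invariants G) = (+)" "module.smult (invariants G) = (\<lambda>c p. const2 c * p)"
  "grade (invariants G) d = {p. (\<forall>g\<in>G. poly_act g p = p) \<and> homog d p}"
  by (simp_all add: invariants_def shifted_def)

text \<open>
  The kernel is found from the injectivity of \<open>\<phi>\<close>; all other properties pass to cosets and back.
\<close>

lemma (in graded_over) fibred_residue: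
  assumes iso: "graded_iso complex_base (special_fibre R A) (invariants G) \<phi>"
  shows "fibred R A (residue R A \<phi>) {p. \<forall>g\<in>G. poly_act g p = p}"
proof -
  define I where "I = ext_ideal R A"
  have I_fil: "I = fil R A 1" by (simp add: I_def ext_ideal_fil)
  interpret I: ideal I A unfolding I_fil by (rule fil_1_ideal)
  let ?q = "a_r_coset A I"
  note sf = special_fibre_simps[of R A, folded I_def]
  have res: "residue R A \<phi> = (\<lambda>a. \<phi> (?q a))" by (simp add: residue_def fun_eq_iff I_def)
  have hom: "\<phi> \<in> ring_hom (special_fibre R A) (invariants G)"
    and lin: "\<And>c X. X \<in> carrier (special_fibre R A) \<Longrightarrow> \<phi> (c \<odot>\<^bsub>special_fibre R A\<^esub> X) = const2 c * \<phi> X"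
    and bij: "bij_betw \<phi> (carrier (special_fibre R A)) (carrier (invariants G))"
    and gr: "\<And>d. \<phi> ` grade (special_fibre R A) d = grade (invariants G) d"
    using iso by (auto simp: graded_iso_def graded_hom_def complex_base_def)
  have q: "?q x \<in> carrier (special_fibre R A)" if "x \<in> carrier A" for x using that by (simp add: sf)
  have add: "\<phi> (?q (x \<oplus>\<^bsub>A\<^esub> y)) = \<phi> (?q x) + \<phi> (?q y)" if "x \<in> carrier A" "y \<in> carrier A" for x y
    using ring_hom_add[OF hom q[OF that(1)] q[OF that(2)]] I.a_rcos_sum[OF that] by (simp add: sf)
  have zero: "\<phi> (?q \<zero>\<^bsub>A\<^esub>) = 0" using add[of "\<zero>\<^bsub>A\<^esub>" "\<zero>\<^bsub>A\<^esub>"] by simp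
  have q0: "?q x = ?q \<zero>\<^bsub>A\<^esub> \<longleftrightarrow> x \<in> I" if "x \<in> carrier A" for x
  proof -
    have "?q \<zero>\<^bsub>A\<^esub> = I" using I.a_subset by (intro alg.a_coset_add_zero)
    then show ?thesis using that I.a_rcos_const[of x] I.a_rcos_self[of x] by auto
  qed
  show ?thesis
  proof (intro fibred.intro fibred_axioms.intro graded_over_axioms; unfold res)
    show "\<phi> (?q (x \<oplus>\<^bsub>A\<^esub> y)) = \<phi> (?q x) + \<phi> (?q y)" if "x \<in> carrier A" "y \<in> carrier A" for x y
      using add that .
    show "\<phi> (?q (x \<otimes>\<^bsub>A\<^esub> y)) = \<phi> (?q x) * \<phi> (?q y)" if "x \<in> carrier A" "y \<in> carrier A" for x y
      using ring_hom_mult[OF hom q[OF that(1)] q[OF that(2)]] I.rcoset_mult_add[OF that] by (simp add: sf)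
    show "\<phi> (?q ((c \<odot>\<^bsub>R\<^esub> \<one>\<^bsub>R\<^esub>) \<odot>\<^bsub>A\<^esub> x)) = const2 c * \<phi> (?q x)" if x: "x \<in> carrier A" for c x
    proof -
      have "set_add A I ((\<lambda>x. scalar c \<odot>\<^bsub>A\<^esub> x) ` ?q x) = ?q (scalar c \<odot>\<^bsub>A\<^esub> x)"
        unfolding I_fil
      proof (rule coset_image[OF graded_over_axioms])
        show "scalar c \<odot>\<^bsub>A\<^esub> y \<in> fil R A 1" if "y \<in> fil R A 1" for y
          using fil_smult_homog[OF scalar_grade that, of c] by simp
      qed (use x scalar_carrier in \<open>auto simp: alg.smult_r_distr\<close>)
      then show ?thesis using lin[OF q[OF x], of c] by (simp add: sf)
    qed
    show "(\<lambda>a. \<phi> (?q a)) ` grade A d = {p \<in> {p. \<forall>g\<in>G. poly_act g p = p}. homog d p}" for d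
      using gr[of d] by (simp add: sf image_image)
    show "(\<lambda>a. \<phi> (?q a)) ` carrier A = {p. \<forall>g\<in>G. poly_act g p = p}"
      using bij_betw_imp_surj_on[OF bij] by (simp add: sf image_image)
    show "x \<in> fil R A 1" if "x \<in> carrier A" "\<phi> (?q x) = 0" for x
    proof -
      have "?q x = ?q \<zero>\<^bsub>A\<^esub>"
        using bij that zero q by (metis alg.M.zero_closed bij_betw_def inj_onD)
      then show ?thesis using q0[OF that(1)] I_fil by simp
    qed
    show "\<phi> (?q x) = 0" if "x \<in> fil R A 1" for x
      using q0[OF fil_carrier[OF that]] that zero I_fil by simp
  qed
qed

lemma graded_linear_fil:
  assumes "graded_over R A" "graded_over R C" "graded_linear R A C f" "x \<in> fil R A n"
  shows "f x \<in> fil R C n"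
proof -
  interpret A: graded_over R A by fact
  interpret C: graded_over R C by fact
  note fD = graded_linearD[OF assms(3)]
  show ?thesis
    using assms(4)
  proof (induction rule: fil.induct)
    case zero
    have "f \<zero>\<^bsub>A\<^esub> = \<zero>\<^bsub>C\<^esub>" using fD(3)[of "\<zero>\<^bsub>R\<^esub>" "\<zero>\<^bsub>A\<^esub>"] fD(1)[of "\<zero>\<^bsub>A\<^esub>"] by simp
    then show ?case by (simp add: fil.zero)
  next
    case (step x j r a)
    then show ?case
      using fil.step[OF step.IH step.hyps(2,3) fD(1)[OF step.hyps(4)]] A.fil_carrier A.grade_R_carrier by (simp add: fD)
  qed
qed

lemma fibre_map_coset:
  assumes A: "graded_over R A" and C: "graded_over R C" and f: "graded_linear R A C f" and a: "a \<in> carrier A"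
  shows "fibre_map R C f (a_r_coset A (ext_ideal R A) a) = a_r_coset C (ext_ideal R C) (f a)"
proof -
  interpret A: graded_over R A by fact
  interpret C: graded_over R C by fact
  show ?thesis
    unfolding fibre_map_def A.ext_ideal_fil C.ext_ideal_fil
    using graded_linearD(1,2)[OF f] a
    by (intro C.coset_image[OF A] graded_linear_fil[OF A C f])
qed

text \<open>
  Maps that commute with the residue maps induce compatible maps of the special fibres.
\<close>

lemma deformation_morphismI:
  assumes A: "graded_over R A" and C: "graded_over R C" and f: "graded_linear R A C f"
    and mult: "\<And>x y. x \<in> carrier A \<Longrightarrow> y \<in> carrier A \<Longrightarrow> f (x \<otimes>\<^bsub>A\<^esub> y) = f x \<otimes>\<^bsub>C\<^esub> f y"
    and one: "f \<one>\<^bsub>A\<^esub> = \<one>\<^bsub>C\<^esub>"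
    and res: "\<And>x. x \<in> carrier A \<Longrightarrow> residue R C \<psi> (f x) = residue R A \<phi> x"
  shows "deformation_morphism R A \<phi> R C \<psi> f"
proof -
  interpret A: graded_over R A by fact
  interpret C: graded_over R C by fact
  note fD = graded_linearD[OF f]
  have "graded_hom complex_base (restrict_scalars R A) (restrict_scalars R C) f"
    unfolding graded_hom_def
  proof (intro conjI ballI allI)
    show "f \<in> ring_hom (restrict_scalars R A) (restrict_scalars R C)"
      by (rule ring_hom_memI) (auto simp: fD mult one)
  qed (auto simp: fD A.scalar_carrier)
  moreover have "\<exists>s\<in>carrier R. f (r \<odot>\<^bsub>A\<^esub> \<one>\<^bsub>A\<^esub>) = s \<odot>\<^bsub>C\<^esub> \<one>\<^bsub>C\<^esub>" if "r \<in> carrier R" for r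
    using that by (intro bexI[of _ r]) (auto simp: fD one)
  moreover have "\<psi> (fibre_map R C f X) = \<phi> X" if X: "X \<in> carrier (special_fibre R A)" for X
  proof -
    obtain a where a: "a \<in> carrier A" "X = a_r_coset A (ext_ideal R A) a" using X by (auto simp: special_fibre_simps)
    show ?thesis unfolding a(2) fibre_map_coset[OF A C f a(1)] using res[OF a(1)] by (simp add: residue_def)
  qed
  ultimately show ?thesis unfolding deformation_morphism_def by blast
qed

lemma deformation_of_hom_residue:
  assumes def: "deformation_of_hom R (invariants G2) (invariants G1) (\<lambda>p. p) B \<psi> A \<phi> F"
    and base: "connected_base R"
  shows "graded_linear R B A F" "\<And>x y. x \<in> carrier B \<Longrightarrow> y \<in> carrier B \<Longrightarrow> F (x \<otimes>\<^bsub>B\<^esub> y) = F x \<otimes>\<^bsub>A\<^esub> F y"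
    "F \<one>\<^bsub>B\<^esub> = \<one>\<^bsub>A\<^esub>" "\<And>x. x \<in> carrier B \<Longrightarrow> residue R A \<phi> (F x) = residue R B \<psi> x"
proof -
  have A: "graded_over R A" and B: "graded_over R B"
    using def base by (auto simp: deformation_of_hom_def is_deformation_def graded_over_def)
  have gh: "graded_hom R B A F" using def by (simp add: deformation_of_hom_def)
  then have F: "F \<in> ring_hom B A" by (simp add: graded_hom_def)
  show lin: "graded_linear R B A F"
    using gh ring_hom_closed[OF F] ring_hom_add[OF F] unfolding graded_hom_def graded_linear_def by blast
  show "F (x \<otimes>\<^bsub>B\<^esub> y) = F x \<otimes>\<^bsub>A\<^esub> F y" if "x \<in> carrier B" "y \<in> carrier B" for x y
    using ring_hom_mult[OF F that] .
  show "F \<one>\<^bsub>B\<^esub> = \<one>\<^bsub>A\<^esub>" using ring_hom_one[OF F] .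
  show "residue R A \<phi> (F x) = residue R B \<psi> x" if x: "x \<in> carrier B" for x
  proof -
    have "a_r_coset B (ext_ideal R B) x \<in> carrier (special_fibre R B)" using x by (simp add: special_fibre_simps)
    then have "\<phi> (fibre_map R A F (a_r_coset B (ext_ideal R B) x)) = \<psi> (a_r_coset B (ext_ideal R B) x)"
      using def by (simp add: deformation_of_hom_def)
    then show ?thesis unfolding fibre_map_coset[OF B A lin x] by (simp add: residue_def)
  qed
qed

text \<open>
  The inverse preserves degrees because \<open>g\<close> commutes with taking homogeneous components.
\<close>

lemma graded_linear_inverse:
  assumes A: "graded_over R A" and C: "graded_over R C" and g: "graded_linear R A C g"
    and bij: "bij_betw g (carrier A) (carrier C)"
  shows "graded_linear R C A (inv_into (carrier A) g)"
proof -
  interpret A: graded_over R A by fact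
  interpret C: graded_over R C by fact
  note gD = graded_linearD[OF g]
  let ?h = "inv_into (carrier A) g"
  have h: "?h (g x) = x" if "x \<in> carrier A" for x using bij that by (simp add: bij_betw_def inv_into_f_f)
  have surj: "\<exists>x\<in>carrier A. y = g x" if "y \<in> carrier C" for y using bij that by (auto simp: bij_betw_def)
  have comp: "component C d (g x) = g (component A d x)" if "x \<in> carrier A" for x d
    using that
  proof (induction rule: A.alg.homog_induct)
    case zero
    have "g \<zero>\<^bsub>A\<^esub> = \<zero>\<^bsub>C\<^esub>" using gD(3)[of "\<zero>\<^bsub>R\<^esub>" "\<zero>\<^bsub>A\<^esub>"] gD(1)[of "\<zero>\<^bsub>A\<^esub>"] by simp
    then show ?case by (simp add: A.alg.component_zero C.alg.component_zero)
  next
    case (add e x y)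
    have g0: "g \<zero>\<^bsub>A\<^esub> = \<zero>\<^bsub>C\<^esub>" using gD(3)[of "\<zero>\<^bsub>R\<^esub>" "\<zero>\<^bsub>A\<^esub>"] gD(1)[of "\<zero>\<^bsub>A\<^esub>"] by simp
    note yc = A.alg.grade_carrier[OF add.hyps(2)]
    show ?case
      using add yc A.alg.component_carrier
      by (simp add: gD C.alg.component_add A.alg.component_add A.alg.component_homog[OF add.hyps(2)]
          C.alg.component_homog[OF gD(4)[OF add.hyps(2)]] g0)
  qed
  show ?thesis
    unfolding graded_linear_def
  proof (intro conjI ballI allI)
    fix y assume "y \<in> carrier C"
    then obtain x where x: "x \<in> carrier A" "y = g x" using surj by blast
    show "?h y \<in> carrier A" using x h by simp
    show "?h (r \<odot>\<^bsub>C\<^esub> y) = r \<odot>\<^bsub>A\<^esub> ?h y" if "r \<in> carrier R" for r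
      using h[of "r \<odot>\<^bsub>A\<^esub> x"] that x by (simp add: gD h)
    fix z assume "z \<in> carrier C"
    then obtain w where w: "w \<in> carrier A" "z = g w" using surj by blast
    show "?h (y \<oplus>\<^bsub>C\<^esub> z) = ?h y \<oplus>\<^bsub>A\<^esub> ?h z"
      using h[of "x \<oplus>\<^bsub>A\<^esub> w"] x w by (simp add: gD h)
  next
    fix d y assume y: "y \<in> grade C d"
    then obtain x where x: "x \<in> carrier A" "y = g x" using surj C.alg.grade_carrier by blast
    have "g (component A d x) = g x" using comp[OF x(1), of d] C.alg.component_homog[OF y, of d] x by simp
    then have "component A d x = x" using h A.alg.component_carrier x(1) by metis
    then show "?h y \<in> grade A d" using A.alg.component_props(1)[OF x(1), of d] x h by simp
  qed
qed

theorem theorem6p1: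
  fixes G\<^sub>1 G\<^sub>2 :: "(complex^2^2) set"
    and R :: "(complex, 'r) gr_alg"
    and \<B> :: "('r, 'b) gr_alg" and \<psi> :: "'b set \<Rightarrow> complex poly poly"
    and \<A>\<^sub>1 :: "('r, 'c) gr_alg" and \<phi>\<^sub>1 :: "'c set \<Rightarrow> complex poly poly"
    and \<A>\<^sub>2 :: "('r, 'd) gr_alg" and \<phi>\<^sub>2 :: "'d set \<Rightarrow> complex poly poly"
    and F\<^sub>1 :: "'b \<Rightarrow> 'c" and F\<^sub>2 :: "'b \<Rightarrow> 'd"
  assumes "subgroup G\<^sub>1 SL2" and "finite G\<^sub>1"
    and "subgroup G\<^sub>2 SL2" and "finite G\<^sub>2"
    and "G\<^sub>1 \<subseteq> G\<^sub>2"
    and "graded_algebra complex_base R"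
    and "bij_betw (\<lambda>c. c \<odot>\<^bsub>R\<^esub> \<one>\<^bsub>R\<^esub>) UNIV (grade R 0)"
    and "\<And>j. ring.finite_dimension R (grade R 0) (grade R j)"
    and "is_deformation R (invariants G\<^sub>2) \<B> \<psi>"
    and "deformation_of_hom R (invariants G\<^sub>2) (invariants G\<^sub>1) (\<lambda>p. p) \<B> \<psi> \<A>\<^sub>1 \<phi>\<^sub>1 F\<^sub>1"
    and "deformation_of_hom R (invariants G\<^sub>2) (invariants G\<^sub>1) (\<lambda>p. p) \<B> \<psi> \<A>\<^sub>2 \<phi>\<^sub>2 F\<^sub>2"
  shows "\<exists>g. deformation_isomorphism R \<A>\<^sub>1 \<phi>\<^sub>1 R \<A>\<^sub>2 \<phi>\<^sub>2 g \<and> (\<forall>b\<in>carrier \<B>. F\<^sub>2 b = g (F\<^sub>1 b))"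
proof -
  interpret G1: subgroup G\<^sub>1 SL2 by fact
  interpret G2: subgroup G\<^sub>2 SL2 by fact
  have SL2: "monoid.mult SL2 = (**)" "\<one>\<^bsub>SL2\<^esub> = mat 1" "carrier SL2 = {g. det g = 1}" by (simp_all add: SL2_def)
  interpret PQ: finite_SL2_pair G\<^sub>1 G\<^sub>2
    using assms(4,5) G1.one_closed G1.m_closed G2.m_closed G2.subset by unfold_locales (auto simp: SL2)
  interpret R: finite_base R
    using assms(6,7,8) by (intro finite_base.intro connected_base.intro connected_base_axioms.intro finite_base_axioms.intro)
  have P: "PQ.P = {p. \<forall>g\<in>G\<^sub>1. poly_act g p = p}" and Q: "PQ.Q = {p. \<forall>g\<in>G\<^sub>2. poly_act g p = p}"
    by (auto simp: PQ.P_def PQ.Q_def fixed_ring_def)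
  have d1: "is_deformation R (invariants G\<^sub>1) \<A>\<^sub>1 \<phi>\<^sub>1" and d2: "is_deformation R (invariants G\<^sub>1) \<A>\<^sub>2 \<phi>\<^sub>2"
    using assms(10,11) by (auto simp: deformation_of_hom_def)
  have over: "graded_over R \<A>\<^sub>1" "graded_over R \<A>\<^sub>2" "graded_over R \<B>"
    using d1 d2 assms(9) R.connected_base_axioms by (auto simp: is_deformation_def graded_over_def)
  let ?p1 = "residue R \<A>\<^sub>1 \<phi>\<^sub>1" and ?p2 = "residue R \<A>\<^sub>2 \<phi>\<^sub>2" and ?pB = "residue R \<B> \<psi>"
  have fib: "fibred R \<A>\<^sub>1 ?p1 PQ.P" "fibred R \<A>\<^sub>2 ?p2 PQ.P" "fibred R \<B> ?pB PQ.Q"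
    unfolding P Q using over d1 d2 assms(9)
    by (auto intro!: graded_over.fibred_residue simp: is_deformation_def)
  have ff: "flat_fibred R \<A>\<^sub>1 ?p1 PQ.P" "flat_fibred R \<A>\<^sub>2 ?p2 PQ.P"
    using fib d1 d2 R.finite_base_axioms
    by (auto intro!: flat_fibred.intro flat_fibred_axioms.intro simp: is_deformation_def)
  obtain Bs dg where Bs: "Bs \<subseteq> PQ.P" "\<And>b. b \<in> Bs \<Longrightarrow> homog (dg b) b"
    "\<And>T c b. finite T \<Longrightarrow> T \<subseteq> Bs \<Longrightarrow> (\<Sum>b\<in>T. const2 (c b) * b) = 0 \<Longrightarrow> b \<in> T \<Longrightarrow> c b = 0"
    "\<And>p d. p \<in> PQ.P \<Longrightarrow> homog d p \<Longrightarrow>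
      \<exists>T c. finite T \<and> T \<subseteq> Bs \<and> (\<forall>b\<in>T. dg b = d) \<and> p = (\<Sum>b\<in>T. const2 (c b) * b)"
    by (rule homogeneous_basis[of PQ.P]) blast
  have bf: "based_fibred R \<A>\<^sub>1 ?p1 PQ.P Bs dg" "based_fibred R \<A>\<^sub>2 ?p2 PQ.P Bs dg"
    using Bs by (auto intro!: based_fibred.intro based_fibred_axioms.intro ff)
  note F1 = deformation_of_hom_residue[OF assms(10) R.connected_base_axioms]
  note F2 = deformation_of_hom_residue[OF assms(11) R.connected_base_axioms]
  interpret two_deformations G\<^sub>1 G\<^sub>2 R \<A>\<^sub>1 ?p1 \<A>\<^sub>2 ?p2 \<B> ?pB Bs dg F\<^sub>1 F\<^sub>2
    using F1 F2 by (intro two_deformations.intro two_deformations_axioms.intro PQ.finite_SL2_pair_axioms bf fib)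
  obtain g where g: "graded_linear R \<A>\<^sub>1 \<A>\<^sub>2 g"
    and \<pi>: "\<And>x. x \<in> carrier \<A>\<^sub>1 \<Longrightarrow> ?p2 (g x) = ?p1 x"
    and mult: "\<And>x y. x \<in> carrier \<A>\<^sub>1 \<Longrightarrow> y \<in> carrier \<A>\<^sub>1 \<Longrightarrow> g (x \<otimes>\<^bsub>\<A>\<^sub>1\<^esub> y) = g x \<otimes>\<^bsub>\<A>\<^sub>2\<^esub> g y"
    and gF: "\<And>b. b \<in> carrier \<B> \<Longrightarrow> g (F\<^sub>1 b) = F\<^sub>2 b"
    and bij: "bij_betw g (carrier \<A>\<^sub>1) (carrier \<A>\<^sub>2)"
    by (rule isomorphism_exists) blast
  have one: "g \<one>\<^bsub>\<A>\<^sub>1\<^esub> = \<one>\<^bsub>\<A>\<^sub>2\<^esub>" using gF[of "\<one>\<^bsub>\<B>\<^esub>"] F1(3) F2(3) by simp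
  define h where "h = inv_into (carrier \<A>\<^sub>1) g"
  have hg: "h (g x) = x" if "x \<in> carrier \<A>\<^sub>1" for x
    using bij that by (simp add: h_def bij_betw_def inv_into_f_f)
  have gh: "g (h y) = y" "h y \<in> carrier \<A>\<^sub>1" if "y \<in> carrier \<A>\<^sub>2" for y
    using bij that by (auto simp: h_def bij_betw_def f_inv_into_f inv_into_into)
  have "deformation_morphism R \<A>\<^sub>1 \<phi>\<^sub>1 R \<A>\<^sub>2 \<phi>\<^sub>2 g"
    by (rule deformation_morphismI[OF over(1,2) g mult one \<pi>])
  moreover have "deformation_morphism R \<A>\<^sub>2 \<phi>\<^sub>2 R \<A>\<^sub>1 \<phi>\<^sub>1 h"
  proof (rule deformation_morphismI[OF over(2,1)])
    show "graded_linear R \<A>\<^sub>2 \<A>\<^sub>1 h" unfolding h_def by (rule graded_linear_inverse[OF over(1,2) g bij])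
    show "h (x \<otimes>\<^bsub>\<A>\<^sub>2\<^esub> y) = h x \<otimes>\<^bsub>\<A>\<^sub>1\<^esub> h y" if "x \<in> carrier \<A>\<^sub>2" "y \<in> carrier \<A>\<^sub>2" for x y
      using hg[of "h x \<otimes>\<^bsub>\<A>\<^sub>1\<^esub> h y"] mult[of "h x" "h y"] gh[OF that(1)] gh[OF that(2)] by simp
    show "h \<one>\<^bsub>\<A>\<^sub>2\<^esub> = \<one>\<^bsub>\<A>\<^sub>1\<^esub>" using hg[of "\<one>\<^bsub>\<A>\<^sub>1\<^esub>"] one by simp
    show "?p1 (h x) = ?p2 x" if "x \<in> carrier \<A>\<^sub>2" for x
      using \<pi>[of "h x"] gh[OF that] by simp
  qed
  ultimately have "deformation_isomorphism R \<A>\<^sub>1 \<phi>\<^sub>1 R \<A>\<^sub>2 \<phi>\<^sub>2 g"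
    unfolding deformation_isomorphism_def using hg gh(1) by blast
  then show ?thesis using gF by metis
qed

end
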